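(* Let $k$ be a field, $R$ a standard graded $k$-algebra and $h_R(z)$ its $h$-polynomial. Let $a\in\mathbb N$ be the order of vanishing of $h_R(z)$ at $-1$, so that $h_R(z)=g(z)(1+z)^a$ with $g(z)\in\mathbb Z[z]$ and $g(-1)\ne0$. If $R$ is Koszul with the Backelin-Roos property and $R$ is not a complete intersection, then $g(-1)<0$.
   Context: A standard graded $k$-algebra is a commutative graded ring $R=\bigoplus_{i\ge 0}R_i$ with $R_0=k$, generated as a $k$-algebra by $R_1$, with $\dim_k R_1<\infty$; morphisms are homomorphisms of graded $k$-algebras. The $h$-polynomial $h_R(z)\in\mathbb Z[z]$ is defined by $\sum_{i\ge0}(\dim_kR_i)z^i=h_R(z)/(1-z)^{\dim R}$. For a finitely generated graded $R$-module $M$ let $\beta^R_{i,j}(M)=\dim_k \operatorname{Tor}^R_i(k,M)_j$ and $P^R_M(s,z)=\sum_{i,j}\beta^R_{i,j}(M)s^jz^i$. $R$ is Koszul if $\beta^R_{i,j}(k)=0$ for all $i\ne j$. $R$ is a complete intersection if it is a quotient of a standard graded polynomial ring by an ideal generated by a homogeneous regular sequence. Golod morphisms: let $\varphi\colon Q\to R$ be a surjective morphism of standard graded $k$-algebras with $\operatorname{Ker}\varphi\subseteq (Q_{\ge 1})^2$. There is always a coefficientwise inequality $P^R_k(s,z)\preccurlyeq \frac{P^Q_k(s,z)}{1-z(P^Q_R(s,z)-1)}$; $\varphi$ is Golod if equality holds. $R$ has the Backelin-Roos property if there is a surjective Golod morphism $Q\to R$ with $Q$ a standard graded complete intersection ring.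 *)

theory Defs
  imports
    "HOL-Library.Poly_Mapping"
    "HOL-Library.Extended_Nat"
    "HOL-Computational_Algebra.Computational_Algebra"
begin

text \<open>
  The ring is the whole type \<open>'a\<close>. Ideals of a commutative ring are its submodules
  (\<open>module.subspace (*)\<close>) and generated ideals are spans (\<open>module.span (*)\<close>).
\<close>

record ('k, 'a) graded_algebra =
  smul :: "'k \<Rightarrow> 'a \<Rightarrow> 'a"
  part :: "nat \<Rightarrow> 'a set"

definition direct_sum_decomposition :: "(nat \<Rightarrow> 'a::ab_group_add set) \<Rightarrow> bool" where
  "direct_sum_decomposition G \<longleftrightarrow>
     (\<forall>x. \<exists>!c :: nat \<Rightarrow>\<^sub>0 'a.
        (\<forall>i. Poly_Mapping.lookup c i \<in> G i) \<and>
        (\<Sum>i\<in>Poly_Mapping.keys c. Poly_Mapping.lookup c i) = x)"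

definition is_subalgebra ::
    "('k::field, 'a::comm_ring_1) graded_algebra \<Rightarrow> 'a set \<Rightarrow> bool" where
  "is_subalgebra R S \<longleftrightarrow>
     module.subspace (smul R) S \<and> 1 \<in> S \<and> (\<forall>x\<in>S. \<forall>y\<in>S. x * y \<in> S)"

definition standard_graded :: "('k::field, 'a::comm_ring_1) graded_algebra \<Rightarrow> bool" where
  "standard_graded R \<longleftrightarrow>
     vector_space (smul R) \<and>
     (\<forall>c x y. smul R c (x * y) = smul R c x * y) \<and>
     (\<forall>i. module.subspace (smul R) (part R i)) \<and>
     direct_sum_decomposition (part R) \<and>
     (\<forall>i j. \<forall>x\<in>part R i. \<forall>y\<in>part R j. x * y \<in> part R (i + j)) \<and>
     part R 0 = range (\<lambda>c. smul R c 1) \<and>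
     (\<forall>S. is_subalgebra R S \<and> part R 1 \<subseteq> S \<longrightarrow> S = UNIV) \<and>
     (\<exists>B. finite B \<and> part R 1 = module.span (smul R) B)"

definition graded_morphism ::
    "('k::field, 'q::comm_ring_1) graded_algebra \<Rightarrow> ('k, 'a::comm_ring_1) graded_algebra
     \<Rightarrow> ('q \<Rightarrow> 'a) \<Rightarrow> bool" where
  "graded_morphism Q R \<phi> \<longleftrightarrow>
     (\<forall>x y. \<phi> (x + y) = \<phi> x + \<phi> y) \<and>
     (\<forall>x y. \<phi> (x * y) = \<phi> x * \<phi> y) \<and>
     \<phi> 1 = 1 \<and>
     (\<forall>c x. \<phi> (smul Q c x) = smul R c (\<phi> x)) \<and>
     (\<forall>i. \<phi> ` part Q i \<subseteq> part R i)"

definition irrelevant_ideal :: "('k, 'a::comm_ring_1) graded_algebra \<Rightarrow> 'a set" where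
  "irrelevant_ideal R = module.span (*) (\<Union>i\<in>{1..}. part R i)"

text \<open>The projection \<open>R \<rightarrow> R / R\<^sub>\<ge>\<^sub>1 = k\<close>.\<close>
definition augmentation :: "('k::field, 'a::comm_ring_1) graded_algebra \<Rightarrow> 'a \<Rightarrow> 'k" where
  "augmentation R x = (THE c. x - smul R c 1 \<in> irrelevant_ideal R)"

definition prime_ideal :: "'a::comm_ring_1 set \<Rightarrow> bool" where
  "prime_ideal P \<longleftrightarrow>
     module.subspace (*) P \<and> P \<noteq> UNIV \<and> (\<forall>x y. x * y \<in> P \<longrightarrow> x \<in> P \<or> y \<in> P)"

definition krull_dim :: "'a::comm_ring_1 itself \<Rightarrow> enat" where
  "krull_dim T = Sup {enat n | n. \<exists>P :: nat \<Rightarrow> 'a set.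
     (\<forall>i\<le>n. prime_ideal (P i)) \<and> (\<forall>i<n. P i \<subset> P (Suc i))}"

definition hilbert_series :: "('k::field, 'a::comm_ring_1) graded_algebra \<Rightarrow> int fps" where
  "hilbert_series R = Abs_fps (\<lambda>i. int (vector_space.dim (smul R) (part R i)))"

text \<open>
  The h-polynomial is the (unique) \<open>h\<close> with this property;
  \<open>1 - z\<close> is invertible as a power series, so the denominator has been cleared.
\<close>
definition is_h_polynomial ::
    "('k::field, 'a::comm_ring_1) graded_algebra \<Rightarrow> int poly \<Rightarrow> bool" where
  "is_h_polynomial R h \<longleftrightarrow>
     (\<exists>d. krull_dim TYPE('a) = enat d \<and>
          hilbert_series R * (1 - fps_X) ^ d = fps_of_poly h)"

record ('a, 'm) graded_module =
  mscale :: "'a \<Rightarrow> 'm \<Rightarrow> 'm"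
  mpart :: "nat \<Rightarrow> 'm set"

text \<open>
  The free module with basis \<open>e\<^sub>b\<close>, \<open>b \<in> B\<close>, consists of the \<open>v :: nat \<Rightarrow>\<^sub>0 'a\<close> with
  \<open>keys v \<subseteq> B\<close>. \<open>lin_ext\<close> extends \<open>e\<^sub>b \<mapsto> f b\<close> linearly.
\<close>

definition free_mod :: "nat set \<Rightarrow> (nat \<Rightarrow>\<^sub>0 'a::zero) set" where
  "free_mod B = {v. Poly_Mapping.keys v \<subseteq> B}"

definition vscale :: "'a::comm_ring_1 \<Rightarrow> (nat \<Rightarrow>\<^sub>0 'a) \<Rightarrow> (nat \<Rightarrow>\<^sub>0 'a)" where
  "vscale r = Poly_Mapping.map ((*) r)"

definition lin_ext ::
    "('a::zero \<Rightarrow> 'm \<Rightarrow> 'm::comm_monoid_add) \<Rightarrow> (nat \<Rightarrow> 'm) \<Rightarrow> (nat \<Rightarrow>\<^sub>0 'a) \<Rightarrow> 'm" where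
  "lin_ext sc f v = (\<Sum>b\<in>Poly_Mapping.keys v. sc (Poly_Mapping.lookup v b) (f b))"

text \<open>
  Data of a graded free complex \<open>\<dots> \<rightarrow> F\<^sub>1 \<rightarrow> F\<^sub>0 \<rightarrow> M\<close>: \<open>F\<^sub>i\<close> has basis \<open>basis i\<close>, the basis element
  \<open>e\<^sub>b\<close> has degree \<open>bdeg i b\<close>, \<open>bdry i b \<in> F\<^sub>i\<close> is the image of the basis element
  \<open>e\<^sub>b\<close> of \<open>F\<^sub>i\<^sub>+\<^sub>1\<close> (note the index shift), and \<open>aug b \<in> M\<close> is the image of the basis element \<open>e\<^sub>b\<close> of \<open>F\<^sub>0\<close>.
\<close>

record (overloaded) ('a, 'm) free_complex =
  basis :: "nat \<Rightarrow> nat set"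
  bdeg :: "nat \<Rightarrow> nat \<Rightarrow> nat"
  bdry :: "nat \<Rightarrow> nat \<Rightarrow> (nat \<Rightarrow>\<^sub>0 'a)"
  aug :: "nat \<Rightarrow> 'm"

text \<open>
  Finiteness is required degreewise only; every free module of finite rank qualifies, and so does
  every graded free module (generated in degrees \<open>\<ge> 0\<close>) with finite-dimensional components.
\<close>
definition graded_free_resolution ::
    "('k::field, 'a::comm_ring_1) graded_algebra \<Rightarrow> ('a, 'm::ab_group_add) graded_module
     \<Rightarrow> ('a, 'm) free_complex \<Rightarrow> bool" where
  "graded_free_resolution R M F \<longleftrightarrow>
     (\<forall>i j. finite {b \<in> basis F i. bdeg F i b = j}) \<and>
     (\<forall>b\<in>basis F 0. aug F b \<in> mpart M (bdeg F 0 b)) \<and>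
     (\<forall>i. \<forall>b\<in>basis F (Suc i). bdry F i b \<in> free_mod (basis F i) \<and>
        (\<forall>p\<in>Poly_Mapping.keys (bdry F i b). bdeg F i p \<le> bdeg F (Suc i) b \<and>
           Poly_Mapping.lookup (bdry F i b) p \<in> part R (bdeg F (Suc i) b - bdeg F i p))) \<and>
     lin_ext (mscale M) (aug F) ` free_mod (basis F 0) = UNIV \<and>
     {v \<in> free_mod (basis F 0). lin_ext (mscale M) (aug F) v = 0}
       = lin_ext vscale (bdry F 0) ` free_mod (basis F 1) \<and>
     (\<forall>i. {v \<in> free_mod (basis F (Suc i)). lin_ext vscale (bdry F i) v = 0}
       = lin_ext vscale (bdry F (Suc i)) ` free_mod (basis F (Suc (Suc i))))"

text \<open>
  The complex \<open>k \<otimes>\<^sub>R F\<close> consists of the vector spaces \<open>k \<otimes>\<^sub>R F\<^sub>i\<close> with basis \<open>basis F i\<close> over \<open>k\<close>,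
  and its maps are obtained by applying \<open>R \<rightarrow> k\<close> to the matrix entries.
\<close>

definition tensor_bdry ::
    "('k::field, 'a::comm_ring_1) graded_algebra \<Rightarrow> ('a, 'm) free_complex
     \<Rightarrow> nat \<Rightarrow> (nat \<Rightarrow>\<^sub>0 'k) \<Rightarrow> (nat \<Rightarrow>\<^sub>0 'k)" where
  "tensor_bdry R F i = lin_ext vscale (\<lambda>b. Poly_Mapping.map (augmentation R) (bdry F i b))"

definition tensor_part :: "('a, 'm) free_complex \<Rightarrow> nat \<Rightarrow> nat \<Rightarrow> (nat \<Rightarrow>\<^sub>0 'k::field) set" where
  "tensor_part F i j = free_mod {b \<in> basis F i. bdeg F i b = j}"

definition tensor_cycles ::
    "('k::field, 'a::comm_ring_1) graded_algebra \<Rightarrow> ('a, 'm) free_complex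
     \<Rightarrow> nat \<Rightarrow> nat \<Rightarrow> (nat \<Rightarrow>\<^sub>0 'k) set" where
  "tensor_cycles R F i j = (case i of
       0 \<Rightarrow> tensor_part F 0 j
     | Suc l \<Rightarrow> {v \<in> tensor_part F (Suc l) j. tensor_bdry R F l v = 0})"

definition tensor_boundaries ::
    "('k::field, 'a::comm_ring_1) graded_algebra \<Rightarrow> ('a, 'm) free_complex
     \<Rightarrow> nat \<Rightarrow> nat \<Rightarrow> (nat \<Rightarrow>\<^sub>0 'k) set" where
  "tensor_boundaries R F i j = tensor_bdry R F i ` tensor_part F (Suc i) j"

text \<open>
  The dimension of \<open>Tor\<^sub>i(k, M)\<^sub>j = H\<^sub>i(k \<otimes>\<^sub>R F)\<^sub>j\<close>, for a graded free resolution \<open>F\<close> of \<open>M\<close>.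
  The result does not depend on \<open>F\<close>, and all \<open>(k \<otimes>\<^sub>R F\<^sub>i)\<^sub>j\<close> are finite-dimensional.
\<close>
definition betti ::
    "('k::field, 'a::comm_ring_1) graded_algebra \<Rightarrow> ('a, 'm::ab_group_add) graded_module
     \<Rightarrow> nat \<Rightarrow> nat \<Rightarrow> nat" where
  "betti R M i j =
     (let F = (SOME F. graded_free_resolution R M F) in
        vector_space.dim vscale (tensor_cycles R F i j)
        - vector_space.dim vscale (tensor_boundaries R F i j))"

text \<open>Outer variable \<open>z\<close> (homological degree), inner variable \<open>s\<close> (internal degree).\<close>
definition poincare_series ::
    "('k::field, 'a::comm_ring_1) graded_algebra \<Rightarrow> ('a, 'm::ab_group_add) graded_module
     \<Rightarrow> int fps fps" where
  "poincare_series R M = Abs_fps (\<lambda>i. Abs_fps (\<lambda>j. int (betti R M i j)))"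

definition residue_field ::
    "('k::field, 'a::comm_ring_1) graded_algebra \<Rightarrow> ('a, 'k) graded_module" where
  "residue_field R =
     \<lparr> mscale = (\<lambda>x c. augmentation R x * c),
       mpart = (\<lambda>j. if j = 0 then UNIV else {0}) \<rparr>"

definition restrict_scalars ::
    "('q \<Rightarrow> 'a) \<Rightarrow> ('k::field, 'a::comm_ring_1) graded_algebra \<Rightarrow> ('q, 'a) graded_module" where
  "restrict_scalars \<phi> R = \<lparr> mscale = (\<lambda>x y. \<phi> x * y), mpart = part R \<rparr>"

definition koszul :: "('k::field, 'a::comm_ring_1) graded_algebra \<Rightarrow> bool" where
  "koszul R \<longleftrightarrow> (\<forall>i j. i \<noteq> j \<longrightarrow> betti R (residue_field R) i j = 0)"

text \<open>
  \<open>poly_ring n\<close> is the polynomial ring over \<open>'k\<close> in the variables with index less than \<open>n\<close>,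
  inside the polynomial ring in countably many variables.
\<close>

definition poly_ring :: "nat \<Rightarrow> ((nat \<Rightarrow>\<^sub>0 nat) \<Rightarrow>\<^sub>0 'k::field) set" where
  "poly_ring n = {p. \<forall>m\<in>Poly_Mapping.keys p. Poly_Mapping.keys m \<subseteq> {..<n}}"

definition poly_part :: "nat \<Rightarrow> nat \<Rightarrow> ((nat \<Rightarrow>\<^sub>0 nat) \<Rightarrow>\<^sub>0 'k::field) set" where
  "poly_part n d = {p \<in> poly_ring n. \<forall>m\<in>Poly_Mapping.keys p.
     (\<Sum>i\<in>Poly_Mapping.keys m. Poly_Mapping.lookup m i) = d}"

definition poly_ideal ::
    "nat \<Rightarrow> ((nat \<Rightarrow>\<^sub>0 nat) \<Rightarrow>\<^sub>0 'k::field) list \<Rightarrow> ((nat \<Rightarrow>\<^sub>0 nat) \<Rightarrow>\<^sub>0 'k) set" where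
  "poly_ideal n fs = {\<Sum>i<length fs. c i * fs ! i | c. \<forall>i. c i \<in> poly_ring n}"

definition homogeneous_regular_sequence ::
    "nat \<Rightarrow> ((nat \<Rightarrow>\<^sub>0 nat) \<Rightarrow>\<^sub>0 'k::field) list \<Rightarrow> bool" where
  "homogeneous_regular_sequence n fs \<longleftrightarrow>
     (\<forall>f\<in>set fs. \<exists>d. f \<in> poly_part n d) \<and>
     (\<forall>i<length fs. \<forall>p\<in>poly_ring n.
        fs ! i * p \<in> poly_ideal n (take i fs) \<longrightarrow> p \<in> poly_ideal n (take i fs)) \<and>
     poly_ideal n fs \<noteq> poly_ring n"

text \<open>
  A surjective morphism of graded \<open>k\<close>-algebras from the polynomial ring; values of \<open>\<pi>\<close>
  outside \<open>poly_ring n\<close> are irrelevant.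
\<close>
definition poly_presentation ::
    "nat \<Rightarrow> ('k::field, 'a::comm_ring_1) graded_algebra
     \<Rightarrow> (((nat \<Rightarrow>\<^sub>0 nat) \<Rightarrow>\<^sub>0 'k) \<Rightarrow> 'a) \<Rightarrow> bool" where
  "poly_presentation n R \<pi> \<longleftrightarrow>
     (\<forall>p\<in>poly_ring n. \<forall>q\<in>poly_ring n. \<pi> (p + q) = \<pi> p + \<pi> q) \<and>
     (\<forall>p\<in>poly_ring n. \<forall>q\<in>poly_ring n. \<pi> (p * q) = \<pi> p * \<pi> q) \<and>
     (\<forall>c. \<pi> (Poly_Mapping.single 0 c) = smul R c 1) \<and>
     (\<forall>d. \<pi> ` poly_part n d \<subseteq> part R d) \<and>
     \<pi> ` poly_ring n = UNIV"

definition complete_intersection :: "('k::field, 'a::comm_ring_1) graded_algebra \<Rightarrow> bool" where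
  "complete_intersection R \<longleftrightarrow>
     (\<exists>n fs \<pi>. homogeneous_regular_sequence n fs \<and> poly_presentation n R \<pi> \<and>
        {p \<in> poly_ring n. \<pi> p = 0} = poly_ideal n fs)"

text \<open>
  The last conjunct is \<open>P\<^sup>R\<^sub>k = P\<^sup>Q\<^sub>k / (1 - z (P\<^sup>Q\<^sub>R - 1))\<close>; the denominator has constant coefficient 1
  with respect to \<open>z\<close>, hence is a unit.
\<close>
definition golod ::
    "('k::field, 'q::comm_ring_1) graded_algebra \<Rightarrow> ('k, 'a::comm_ring_1) graded_algebra
     \<Rightarrow> ('q \<Rightarrow> 'a) \<Rightarrow> bool" where
  "golod Q R \<phi> \<longleftrightarrow>
     graded_morphism Q R \<phi> \<and> surj \<phi> \<and>
     {x. \<phi> x = 0} \<subseteq>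
       module.span (*) {x * y | x y. x \<in> irrelevant_ideal Q \<and> y \<in> irrelevant_ideal Q} \<and>
     poincare_series R (residue_field R)
       * (1 - fps_X * (poincare_series Q (restrict_scalars \<phi> R) - 1))
     = poincare_series Q (residue_field Q)"

text \<open>
  The ring \<open>Q\<close> ranges over the commutative rings with underlying type \<open>'q\<close>; a theorem assuming
  \<open>backelin_roos TYPE('q) R\<close> is polymorphic in \<open>'q\<close> and therefore covers all \<open>Q\<close>.
\<close>
definition backelin_roos ::
    "'q::comm_ring_1 itself \<Rightarrow> ('k::field, 'a::comm_ring_1) graded_algebra \<Rightarrow> bool" where
  "backelin_roos T R \<longleftrightarrow>
     (\<exists>(Q :: ('k, 'q) graded_algebra) \<phi>.
        standard_graded Q \<and> complete_intersection Q \<and> golod Q R \<phi>)"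

end

theory Submission
  imports Defs "HOL-Analysis.FPS_Convergence"
begin

text \<open>
  Write \<open>H\<^sub>R\<close> for the Hilbert series of \<open>R\<close>, \<open>P\<^sup>R\<^sub>k\<close> for the Poincare series of \<open>k\<close>, and let \<open>Q \<rightarrow> R\<close> be the given Golod
  morphism with kernel \<open>I\<close>. Suppose that \<open>g(-1) > 0\<close>; it is to be shown that \<open>R\<close> is a complete
  intersection.

  The Golod equality reads \<open>P\<^sup>R\<^sub>k = P\<^sup>Q\<^sub>k + z P\<^sup>R\<^sub>k (P\<^sup>Q\<^sub>R - 1)\<close>, and all coefficients in it are non-negative. As \<open>R\<close> is
  Koszul, \<open>P\<^sup>R\<^sub>k\<close> lives on the diagonal. Hence so does \<open>P\<^sup>Q\<^sub>k\<close>, which means that \<open>Q\<close> is Koszul, and the only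
  nonzero coefficients of \<open>P\<^sup>Q\<^sub>R - 1\<close> are those \<open>t\<^sub>i\<close> in homological degree \<open>i\<close> and internal degree \<open>i + 1\<close>. For a
  Koszul algebra the product of the Hilbert series and the alternating diagonal Poincare series is
  1 (\<open>koszul_hilbert_series\<close>). With \<open>N(z) = \<Sum>\<^sub>i t\<^sub>i z\<^bsup>i+1\<^esup>\<close> this yields \<open>H\<^sub>R(z) = H\<^sub>Q(z) (1 - N(-z))\<close>
  (\<open>golod_koszul\<close>).

  Since \<open>Q\<close> is a complete intersection, \<open>H\<^sub>Q(z) = (\<Prod>\<^sub>i (1 - z\<^bsup>d\<^sub>i\<^esup>)) / (1 - z)\<^sup>n\<close>, and therefore \<open>1 - N(x)\<close> is a positive
  multiple of \<open>h\<^sub>R(-x) = g(-x) (1 - x)\<^sup>a\<close> for \<open>0 < x < 1\<close>. So \<open>g(-1) > 0\<close> forces \<open>N(x) < 1\<close> for \<open>x\<close> near 1. The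
  coefficients of \<open>N\<close> being non-negative integers, \<open>N\<close> is zero or a single power \<open>z\<^sup>m\<close>
  (\<open>positive_value_imp_monomial\<close>).

  If \<open>N = 0\<close>, then \<open>Q\<close> and \<open>R\<close> have the same Hilbert series and \<open>I = 0\<close>. If \<open>N = z\<^sup>m\<close>, recall that
  the first Betti numbers of \<open>R\<close> over \<open>Q\<close> count the generators of \<open>I\<close>: they vanish outside degree 2, and
  there the number is the coefficient of \<open>N\<close> at \<open>z\<^sup>2\<close>. For \<open>m \<noteq> 2\<close> there are none and \<open>I = 0\<close>. For \<open>m = 2\<close> the
  ideal is generated by one quadric, which is a nonzerodivisor because \<open>H\<^sub>R(z) = H\<^sub>Q(z) (1 - z\<^sup>2)\<close>
  (\<open>ker_principal_regular\<close>). In each case \<open>R\<close> is a complete intersection together with \<open>Q\<close>.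

  Betti numbers are defined by an arbitrary, possibly non-minimal resolution. Such resolutions exist
  because a \<open>k\<close>-basis of each component can be taken as generators (\<open>exists_graded_free_resolution\<close>). The
  facts about Tor that the argument needs are extracted from a single resolution: Nakayama's lemma
  bounds the syzygies from below (\<open>free_summand_le_syzygies\<close>), which suffices for the Euler
  characteristic, and a lift of the augmentation to \<open>Q\<close> embeds \<open>I\<close> modulo \<open>m I\<close> into Tor
  (\<open>ker_in_irrelevant_times_ker\<close>).
\<close>

abbreviation "lookup \<equiv> Poly_Mapping.lookup"
abbreviation "keys \<equiv> Poly_Mapping.keys"
abbreviation "single \<equiv> Poly_Mapping.single"

section \<open>Dimension counts in finite-dimensional subspaces\<close>

text \<open>
  The algebras and free modules below are in general infinite-dimensional, so finiteness is a property of the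
  subspace that is measured.
\<close>
definition fin_dim :: "('k::field \<Rightarrow> 'b::ab_group_add \<Rightarrow> 'b) \<Rightarrow> 'b set \<Rightarrow> bool" where
  "fin_dim s V \<longleftrightarrow> (\<exists>S. finite S \<and> V \<subseteq> module.span s S)"

context vector_space
begin

lemma fin_dim_subset: "fin_dim scale V \<Longrightarrow> U \<subseteq> V \<Longrightarrow> fin_dim scale U"
  unfolding fin_dim_def by blast

lemma fin_dim_basis:
  assumes "fin_dim scale V" "subspace V"
  obtains B where "finite B" "B \<subseteq> V" "independent B" "span B = V" "card B = dim V"
proof -
  obtain S where S: "finite S" "V \<subseteq> span S" using assms(1) unfolding fin_dim_def by blast
  obtain B where B: "B \<subseteq> V" "independent B" "V \<subseteq> span B" "card B = dim V"
    using basis_exists by blast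
  have "finite B" using independent_span_bound[OF S(1) B(2)] B(1) S(2) by blast
  moreover have "span B = V" using B(1,3) assms(2) by (simp add: span_minimal subset_antisym)
  ultimately show ?thesis using B that by blast
qed

lemma dim_mono_fin_dim:
  assumes "fin_dim scale V" "subspace V" "U \<subseteq> V"
  shows "dim U \<le> dim V"
proof -
  obtain B where "finite B" "span B = V" "card B = dim V"
    using fin_dim_basis[OF assms(1,2)] by metis
  then show ?thesis using dim_le_card[of U B] assms(3) by simp
qed

lemma subspace_eq_of_dim_ge:
  assumes "fin_dim scale V" "subspace V" "subspace U" "U \<subseteq> V" "dim V \<le> dim U"
  shows "U = V"
proof -
  obtain A where A: "finite A" "A \<subseteq> U" "independent A" "span A = U" "card A = dim U"
    using fin_dim_basis[OF fin_dim_subset[OF assms(1,4)] assms(3)] by metis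
  obtain B where B: "A \<subseteq> B" "B \<subseteq> V" "independent B" "V \<subseteq> span B"
    using maximal_independent_subset_extend[of A V] A assms(4) by blast
  have "card B = dim V" using basis_card_eq_dim[OF B(2,4,3)] .
  moreover have "finite B"
    using assms(1) independent_span_bound B(2,3) unfolding fin_dim_def by blast
  ultimately have "A = B" using A(5) assms(5) B(1) card_seteq by metis
  then show ?thesis using A(4) B(4) assms(4) by blast
qed

lemma dim_le_add:
  assumes "fin_dim scale U" "subspace U" "fin_dim scale W" "subspace W"
    and "\<And>v. v \<in> V \<Longrightarrow> \<exists>u\<in>U. \<exists>w\<in>W. v = u + w"
  shows "dim V \<le> dim U + dim W"
proof -
  obtain A where A: "finite A" "span A = U" "card A = dim U"
    using fin_dim_basis[OF assms(1,2)] by metis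
  obtain B where B: "finite B" "span B = W" "card B = dim W"
    using fin_dim_basis[OF assms(3,4)] by metis
  have "V \<subseteq> span (A \<union> B)"
  proof
    fix v assume "v \<in> V"
    then obtain u w where "u \<in> span A" "w \<in> span B" "v = u + w" using assms(5) A(2) B(2) by blast
    then show "v \<in> span (A \<union> B)"
      using span_mono[of A "A \<union> B"] span_mono[of B "A \<union> B"] span_add by blast
  qed
  then have "dim V \<le> card (A \<union> B)" using dim_le_card A(1) B(1) by simp
  then show ?thesis using card_Un_le[of A B] A(3) B(3) by linarith
qed

lemma fin_dim_0_iff:
  assumes "fin_dim scale V" "subspace V"
  shows "dim V = 0 \<longleftrightarrow> V = {0}"
proof
  assume *: "dim V = 0"
  obtain B where "finite B" "span B = V" "card B = dim V" using fin_dim_basis[OF assms] by metis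
  then show "V = {0}" using * by auto
next
  assume *: "V = {0}"
  then have "V \<subseteq> span {}" by simp
  then show "dim V = 0" using dim_le_card[of V "{}"] by simp
qed

end

context vector_space_pair
begin

lemma fin_dim_image:
  assumes "Vector_Spaces.linear s1 s2 f" "fin_dim s1 V"
  shows "fin_dim s2 (f ` V)"
proof -
  interpret f: Vector_Spaces.linear s1 s2 f by fact
  obtain S where S: "finite S" "V \<subseteq> vs1.span S" using assms(2) unfolding fin_dim_def by blast
  have "f ` V \<subseteq> vs2.span (f ` S)" using S(2) f.span_image[of S] by blast
  then show ?thesis unfolding fin_dim_def using S(1) by blast
qed

text \<open>
  The subspace \<open>V\<close> will be a single degree component of the domain of a homogeneous map.
\<close>
lemma rank_nullity:
  assumes "Vector_Spaces.linear s1 s2 f" "vs1.subspace V" "fin_dim s1 V"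
  shows "vs1.dim V = vs2.dim (f ` V) + vs1.dim {v \<in> V. f v = 0}"
proof -
  interpret f: Vector_Spaces.linear s1 s2 f by fact
  let ?K = "{v \<in> V. f v = 0}"
  have K: "vs1.subspace ?K"
    using assms(2) by (auto simp: vs1.subspace_def f.zero f.add f.scale)
  obtain A where A: "finite A" "A \<subseteq> ?K" "vs1.independent A" "vs1.span A = ?K"
    using vs1.fin_dim_basis[OF vs1.fin_dim_subset[OF assms(3)] K] by (metis (no_types, lifting) mem_Collect_eq subsetI)
  obtain B where B: "A \<subseteq> B" "B \<subseteq> V" "vs1.independent B" "V \<subseteq> vs1.span B"
    using vs1.maximal_independent_subset_extend[of A V] A by blast
  have finB: "finite B"
    using assms(3) vs1.independent_span_bound B(2,3) unfolding fin_dim_def by blast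
  let ?C = "B - A"
  have inj: "inj_on f (vs1.span ?C)"
  proof (subst f.inj_on_iff_eq_0)
    show "\<forall>x\<in>vs1.span ?C. f x = 0 \<longrightarrow> x = 0"
    proof (intro ballI impI)
      fix x assume x: "x \<in> vs1.span ?C" "f x = 0"
      have "x \<in> V" using x(1) B(2) assms(2) vs1.span_minimal[of ?C V] by blast
      then have "x \<in> vs1.span A" using A(4) x(2) by simp
      then have "vs1.representation B x = vs1.representation A x"
        using vs1.representation_extend[OF B(3) _ B(1)] by blast
      moreover have "vs1.representation B x = vs1.representation ?C x"
        using vs1.representation_extend[OF B(3) x(1)] by blast
      ultimately have "vs1.representation B x b = 0" for b
        using vs1.representation_ne_zero[of A x b] vs1.representation_ne_zero[of ?C x b] by auto
      moreover have "x \<in> vs1.span B" using x(1) vs1.span_mono[of ?C B] by blast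
      ultimately show "x = 0"
        using vs1.sum_nonzero_representation_eq[OF B(3), of x] by simp
    qed
  qed simp
  have "vs1.independent ?C" using vs1.independent_mono[OF B(3)] by blast
  then have ind: "vs2.independent (f ` ?C)"
    using f.independent_injective_image inj by blast
  have "f ` V \<subseteq> vs2.span (f ` ?C)"
  proof
    fix y assume "y \<in> f ` V"
    then obtain x where x: "x \<in> V" "y = f x" by blast
    then have "y \<in> vs2.span (f ` B)" using B(4) f.span_image[of B] by blast
    moreover have "f ` B \<subseteq> vs2.span (f ` ?C)"
    proof
      fix z assume "z \<in> f ` B"
      then obtain b where "b \<in> B" "z = f b" by blast
      moreover have "f b = 0" if "b \<in> A" using A(2) that by blast
      ultimately show "z \<in> vs2.span (f ` ?C)"
        by (cases "b \<in> A") (auto intro: vs2.span_base vs2.span_zero)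
    qed
    ultimately show "y \<in> vs2.span (f ` ?C)"
      using vs2.span_minimal[OF _ vs2.subspace_span] by blast
  qed
  then have "vs2.dim (f ` V) = card (f ` ?C)"
    using vs2.basis_card_eq_dim[of "f ` ?C" "f ` V"] ind B(2) by (metis Diff_subset image_mono subset_trans)
  also have "\<dots> = card ?C"
    using inj by (meson card_image inj_on_subset vs1.span_superset)
  finally have 1: "vs2.dim (f ` V) = card ?C" .
  have 2: "vs1.dim ?K = card A" using vs1.basis_card_eq_dim[of A ?K] A by simp
  have 3: "vs1.dim V = card B" using vs1.basis_card_eq_dim[OF B(2,4,3)] by simp
  have "card B = card ?C + card A" using B(1) finB A(1)
    by (metis add.commute card_Diff_subset card_mono le_add_diff_inverse)
  then show ?thesis using 1 2 3 by simp
qed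

end

subsection \<open>Finitely supported families\<close>

lemma lookup_map_0: "f 0 = 0 \<Longrightarrow> lookup (Poly_Mapping.map f p) i = f (lookup p i)"
  by (simp add: map.rep_eq when_def)

lemma vector_space_map_scale:
  assumes "vector_space s"
  shows "vector_space (\<lambda>c. Poly_Mapping.map (s c))"
proof -
  interpret vector_space s by fact
  show ?thesis
    by unfold_locales
      (auto intro!: poly_mapping_eqI simp: lookup_map_0 lookup_add scale_right_distrib scale_left_distrib)
qed

text \<open>
  The components of a graded free module, of its reduction to \<open>k\<close> and of a polynomial ring all have this
  form: finitely supported families with a prescribed subspace at each index.
\<close>
lemma dim_finsupp:
  fixes s :: "'k::field \<Rightarrow> 'b::ab_group_add \<Rightarrow> 'b" and V :: "'i \<Rightarrow> 'b set"
  assumes "vector_space s" "finite B"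
    and sub: "\<And>p. p \<in> B \<Longrightarrow> module.subspace s (V p)"
    and fd: "\<And>p. p \<in> B \<Longrightarrow> fin_dim s (V p)"
  defines "W \<equiv> \<lambda>B. {v :: 'i \<Rightarrow>\<^sub>0 'b. \<forall>p. if p \<in> B then lookup v p \<in> V p else lookup v p = 0}"
  shows "module.subspace (\<lambda>c. Poly_Mapping.map (s c)) (W B) \<and>
         fin_dim (\<lambda>c. Poly_Mapping.map (s c)) (W B) \<and>
         vector_space.dim (\<lambda>c. Poly_Mapping.map (s c)) (W B) = (\<Sum>p\<in>B. vector_space.dim s (V p))"
proof -
  interpret s: vector_space s by fact
  interpret m: vector_space "\<lambda>c. Poly_Mapping.map (s c) :: ('i \<Rightarrow>\<^sub>0 'b) \<Rightarrow> _"
    by (rule vector_space_map_scale) fact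
  interpret vector_space_pair "\<lambda>c. Poly_Mapping.map (s c) :: ('i \<Rightarrow>\<^sub>0 'b) \<Rightarrow> _" s by unfold_locales
  have subW: "m.subspace (W B)" if "\<And>p. p \<in> B \<Longrightarrow> s.subspace (V p)" for B
    using that unfolding m.subspace_def W_def
    by (auto simp: lookup_add lookup_map_0 s.subspace_0 s.subspace_add s.subspace_scale)
  show ?thesis using assms(2-4)
  proof (induction B rule: finite_induct)
    case empty
    have "W {} = {0}" unfolding W_def by (auto intro: poly_mapping_eqI)
    moreover have "fin_dim (\<lambda>c. Poly_Mapping.map (s c)) {0 :: 'i \<Rightarrow>\<^sub>0 'b}"
      unfolding fin_dim_def by (intro exI[of _ "{}"]) auto
    ultimately show ?case using m.fin_dim_0_iff[of "{0}"] m.subspace_0 m.subspace_single_0 by simp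
  next
    case (insert b B)
    let ?f = "\<lambda>v :: 'i \<Rightarrow>\<^sub>0 'b. lookup v b"
    have lin: "Vector_Spaces.linear (\<lambda>c. Poly_Mapping.map (s c)) s ?f"
      by unfold_locales (auto simp: lookup_add lookup_map_0)
    have sb: "m.subspace (W (insert b B))" using subW insert.prems by blast
    have IH: "m.subspace (W B)" "fin_dim (\<lambda>c. Poly_Mapping.map (s c)) (W B)"
       "m.dim (W B) = (\<Sum>p\<in>B. s.dim (V p))" using insert by auto
    have ker: "{v \<in> W (insert b B). ?f v = 0} = W B"
      using insert(2) s.subspace_0[OF insert.prems(1)[of b]] unfolding W_def by (auto split: if_splits)
    have single: "single b x \<in> W (insert b B)" if "x \<in> V b" for x
      using that insert.prems(1) s.subspace_0 unfolding W_def by (auto simp: lookup_single when_def)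
    have im: "?f ` W (insert b B) = V b"
    proof
      show "?f ` W (insert b B) \<subseteq> V b" unfolding W_def by auto
      show "V b \<subseteq> ?f ` W (insert b B)"
      proof
        fix x assume "x \<in> V b"
        then show "x \<in> ?f ` W (insert b B)" using single by (intro image_eqI[of _ _ "single b x"]) auto
      qed
    qed
    have fdW: "fin_dim (\<lambda>c. Poly_Mapping.map (s c)) (W (insert b B))"
    proof -
      obtain S where S: "finite S" "W B \<subseteq> m.span S" using IH(2) unfolding fin_dim_def by blast
      obtain T where T: "finite T" "V b \<subseteq> s.span T" using insert.prems(2)[of b] unfolding fin_dim_def by blast
      let ?U = "S \<union> single b ` T"
      have lins: "Vector_Spaces.linear s (\<lambda>c. Poly_Mapping.map (s c)) (single b :: _ \<Rightarrow> 'i \<Rightarrow>\<^sub>0 'b)"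
        by unfold_locales
          (rule poly_mapping_eqI, simp add: lookup_add lookup_map_0 lookup_single when_def)+
      have "W (insert b B) \<subseteq> m.span ?U"
      proof
        fix v assume v: "v \<in> W (insert b B)"
        let ?x = "single b (?f v)"
        have "?f v \<in> V b" using v im by blast
        then have x: "?x \<in> W (insert b B)" "?x \<in> single b ` s.span T" using single T(2) by blast+
        then have "?x \<in> m.span (single b ` T)"
          using module_hom.span_image[OF lins[unfolded module_hom_iff_linear[symmetric]], of T] by simp
        then have 1: "?x \<in> m.span ?U" by (rule subsetD[OF m.span_mono[OF Un_upper2]])
        have "?f (v - ?x) = 0" by (simp add: lookup_minus)
        then have "v - ?x \<in> {v \<in> W (insert b B). ?f v = 0}"
          using m.subspace_diff[OF sb v x(1)] by simp
        then have "v - ?x \<in> W B" unfolding ker .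
        then have "v - ?x \<in> m.span ?U" using S(2) subsetD[OF m.span_mono[OF Un_upper1]] by blast
        then show "v \<in> m.span ?U" using m.span_add[OF _ 1, of "v - ?x"] by simp
      qed
      then show ?thesis unfolding fin_dim_def using S(1) T(1) by (intro exI[of _ ?U]) auto
    qed
    have "m.dim (W (insert b B)) = s.dim (V b) + m.dim (W B)"
      using rank_nullity[OF lin sb fdW] im ker by simp
    then show ?case using sb fdW IH insert(1,2) by simp
  qed
qed

text \<open>
  This is rank-nullity for the addition map on the direct sum of \<open>U\<close> and \<open>W\<close>, whose kernel is a copy of
  the intersection. The direct sum is realised by the families supported on \<open>{0, 1}\<close>.
\<close>
lemma (in vector_space) dim_sum_Int:
  assumes "subspace U" "fin_dim scale U" "subspace W" "fin_dim scale W"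
  shows "dim {x + y | x y. x \<in> U \<and> y \<in> W} + dim (U \<inter> W) = dim U + dim W"
proof -
  let ?s = "\<lambda>c. Poly_Mapping.map (scale c) :: (nat \<Rightarrow>\<^sub>0 'b) \<Rightarrow> _"
  let ?V = "\<lambda>p :: nat. if p = 0 then U else W"
  let ?Z = "{v :: nat \<Rightarrow>\<^sub>0 'b. \<forall>p. if p \<in> {0, 1} then lookup v p \<in> ?V p else lookup v p = 0}"
  interpret m: vector_space ?s by (rule vector_space_map_scale) (rule vector_space_axioms)
  interpret vector_space_pair ?s scale by unfold_locales
  have Z: "m.subspace ?Z" "fin_dim ?s ?Z" "m.dim ?Z = dim U + dim W"
    using dim_finsupp[OF vector_space_axioms, of "{0, 1}" ?V] assms by simp_all
  let ?f = "\<lambda>v :: nat \<Rightarrow>\<^sub>0 'b. lookup v 0 + lookup v 1"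
  let ?g = "\<lambda>v :: nat \<Rightarrow>\<^sub>0 'b. lookup v 0"
  have f: "Vector_Spaces.linear ?s scale ?f"
    by unfold_locales (simp_all add: lookup_add lookup_map_0 scale_right_distrib)
  have g: "Vector_Spaces.linear ?s scale ?g"
    by unfold_locales (simp_all add: lookup_add lookup_map_0)
  have in_Z: "single 0 x + single 1 y \<in> ?Z" if "x \<in> U" "y \<in> W" for x y
    using that by (auto simp: lookup_add lookup_single when_def)
  have Z_D: "?g v \<in> U" "lookup v 1 \<in> W" "p \<notin> {0, 1} \<Longrightarrow> lookup v p = 0"
    if "v \<in> ?Z" for v p
  proof -
    have *: "if p \<in> {0, 1} then lookup v p \<in> ?V p else lookup v p = 0" for p
      using that by blast
    show "?g v \<in> U" "lookup v 1 \<in> W" "p \<notin> {0, 1} \<Longrightarrow> lookup v p = 0"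
      using *[of 0] *[of 1] *[of p] by auto
  qed
  have im_f: "?f ` ?Z = {x + y | x y. x \<in> U \<and> y \<in> W}" (is "_ = ?S")
  proof
    show "?f ` ?Z \<subseteq> ?S" using Z_D by blast
    show "?S \<subseteq> ?f ` ?Z"
    proof
      fix z assume "z \<in> ?S"
      then obtain x y where xy: "x \<in> U" "y \<in> W" "z = x + y" by blast
      show "z \<in> ?f ` ?Z"
        by (rule image_eqI[OF _ in_Z[OF xy(1,2)]]) (simp add: xy(3) lookup_add lookup_single)
    qed
  qed
  let ?K = "{v \<in> ?Z. ?f v = 0}"
  have K_sub: "m.subspace ?K"
  proof -
    have "m.subspace {v. ?f v = 0}" using module_hom.subspace_kernel[OF module_hom_linearI[OF f]] .
    from m.subspace_inter[OF Z(1) this] show ?thesis by (simp only: Collect_conj_eq Collect_mem_eq)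
  qed
  have K_fd: "fin_dim ?s ?K" by (rule m.fin_dim_subset[OF Z(2)]) blast
  have im_g: "?g ` ?K = U \<inter> W"
  proof
    show "?g ` ?K \<subseteq> U \<inter> W"
    proof
      fix x assume "x \<in> ?g ` ?K"
      then obtain v where v: "v \<in> ?Z" "?f v = 0" "x = ?g v" by blast
      then have "x = - lookup v 1" by (simp add: eq_neg_iff_add_eq_0)
      then show "x \<in> U \<inter> W" using Z_D(1,2)[OF v(1)] v(3) subspace_neg[OF assms(3)] by simp
    qed
    show "U \<inter> W \<subseteq> ?g ` ?K"
    proof
      fix x assume x: "x \<in> U \<inter> W"
      have "single 0 x + single 1 (- x) \<in> ?Z"
        using in_Z[of x "- x"] x subspace_neg[OF assms(3)] by blast
      then show "x \<in> ?g ` ?K"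
        by (intro image_eqI[of _ _ "single 0 x + single 1 (- x)"])
           (simp_all add: lookup_add lookup_single)
    qed
  qed
  have "{v \<in> ?K. ?g v = 0} = {0}"
  proof (intro set_eqI iffI)
    fix v assume "v \<in> {v \<in> ?K. ?g v = 0}"
    then have v: "v \<in> ?Z" "?f v = 0" "?g v = 0" by blast+
    have "lookup v p = 0" for p using Z_D(3)[OF v(1), of p] v(2,3) by (cases "p \<in> {0, 1}") auto
    then show "v \<in> {0}" by (auto intro: poly_mapping_eqI)
  qed (use m.subspace_0[OF Z(1)] in auto)
  then have "m.dim {v \<in> ?K. ?g v = 0} = 0"
    using m.dim_le_card[of "{0}" "{}"] by simp
  then have "m.dim ?K = dim (U \<inter> W)" using rank_nullity[OF g K_sub K_fd] unfolding im_g by simp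
  then show ?thesis using rank_nullity[OF f Z(1,2)] unfolding im_f Z(3) by simp
qed

text \<open>
  Because the complement is spanned by members of a given spanning set, Nakayama's lemma can later
  pick its generators among the basis elements of a free module.
\<close>
lemma (in vector_space) complement_from_spanning_set:
  assumes "fin_dim scale V" "subspace V" "E \<subseteq> V" "V \<subseteq> span E" "subspace U" "U \<subseteq> V"
  obtains E' where "E' \<subseteq> E" "finite E'" "card E' + dim U = dim V"
    "\<forall>v\<in>V. \<exists>x\<in>span E'. \<exists>u\<in>U. v = x + u"
proof -
  obtain A where A: "finite A" "A \<subseteq> U" "independent A" "span A = U" "card A = dim U"
    using fin_dim_basis[OF fin_dim_subset[OF assms(1,6)] assms(5)] by metis
  obtain B where B: "A \<subseteq> B" "B \<subseteq> A \<union> E" "independent B" "A \<union> E \<subseteq> span B"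
    using maximal_independent_subset_extend[of A "A \<union> E"] A(3) by blast
  have BV: "B \<subseteq> V" using B(2) A(2) assms(3,6) by blast
  have "V \<subseteq> span B" using assms(4) span_minimal[of E "span B"] B(4) by auto
  then have card: "card B = dim V" using basis_card_eq_dim[OF BV _ B(3)] by blast
  have finB: "finite B" using assms(1) independent_span_bound B(3) BV unfolding fin_dim_def by blast
  have "card (B - A) + dim U = dim V"
    using card A(5) card_Diff_subset[OF A(1) B(1)] card_mono[OF finB B(1)] by simp
  moreover have "\<exists>x\<in>span (B - A). \<exists>u\<in>U. v = x + u" if "v \<in> V" for v
  proof -
    have "(B - A) \<union> A = B" using B(1) by blast
    then have "v \<in> span ((B - A) \<union> A)" using \<open>V \<subseteq> span B\<close> that by auto
    then show ?thesis unfolding span_Un A(4) by blast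
  qed
  moreover have "B - A \<subseteq> E" using B(2) by blast
  ultimately show ?thesis using that finB by blast
qed

section \<open>Gradings and homogeneous components\<close>

text \<open>
  A grading is recorded through its projections. Free modules and polynomial rings have explicit ones,
  and submodules are graded exactly if the projections preserve them.
\<close>
locale grading =
  fixes G :: "nat \<Rightarrow> 'm::ab_group_add set" and pr :: "nat \<Rightarrow> 'm \<Rightarrow> 'm"
  assumes pr_add: "pr i (x + y) = pr i x + pr i y"
    and pr_in: "pr i x \<in> G i"
    and pr_same: "x \<in> G i \<Longrightarrow> pr i x = x"
    and pr_other: "x \<in> G i \<Longrightarrow> j \<noteq> i \<Longrightarrow> pr j x = 0"
    and pr_fin: "\<exists>n. x = (\<Sum>i<n. pr i x)"
begin

lemma pr_0 [simp]: "pr i 0 = 0"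
  using pr_add[of i 0 0] by simp

lemma pr_sum: "pr i (sum f S) = (\<Sum>x\<in>S. pr i (f x))"
  by (induction S rule: infinite_finite_induct) (auto simp: pr_add)

lemma pr_diff: "pr i (x - y) = pr i x - pr i y"
  using pr_add[of i "x - y" y] by (simp add: algebra_simps)

lemma G_0 [simp]: "0 \<in> G i" using pr_in[of i 0] by simp

lemma in_G_iff: "x \<in> G i \<longleftrightarrow> pr i x = x"
  using pr_in pr_same by metis

lemma G_add: "x \<in> G i \<Longrightarrow> y \<in> G i \<Longrightarrow> x + y \<in> G i"
  unfolding in_G_iff by (simp add: pr_add)

lemma G_sum: "(\<And>x. x \<in> S \<Longrightarrow> f x \<in> G i) \<Longrightarrow> sum f S \<in> G i"
  unfolding in_G_iff by (simp add: pr_sum)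

lemma pr_pr: "pr i (pr j x) = (if i = j then pr j x else 0)"
  using pr_same[OF pr_in, of j x] pr_other[OF pr_in, of i j x] by auto

lemma pr_fin_ge: obtains n where "\<And>m. m \<ge> n \<Longrightarrow> x = (\<Sum>i<m. pr i x)"
proof -
  obtain n where n: "x = (\<Sum>i<n. pr i x)" using pr_fin by blast
  have zero: "pr j x = 0" if "j \<ge> n" for j
  proof -
    have "pr j x = (\<Sum>i<n. pr j (pr i x))" by (subst n) (rule pr_sum)
    also have "\<dots> = 0" using that by (intro sum.neutral) (auto simp: pr_pr)
    finally show ?thesis .
  qed
  have "x = (\<Sum>i<m. pr i x)" if "m \<ge> n" for m
    by (subst n, rule sum.mono_neutral_left) (use that zero in auto)
  then show ?thesis using that by blast
qed

lemma eq_0_of_pr: "(\<And>i. pr i x = 0) \<Longrightarrow> x = 0"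
  using pr_fin[of x] by auto

end

lemma additive_sum:
  fixes f :: "'b::ab_group_add \<Rightarrow> 'c::ab_group_add"
  assumes "\<And>x y. f (x + y) = f x + f y"
  shows "f (sum g S) = (\<Sum>x\<in>S. f (g x))"
proof -
  have "f 0 = 0" using assms[of 0 0] by simp
  then show ?thesis by (induction S rule: infinite_finite_induct) (auto simp: assms)
qed

text \<open>
  Homogeneous additive maps commute with taking homogeneous components. This is what turns the
  ungraded exactness of a resolution, or the bare surjectivity of a morphism, into statements about
  each degree separately.
\<close>
lemma pr_homogeneous_map:
  assumes "grading G pr" "grading G' pr'"
    and add: "\<And>x y. f (x + y) = f x + f y"
    and deg: "\<And>j x. x \<in> G j \<Longrightarrow> f x \<in> G' (j + s)"
  shows "pr' i (f x) = (if s \<le> i then f (pr (i - s) x) else 0)"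
proof -
  interpret A: grading G pr by fact
  interpret B: grading G' pr' by fact
  obtain n where n: "\<And>m. m \<ge> n \<Longrightarrow> x = (\<Sum>i<m. pr i x)" using A.pr_fin_ge[of x] by blast
  let ?m = "max n (i + 1)"
  have "pr' i (f x) = pr' i (\<Sum>j<?m. f (pr j x))"
    by (subst n[of ?m]) (simp_all add: additive_sum[of f, OF add])
  also have "\<dots> = (\<Sum>j<?m. pr' i (f (pr j x)))" by (rule B.pr_sum)
  also have "\<dots> = (\<Sum>j<?m. if i = j + s then f (pr j x) else 0)"
    by (intro sum.cong refl) (simp add: B.pr_same[OF deg[OF A.pr_in]] B.pr_other[OF deg[OF A.pr_in]])
  also have "\<dots> = (if s \<le> i then f (pr (i - s) x) else 0)"
  proof (cases "s \<le> i")
    case True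
    then have "(i = j + s) = (j = i - s)" for j by auto
    moreover have "i - s < ?m" by simp
    ultimately show ?thesis using True by (simp add: sum.delta' del: less_max_iff_disj)
  next
    case False
    then have "(i = j + s) = False" for j by auto
    then show ?thesis using False by simp
  qed
  finally show ?thesis .
qed

text \<open>
  The projections belonging to an internal direct sum decomposition.
\<close>
definition component :: "(nat \<Rightarrow> 'a::ab_group_add set) \<Rightarrow> nat \<Rightarrow> 'a \<Rightarrow> 'a" where
  "component G i x = lookup (THE c :: nat \<Rightarrow>\<^sub>0 'a. (\<forall>i. lookup c i \<in> G i) \<and>
        (\<Sum>i\<in>keys c. lookup c i) = x) i"

lemma grading_component:
  assumes ds: "direct_sum_decomposition G"
    and zero: "\<And>i. 0 \<in> G i" and add: "\<And>i x y. x \<in> G i \<Longrightarrow> y \<in> G i \<Longrightarrow> x + y \<in> G i"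
  shows "grading G (component G)"
proof -
  let ?P = "\<lambda>c :: nat \<Rightarrow>\<^sub>0 'a. \<lambda>x. (\<forall>i. lookup c i \<in> G i) \<and>
        (\<Sum>i\<in>keys c. lookup c i) = x"
  define d where "d x = (THE c. ?P c x)" for x
  have ex1: "\<exists>!c. ?P c x" for x using ds unfolding direct_sum_decomposition_def by blast
  have P: "?P (d x) x" for x unfolding d_def by (rule theI'[OF ex1])
  have eq: "d x = c" if "?P c x" for c x using ex1[of x] P[of x] that by blast
  have comp: "component G i x = lookup (d x) i" for i x
    unfolding component_def d_def ..
  have single: "d x = single i x" if "x \<in> G i" for i x
    by (rule eq) (use that zero in \<open>auto simp: lookup_single when_def\<close>)
  show ?thesis
  proof
    fix i x y
    have "d (x + y) = d x + d y"
    proof (rule eq, intro conjI allI)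
      show "lookup (d x + d y) i \<in> G i" for i using P add by (simp add: lookup_add)
      have "(\<Sum>i\<in>keys (d x + d y). lookup (d x + d y) i)
         = (\<Sum>i\<in>keys (d x). lookup (d x) i)
           + (\<Sum>i\<in>keys (d y). lookup (d y) i)"
        by (rule setsum_keys_plus_distrib) auto
      then show "(\<Sum>i\<in>keys (d x + d y). lookup (d x + d y) i) = x + y"
        using P by simp
    qed
    then show "component G i (x + y) = component G i x + component G i y"
      by (simp add: comp lookup_add)
  next
    fix i x show "component G i x \<in> G i" using P comp by simp
  next
    fix i x assume "x \<in> G i" then show "component G i x = x" using single comp by simp
  next
    fix i j x assume "x \<in> G i" "j \<noteq> i" then show "component G j x = 0"
      using single comp by (simp add: lookup_single_not_eq)
  next
    fix x
    obtain n where n: "keys (d x) \<subseteq> {..<n}"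
      using finite_nat_bounded[OF finite_keys] by blast
    have "x = (\<Sum>i\<in>keys (d x). lookup (d x) i)" using P by simp
    also have "\<dots> = (\<Sum>i<n. component G i x)" unfolding comp
      by (rule sum.mono_neutral_left) (use n in \<open>auto simp: in_keys_iff\<close>)
    finally show "\<exists>n. x = (\<Sum>i<n. component G i x)" by blast
  qed
qed

section \<open>Standard graded algebras\<close>

lemma module_mult: "module ((*) :: 'a::comm_ring_1 \<Rightarrow> 'a \<Rightarrow> 'a)"
  by unfold_locales (auto simp: algebra_simps)

abbreviation hpr :: "('k, 'a::comm_ring_1) graded_algebra \<Rightarrow> nat \<Rightarrow> 'a \<Rightarrow> 'a" where
  "hpr R \<equiv> component (part R)"

abbreviation hdim :: "('k::field, 'a::comm_ring_1) graded_algebra \<Rightarrow> nat \<Rightarrow> nat" where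
  "hdim R i \<equiv> vector_space.dim (smul R) (part R i)"

locale std_graded =
  fixes R :: "('k::field, 'a::comm_ring_1) graded_algebra"
  assumes std: "standard_graded R"
begin

sublocale K: vector_space "smul R" using std unfolding standard_graded_def by blast

lemma smul_mult: "smul R c (x * y) = smul R c x * y"
  and part_subspace: "K.subspace (part R i)"
  and part_mult: "x \<in> part R i \<Longrightarrow> y \<in> part R j \<Longrightarrow> x * y \<in> part R (i + j)"
  and part_0: "part R 0 = range (\<lambda>c. smul R c 1)"
  and direct_sum: "direct_sum_decomposition (part R)"
  and part_1: "\<exists>B. finite B \<and> part R 1 = K.span B"
  and generated: "is_subalgebra R S \<Longrightarrow> part R 1 \<subseteq> S \<Longrightarrow> S = UNIV"
  using std unfolding standard_graded_def by (simp_all only: Ball_def)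

sublocale A: grading "part R" "hpr R"
proof (rule grading_component)
  show "direct_sum_decomposition (part R)" by (rule direct_sum)
  show "0 \<in> part R i" for i using part_subspace K.subspace_0 by blast
  show "x + y \<in> part R i" if "x \<in> part R i" "y \<in> part R i" for x y i
    using part_subspace K.subspace_add that by blast
qed

lemma smul_1_mult: "smul R c 1 * x = smul R c x"
  using smul_mult[of c 1 x] by simp

lemma mult_smul: "x * smul R c y = smul R c (x * y)"
  using smul_mult[of c y x] by (simp add: mult.commute)

lemma smul_1_in: "smul R c 1 \<in> part R 0" using part_0 by blast

lemma one_in: "1 \<in> part R 0" using smul_1_in[of 1] by simp

lemma hpr_mult_homogeneous:
  "x \<in> part R i \<Longrightarrow> hpr R d (x * y) = (if i \<le> d then x * hpr R (d - i) y else 0)"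
  by (rule pr_homogeneous_map[OF A.grading_axioms A.grading_axioms])
     (auto simp: algebra_simps part_mult dest: part_mult[of x i])

lemma hpr_mult: "hpr R d (x * y) = (\<Sum>i\<le>d. hpr R i x * hpr R (d - i) y)"
proof -
  obtain n where n: "\<And>m. m \<ge> n \<Longrightarrow> x = (\<Sum>i<m. hpr R i x)" using A.pr_fin_ge[of x] by blast
  let ?m = "max n (Suc d)"
  have "hpr R d (x * y) = hpr R d ((\<Sum>i<?m. hpr R i x) * y)" using n[of ?m] by simp
  also have "\<dots> = (\<Sum>i<?m. hpr R d (hpr R i x * y))" by (simp only: sum_distrib_right A.pr_sum)
  also have "\<dots> = (\<Sum>i\<le>d. hpr R i x * hpr R (d - i) y)"
    by (rule sum.mono_neutral_cong_right) (auto simp: hpr_mult_homogeneous[OF A.pr_in])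
  finally show ?thesis .
qed

lemma hpr_0_mult: "hpr R 0 (x * y) = hpr R 0 x * hpr R 0 y"
  by (simp add: hpr_mult)

subsection \<open>The augmentation\<close>

lemma irrelevant_ideal_eq: "irrelevant_ideal R = {x. hpr R 0 x = 0}"
proof -
  interpret I: module "(*) :: 'a \<Rightarrow> 'a \<Rightarrow> 'a" by (rule module_mult)
  show ?thesis
  proof
    show "irrelevant_ideal R \<subseteq> {x. hpr R 0 x = 0}" unfolding irrelevant_ideal_def
    proof (rule I.span_minimal)
      show "(\<Union>i\<in>{1..}. part R i) \<subseteq> {x. hpr R 0 x = 0}" using A.pr_other by auto
      show "I.subspace {x. hpr R 0 x = 0}" by (auto simp: I.subspace_def A.pr_add hpr_0_mult)
    qed
    show "{x. hpr R 0 x = 0} \<subseteq> irrelevant_ideal R"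
    proof
      fix x assume "x \<in> {x. hpr R 0 x = 0}"
      then have x: "hpr R 0 x = 0" by simp
      obtain n where n: "x = (\<Sum>i<n. hpr R i x)" using A.pr_fin by blast
      have "hpr R i x \<in> irrelevant_ideal R" for i
      proof (cases "i = 0")
        case True then show ?thesis using x I.span_zero unfolding irrelevant_ideal_def by simp
      next
        case False
        then show ?thesis unfolding irrelevant_ideal_def using A.pr_in[of i x] by (intro I.span_base) auto
      qed
      then have "(\<Sum>i<n. hpr R i x) \<in> irrelevant_ideal R"
        unfolding irrelevant_ideal_def by (rule I.span_sum)
      then show "x \<in> irrelevant_ideal R" using n by simp
    qed
  qed
qed

lemma hpr_0: "hpr R 0 x = smul R (augmentation R x) 1"
proof -
  have *: "x - smul R c 1 \<in> irrelevant_ideal R \<longleftrightarrow> hpr R 0 x = smul R c 1" for c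
    unfolding irrelevant_ideal_eq using A.pr_same[OF smul_1_in] by (simp add: A.pr_diff)
  obtain c where c: "hpr R 0 x = smul R c 1" using A.pr_in[of 0 x] part_0 by auto
  have "augmentation R x = c" unfolding augmentation_def * c by (rule the_equality) auto
  then show ?thesis using c by simp
qed

lemma aug_eqI: "hpr R 0 x = smul R c 1 \<Longrightarrow> augmentation R x = c"
  using hpr_0[of x] by simp

lemma aug_add: "augmentation R (x + y) = augmentation R x + augmentation R y"
  by (rule aug_eqI) (simp add: A.pr_add hpr_0 K.scale_left_distrib)

lemma aug_mult: "augmentation R (x * y) = augmentation R x * augmentation R y"
  by (rule aug_eqI, subst hpr_0_mult) (simp add: hpr_0 smul_1_mult)

lemma aug_smul_1 [simp]: "augmentation R (smul R c 1) = c"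
  by (rule aug_eqI) (simp add: A.pr_same[OF smul_1_in])

lemma aug_0 [simp]: "augmentation R 0 = 0" by (rule aug_eqI) simp

lemma aug_1 [simp]: "augmentation R 1 = 1" using aug_smul_1[of 1] by simp

lemma aug_eq_0_iff: "augmentation R x = 0 \<longleftrightarrow> hpr R 0 x = 0"
  by (simp add: hpr_0)

lemma aug_eq_0: "x \<in> part R i \<Longrightarrow> i > 0 \<Longrightarrow> augmentation R x = 0"
  by (simp add: aug_eq_0_iff A.pr_other)

lemma aug_part_0: "x \<in> part R 0 \<Longrightarrow> x = smul R (augmentation R x) 1"
  using hpr_0[of x] A.pr_same[of x 0] by simp

lemma aug_diff: "augmentation R (x - y) = augmentation R x - augmentation R y"
  using aug_add[of "x - y" y] by (simp add: algebra_simps)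

subsection \<open>The components of a standard graded algebra are finite-dimensional\<close>

text \<open>
  The products of \<open>i\<close> elements of a finite spanning set of \<open>R\<^sub>1\<close> span \<open>R\<^sub>i\<close>: the elements all of whose components
  lie in the respective spans form a subalgebra that contains \<open>R\<^sub>1\<close>.
\<close>
lemma fin_dim_part: "fin_dim (smul R) (part R i)"
proof -
  obtain B where B: "finite B" "part R 1 = K.span B" using part_1 by blast
  define T where "T i = {prod_list xs | xs. set xs \<subseteq> B \<and> length xs = i}" for i
  have finT: "finite (T i)" for i
  proof -
    have "T i = prod_list ` {xs. set xs \<subseteq> B \<and> length xs = i}" unfolding T_def by auto
    then show ?thesis using finite_lists_length_eq[OF B(1)] by simp
  qed
  have Tmult: "x * y \<in> K.span (T (i + j))" if "x \<in> K.span (T i)" "y \<in> K.span (T j)" for x y i j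
  proof -
    have 1: "x * y \<in> K.span (T (i + j))" if "x \<in> T i" "y \<in> T j" for x y
    proof -
      obtain xs ys where "x = prod_list xs" "set xs \<subseteq> B" "length xs = i"
         "y = prod_list ys" "set ys \<subseteq> B" "length ys = j" using \<open>x \<in> T i\<close> \<open>y \<in> T j\<close> unfolding T_def by blast
      then have "x * y \<in> T (i + j)" unfolding T_def by (intro CollectI exI[of _ "xs @ ys"]) auto
      then show ?thesis by (rule K.span_base)
    qed
    have 2: "x * y \<in> K.span (T (i + j))" if "x \<in> T i" "y \<in> K.span (T j)" for x y
    proof -
      have "K.span (T j) \<subseteq> {y. x * y \<in> K.span (T (i + j))}"
      proof (rule K.span_minimal)
        show "T j \<subseteq> {y. x * y \<in> K.span (T (i + j))}" using 1 that(1) by blast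
        show "K.subspace {y. x * y \<in> K.span (T (i + j))}"
          by (auto simp: K.subspace_def K.span_zero distrib_left K.span_add mult_smul K.span_scale)
      qed
      then show ?thesis using that by blast
    qed
    have "K.span (T i) \<subseteq> {x. x * y \<in> K.span (T (i + j))}"
    proof (rule K.span_minimal)
      show "T i \<subseteq> {x. x * y \<in> K.span (T (i + j))}" using 2 \<open>y \<in> _\<close> by blast
      show "K.subspace {x. x * y \<in> K.span (T (i + j))}"
        by (auto simp: K.subspace_def K.span_zero distrib_right K.span_add smul_mult[symmetric] K.span_scale)
    qed
    then show ?thesis using that by blast
  qed
  define S where "S = {x. \<forall>i. hpr R i x \<in> K.span (T i)}"
  have "is_subalgebra R S" unfolding is_subalgebra_def
  proof (intro conjI ballI)
    have "hpr R i (smul R c x) = smul R c (hpr R i x)" for i c x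
      using hpr_mult_homogeneous[OF smul_1_in, of i c x] by (simp add: smul_1_mult)
    then show "K.subspace S"
      unfolding S_def by (auto simp: K.subspace_def K.span_zero A.pr_add K.span_add K.span_scale)
    have "T 0 = {1}" unfolding T_def by auto
    then have "hpr R i 1 \<in> K.span (T i)" for i
      using A.pr_same[OF one_in] A.pr_other[OF one_in, of i]
      by (cases "i = 0") (auto intro: K.span_zero K.span_base)
    then show "1 \<in> S" unfolding S_def by blast
    fix x y assume xy: "x \<in> S" "y \<in> S"
    have "hpr R d (x * y) \<in> K.span (T d)" for d
    proof -
      obtain n where n: "x = (\<Sum>i<n. hpr R i x)" using A.pr_fin by blast
      have "hpr R d (x * y) = hpr R d ((\<Sum>i<n. hpr R i x) * y)" using n by simp
      also have "\<dots> = (\<Sum>i<n. hpr R d (hpr R i x * y))" by (simp only: sum_distrib_right A.pr_sum)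
      also have "\<dots> \<in> K.span (T d)"
      proof (rule K.span_sum)
        fix i
        show "hpr R d (hpr R i x * y) \<in> K.span (T d)"
          using Tmult[of "hpr R i x" i "hpr R (d - i) y" "d - i"] xy
          unfolding hpr_mult_homogeneous[OF A.pr_in] S_def by (auto intro: K.span_zero)
      qed
      finally show ?thesis .
    qed
    then show "x * y \<in> S" unfolding S_def by blast
  qed
  moreover have "part R 1 \<subseteq> S"
  proof
    fix x assume x: "x \<in> part R 1"
    have "B \<subseteq> T 1" unfolding T_def by (force intro: exI[of _ "[b]" for b])
    then have "x \<in> K.span (T 1)" using x B(2) K.span_mono by blast
    then have "hpr R i x \<in> K.span (T i)" for i
      using A.pr_same[OF x] A.pr_other[OF x, of i] by (cases "i = 1") (auto intro: K.span_zero)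
    then show "x \<in> S" unfolding S_def by blast
  qed
  ultimately have "S = UNIV" by (rule generated)
  then have "hpr R i x \<in> K.span (T i)" for x unfolding S_def by blast
  then have "part R i \<subseteq> K.span (T i)" using A.pr_same by (metis subsetI)
  then show ?thesis unfolding fin_dim_def using finT by blast
qed

lemma hdim_0: "hdim R 0 = 1"
proof -
  have "part R 0 = K.span {1}" unfolding part_0 K.span_singleton by simp
  then show ?thesis using K.dim_span_eq_card_independent[of "{1}"] by (simp add: K.dependent_single)
qed

end

section \<open>Graded modules and graded free modules\<close>

text \<open>
  Finiteness of the components is left out on purpose. The free module on all of \<open>nat\<close> is an instance for
  every choice of degrees, and only its submodules on degreewise finite bases are ever measured.
\<close>
locale graded_module_over = std_graded R + grading G pr + M: module sc
  for R :: "('k::field, 'a::comm_ring_1) graded_algebra"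
    and sc :: "'a \<Rightarrow> 'm::ab_group_add \<Rightarrow> 'm" and G and pr +
  assumes sc_in: "x \<in> part R i \<Longrightarrow> m \<in> G j \<Longrightarrow> sc x m \<in> G (i + j)"
begin

definition ksc :: "'k \<Rightarrow> 'm \<Rightarrow> 'm" where "ksc c m = sc (smul R c 1) m"

sublocale KM: vector_space ksc
  by unfold_locales
    (simp_all add: ksc_def M.scale_right_distrib K.scale_left_distrib M.scale_left_distrib smul_1_mult)

lemma ksc_in: "m \<in> G j \<Longrightarrow> ksc c m \<in> G j"
  using sc_in[OF smul_1_in, of m j c] by (simp add: ksc_def)

end

text \<open>
  The component of degree \<open>j\<close> of the free module whose basis element \<open>e\<^sub>p\<close> has degree \<open>deg p\<close>.
\<close>
definition fpart :: "('k, 'a::comm_ring_1) graded_algebra \<Rightarrow> (nat \<Rightarrow> nat) \<Rightarrow> nat \<Rightarrow> (nat \<Rightarrow>\<^sub>0 'a) set" where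
  "fpart R deg j = {v. \<forall>p. if deg p \<le> j then lookup v p \<in> part R (j - deg p)
                              else lookup v p = 0}"

definition fpr :: "('k, 'a::comm_ring_1) graded_algebra \<Rightarrow> (nat \<Rightarrow> nat) \<Rightarrow> nat \<Rightarrow> (nat \<Rightarrow>\<^sub>0 'a) \<Rightarrow> (nat \<Rightarrow>\<^sub>0 'a)" where
  "fpr R deg j v = Poly_Mapping.mapp (\<lambda>p x. if deg p \<le> j then hpr R (j - deg p) x else 0) v"

lemma lookup_vscale [simp]: "lookup (vscale r v) p = r * lookup v p"
  by (simp add: vscale_def lookup_map_0)

lemma module_vscale: "module (vscale :: 'a::comm_ring_1 \<Rightarrow> _)"
  by unfold_locales (rule poly_mapping_eqI, simp add: lookup_add algebra_simps)+

lemma vector_space_vscale: "vector_space (vscale :: 'k::field \<Rightarrow> _)"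
  using module_vscale module_iff_vector_space by blast

lemma in_free_mod_iff: "v \<in> free_mod B \<longleftrightarrow> (\<forall>p. p \<notin> B \<longrightarrow> lookup v p = 0)"
  unfolding free_mod_def by (auto simp: in_keys_iff)

lemma free_mod_0 [simp]: "0 \<in> free_mod B"
  and free_mod_add: "v \<in> free_mod B \<Longrightarrow> w \<in> free_mod B \<Longrightarrow> v + w \<in> free_mod B"
  and free_mod_vscale: "v \<in> free_mod B \<Longrightarrow> vscale r v \<in> free_mod B"
  and free_mod_single: "p \<in> B \<Longrightarrow> single p x \<in> free_mod B"
  for v w :: "nat \<Rightarrow>\<^sub>0 'a::comm_ring_1"
  by (auto simp: in_free_mod_iff lookup_add lookup_minus lookup_single when_def)

lemma free_mod_sum: "(\<And>x. x \<in> S \<Longrightarrow> f x \<in> free_mod B) \<Longrightarrow> (sum f S :: nat \<Rightarrow>\<^sub>0 'a::comm_ring_1) \<in> free_mod B"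
  by (induction S rule: infinite_finite_induct) (auto intro: free_mod_add)

context std_graded
begin

lemma lookup_fpr: "lookup (fpr R deg j v) p
    = (if deg p \<le> j then hpr R (j - deg p) (lookup v p) else 0)"
  unfolding fpr_def Poly_Mapping.lookup_mapp by (auto simp: in_keys_iff when_def)

lemma grading_fpart: "grading (fpart R deg) (fpr R deg)"
proof
  fix v
  obtain n :: "nat \<Rightarrow> nat" where n: "\<And>p m. m \<ge> n p \<Longrightarrow> lookup v p = (\<Sum>i<m. hpr R i (lookup v p))"
  proof -
    have "\<exists>n. \<forall>m\<ge>n. lookup v p = (\<Sum>i<m. hpr R i (lookup v p))" for p
      using A.pr_fin_ge by metis
    then show ?thesis using that by metis
  qed
  obtain N where N: "\<And>p. p \<in> keys v \<Longrightarrow> deg p + n p \<le> N"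
    using finite_nat_set_iff_bounded_le[of "(\<lambda>p. deg p + n p) ` keys v"] by auto
  have "v = (\<Sum>i<N. fpr R deg i v)"
  proof (rule poly_mapping_eqI)
    fix p
    show "lookup v p = lookup (\<Sum>i<N. fpr R deg i v) p"
    proof (cases "p \<in> keys v")
      case True
      have "(\<Sum>i<N. lookup (fpr R deg i v) p)
        = (\<Sum>i\<in>{deg p..<N}. hpr R (i - deg p) (lookup v p))"
        unfolding lookup_fpr by (rule sum.mono_neutral_cong_right) auto
      also have "\<dots> = (\<Sum>i<N - deg p. hpr R i (lookup v p))"
        by (rule sum.reindex_bij_witness[of _ "\<lambda>i. i + deg p" "\<lambda>i. i - deg p"]) auto
      also have "\<dots> = lookup v p" using n[of p "N - deg p"] N[OF True] by simp
      finally show ?thesis by (simp add: lookup_sum)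
    qed (simp add: lookup_sum lookup_fpr in_keys_iff cong: if_cong)
  qed
  then show "\<exists>n. v = (\<Sum>i<n. fpr R deg i v)" by blast
next
  fix i j v assume v: "v \<in> fpart R deg i" "j \<noteq> i"
  show "fpr R deg j v = 0"
  proof (rule poly_mapping_eqI)
    fix p
    show "lookup (fpr R deg j v) p = lookup 0 p"
      using v(1)[unfolded fpart_def, THEN CollectD, rule_format, of p] v(2)
      by (auto simp: lookup_fpr split: if_splits intro: A.pr_other)
  qed
next
  fix i v assume v: "v \<in> fpart R deg i"
  show "fpr R deg i v = v"
  proof (rule poly_mapping_eqI)
    fix p
    show "lookup (fpr R deg i v) p = lookup v p"
      using v[unfolded fpart_def, THEN CollectD, rule_format, of p]
      by (auto simp: lookup_fpr A.pr_same split: if_splits)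
  qed
qed (auto simp: fpart_def lookup_fpr A.pr_in lookup_add A.pr_add intro!: poly_mapping_eqI)

lemma graded_module_fpart: "graded_module_over R vscale (fpart R deg) (fpr R deg)"
proof -
  interpret G: grading "fpart R deg" "fpr R deg" by (rule grading_fpart)
  interpret V: module "vscale :: 'a \<Rightarrow> _" by (rule module_vscale)
  show ?thesis
  proof
    fix x i v j assume *: "x \<in> part R i" "v \<in> fpart R deg j"
    show "vscale x v \<in> fpart R deg (i + j)" unfolding fpart_def
    proof (intro CollectI allI)
      fix p
      show "if deg p \<le> i + j then lookup (vscale x v) p \<in> part R (i + j - deg p)
        else lookup (vscale x v) p = 0"
        using *(2)[unfolded fpart_def, THEN CollectD, rule_format, of p]
          part_mult[OF *(1), of "lookup v p" "j - deg p"]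
        by (auto split: if_splits)
    qed
  qed
qed

lemma fpr_free_mod: "v \<in> free_mod B \<Longrightarrow> fpr R deg j v \<in> free_mod B"
  by (auto simp: in_free_mod_iff lookup_fpr)

abbreviation fksc :: "'k \<Rightarrow> (nat \<Rightarrow>\<^sub>0 'a) \<Rightarrow> (nat \<Rightarrow>\<^sub>0 'a)" where
  "fksc \<equiv> \<lambda>c. Poly_Mapping.map (smul R c)"

lemma vscale_smul_1: "vscale (smul R c 1) = fksc c"
  unfolding vscale_def by (intro ext poly_mapping_eqI) (simp add: lookup_map_0 smul_1_mult)

lemma vector_space_fksc: "vector_space fksc"
  by (rule vector_space_map_scale) (rule K.vector_space_axioms)

lemma dim_fpart_free_mod:
  assumes "finite {p \<in> B. deg p \<le> j}"
  shows "fin_dim fksc (fpart R deg j \<inter> free_mod B)"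
    and "vector_space.dim fksc (fpart R deg j \<inter> free_mod B) = (\<Sum>p | p \<in> B \<and> deg p \<le> j. hdim R (j - deg p))"
proof -
  let ?C = "{p \<in> B. deg p \<le> j}"
  have "fpart R deg j \<inter> free_mod B = {v. \<forall>p. if p \<in> ?C then lookup v p \<in> part R (j - deg p)
       else lookup v p = 0}" (is "?L = ?R")
  proof (intro set_eqI iffI)
    fix v assume v: "v \<in> ?L"
    then show "v \<in> ?R" unfolding fpart_def by (auto simp: in_free_mod_iff split: if_splits)
  next
    fix v assume v: "v \<in> ?R"
    then have "if p \<in> ?C then lookup v p \<in> part R (j - deg p) else lookup v p = 0" for p
      by blast
    then show "v \<in> ?L" unfolding fpart_def by (auto simp: in_free_mod_iff split: if_splits) (metis A.G_0)+
  qed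
  then show "fin_dim fksc (fpart R deg j \<inter> free_mod B)"
    and "vector_space.dim fksc (fpart R deg j \<inter> free_mod B) = (\<Sum>p | p \<in> B \<and> deg p \<le> j. hdim R (j - deg p))"
    using dim_finsupp[OF K.vector_space_axioms assms, of "\<lambda>p. part R (j - deg p)"] part_subspace fin_dim_part
    by simp_all
qed

end

subsection \<open>Linear extension from a basis\<close>

context module
begin

lemma lin_ext_superset:
  "finite S \<Longrightarrow> keys v \<subseteq> S \<Longrightarrow> lin_ext scale f v = (\<Sum>b\<in>S. scale (lookup v b) (f b))"
  unfolding lin_ext_def by (rule sum.mono_neutral_left) (auto simp: in_keys_iff)

lemma lin_ext_add: "lin_ext scale f (v + w) = lin_ext scale f v + lin_ext scale f w"
proof -
  let ?S = "keys v \<union> keys w"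
  have "finite ?S" "keys (v + w) \<subseteq> ?S" using Poly_Mapping.keys_add[of v w] by auto
  then show ?thesis
    using lin_ext_superset[of ?S "v + w" f] lin_ext_superset[of ?S v f] lin_ext_superset[of ?S w f]
    by (simp add: lookup_add scale_left_distrib sum.distrib)
qed

lemma lin_ext_vscale: "lin_ext scale f (vscale r v) = scale r (lin_ext scale f v)"
proof -
  have "keys (vscale r v) \<subseteq> keys v" by (auto simp: in_keys_iff)
  then show ?thesis
    using lin_ext_superset[of "keys v" "vscale r v" f]
    by (simp add: lin_ext_def scale_sum_right)
qed

lemma lin_ext_0 [simp]: "lin_ext scale f 0 = 0" by (simp add: lin_ext_def)

lemma lin_ext_single: "lin_ext scale f (single b x) = scale x (f b)"
  by (cases "x = 0") (simp_all add: lin_ext_def)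

end

lemma lin_ext_in_free_mod:
  "(\<And>b. b \<in> keys v \<Longrightarrow> f b \<in> free_mod B) \<Longrightarrow> lin_ext vscale f (v :: nat \<Rightarrow>\<^sub>0 'a::comm_ring_1) \<in> free_mod B"
  unfolding lin_ext_def by (intro free_mod_sum free_mod_vscale)

lemma (in graded_module_over) lin_ext_in:
  assumes "v \<in> fpart R deg j" "\<And>b. b \<in> keys v \<Longrightarrow> f b \<in> G (deg b)"
  shows "lin_ext sc f v \<in> G j"
  unfolding lin_ext_def
proof (rule G_sum)
  fix b assume b: "b \<in> keys v"
  have "if deg b \<le> j then lookup v b \<in> part R (j - deg b) else lookup v b = 0"
    using assms(1) unfolding fpart_def by blast
  then have "deg b \<le> j" "lookup v b \<in> part R (j - deg b)"
    using b by (auto simp: in_keys_iff split: if_splits)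
  then show "sc (lookup v b) (f b) \<in> G j"
    using sc_in[of _ "j - deg b" "f b" "deg b"] assms(2)[OF b] by simp
qed

section \<open>Betti numbers computed from an arbitrary resolution\<close>

lemma vector_space_mult: "vector_space ((*) :: 'k::field \<Rightarrow> _)"
  by unfold_locales (auto simp: algebra_simps)

lemma dim_mult_UNIV: "fin_dim ((*) :: 'k::field \<Rightarrow> _) UNIV" "vector_space.dim ((*) :: 'k \<Rightarrow> _) UNIV = 1"
proof -
  have *: "module.span (*) {1::'k} = UNIV"
    unfolding module.span_singleton[OF module_mult] by auto
  then show "fin_dim ((*) :: 'k \<Rightarrow> _) UNIV" unfolding fin_dim_def by (intro exI[of _ "{1}"]) simp
  have "\<not> module.dependent (*) {1::'k}"
    by (simp add: vector_space.dependent_single[OF vector_space_mult])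
  then show "vector_space.dim ((*) :: 'k \<Rightarrow> _) UNIV = 1"
    using vector_space.dim_span_eq_card_independent[OF vector_space_mult, of "{1}"] * by simp
qed

lemma sum_single_eq: "v = (\<Sum>p\<in>keys v. vscale (lookup v p) (single p (1::'a::comm_ring_1)))"
proof (rule poly_mapping_eqI)
  fix q
  have "(\<Sum>p\<in>keys v. lookup v p * lookup (single p 1) q)
     = (\<Sum>p\<in>keys v. if p = q then lookup v p else 0)"
    by (intro sum.cong) (auto simp: lookup_single)
  then show "lookup v q = lookup
      (\<Sum>p\<in>keys v. vscale (lookup v p) (single p 1)) q"
    by (simp add: lookup_sum in_keys_iff)
qed

text \<open>
  No minimality is assumed, so the Betti numbers may differ from the ranks of the free modules. All that
  follows is derived from the given resolution itself; it is never compared with a minimal one.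
\<close>
locale resolution = graded_module_over R sc G pr
  for R :: "('k::field, 'a::comm_ring_1) graded_algebra"
    and sc :: "'a \<Rightarrow> 'm::ab_group_add \<Rightarrow> 'm" and G and pr +
  fixes F :: "('a, 'm) free_complex"
  assumes res: "graded_free_resolution R \<lparr>mscale = sc, mpart = G\<rparr> F"
    and fin_dim_G: "fin_dim ksc (G j)"
begin

lemmas res' = res[unfolded graded_free_resolution_def graded_module.simps]

lemma res_fin: "finite {b \<in> basis F i. bdeg F i b = j}"
  using res'[THEN conjunct1] by blast

lemma res_aug: "b \<in> basis F 0 \<Longrightarrow> aug F b \<in> G (bdeg F 0 b)"
  using res'[THEN conjunct2, THEN conjunct1] by blast

lemma res_bdry: "b \<in> basis F (Suc i) \<Longrightarrow> bdry F i b \<in> free_mod (basis F i) \<and>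
        (\<forall>p\<in>keys (bdry F i b). bdeg F i p \<le> bdeg F (Suc i) b \<and>
           lookup (bdry F i b) p \<in> part R (bdeg F (Suc i) b - bdeg F i p))"
  using res'[THEN conjunct2, THEN conjunct2, THEN conjunct1] by blast

lemma res_surj: "lin_ext sc (aug F) ` free_mod (basis F 0) = UNIV"
  using res'[THEN conjunct2, THEN conjunct2, THEN conjunct2, THEN conjunct1] .

lemma res_exact_0: "{v \<in> free_mod (basis F 0). lin_ext sc (aug F) v = 0}
       = lin_ext vscale (bdry F 0) ` free_mod (basis F 1)"
  using res'[THEN conjunct2, THEN conjunct2, THEN conjunct2, THEN conjunct2, THEN conjunct1] .

lemma res_exact: "{v \<in> free_mod (basis F (Suc i)). lin_ext vscale (bdry F i) v = 0}
       = lin_ext vscale (bdry F (Suc i)) ` free_mod (basis F (Suc (Suc i)))"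
  using res'[THEN conjunct2, THEN conjunct2, THEN conjunct2, THEN conjunct2, THEN conjunct2] by blast

sublocale V: module "vscale :: 'a \<Rightarrow> (nat \<Rightarrow>\<^sub>0 'a) \<Rightarrow> _" by (rule module_vscale)
sublocale T: vector_space "vscale :: 'k \<Rightarrow> (nat \<Rightarrow>\<^sub>0 'k) \<Rightarrow> _" by (rule vector_space_vscale)
sublocale FK: vector_space fksc by (rule vector_space_fksc)
sublocale FG: graded_module_over R vscale "fpart R (bdeg F i)" "fpr R (bdeg F i)" for i
  by (rule graded_module_fpart)

abbreviation "FF i \<equiv> free_mod (basis F i) :: (nat \<Rightarrow>\<^sub>0 'a) set"
definition "Fj i j = fpart R (bdeg F i) j \<inter> FF i"

lemma fin_le: "finite {b \<in> basis F i. bdeg F i b \<le> j}"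
proof -
  have "{b \<in> basis F i. bdeg F i b \<le> j} = (\<Union>l\<le>j. {b \<in> basis F i. bdeg F i b = l})" by auto
  then show ?thesis using res_fin by simp
qed

subsection \<open>Exactness in each degree\<close>

text \<open>
  The values of \<^term>\<open>aug F\<close> and \<^term>\<open>bdry F i\<close> off the bases are unconstrained. Replacing them by
  zero yields maps that are homogeneous on the whole type.
\<close>
definition D0 :: "(nat \<Rightarrow>\<^sub>0 'a) \<Rightarrow> 'm" where
  "D0 = lin_ext sc (\<lambda>b. if b \<in> basis F 0 then aug F b else 0)"
definition D :: "nat \<Rightarrow> (nat \<Rightarrow>\<^sub>0 'a) \<Rightarrow> (nat \<Rightarrow>\<^sub>0 'a)" where
  "D i = lin_ext vscale (\<lambda>b. if b \<in> basis F (Suc i) then bdry F i b else 0)"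

lemma D0_eq: "v \<in> FF 0 \<Longrightarrow> D0 v = lin_ext sc (aug F) v"
  unfolding D0_def lin_ext_def free_mod_def by (intro sum.cong) auto

lemma D_eq: "v \<in> FF (Suc i) \<Longrightarrow> D i v = lin_ext vscale (bdry F i) v"
  unfolding D_def lin_ext_def free_mod_def by (intro sum.cong) auto

lemma D0_add: "D0 (v + w) = D0 v + D0 w" unfolding D0_def by (rule M.lin_ext_add)
lemma D_add: "D i (v + w) = D i v + D i w" unfolding D_def by (rule V.lin_ext_add)
lemma D0_vscale: "D0 (vscale r v) = sc r (D0 v)" unfolding D0_def by (rule M.lin_ext_vscale)
lemma D_vscale: "D i (vscale r v) = vscale r (D i v)" unfolding D_def by (rule V.lin_ext_vscale)

lemma bdry_in: "b \<in> basis F (Suc i) \<Longrightarrow> bdry F i b \<in> fpart R (bdeg F i) (bdeg F (Suc i) b)"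
  unfolding fpart_def
proof (intro CollectI allI)
  fix p assume b: "b \<in> basis F (Suc i)"
  show "if bdeg F i p \<le> bdeg F (Suc i) b then lookup (bdry F i b) p \<in> part R (bdeg F (Suc i) b - bdeg F i p)
      else lookup (bdry F i b) p = 0"
    using res_bdry[OF b] by (cases "p \<in> keys (bdry F i b)") (auto simp: in_keys_iff)
qed

lemma D0_homogeneous: "v \<in> fpart R (bdeg F 0) j \<Longrightarrow> D0 v \<in> G j"
  unfolding D0_def by (erule lin_ext_in) (auto simp: res_aug)

lemma D_homogeneous: "v \<in> fpart R (bdeg F (Suc i)) j \<Longrightarrow> D i v \<in> fpart R (bdeg F i) j"
  unfolding D_def by (erule FG.lin_ext_in) (auto simp: bdry_in FG.G_0)

lemma D_in_FF: "D i v \<in> FF i"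
  unfolding D_def by (rule lin_ext_in_free_mod) (use res_bdry in auto)

lemma pr_D0: "pr j (D0 v) = D0 (fpr R (bdeg F 0) j v)"
  using pr_homogeneous_map[OF FG.grading_axioms grading_axioms, of D0 0 0 j v] D0_add D0_homogeneous
  by simp

lemma fpr_D: "fpr R (bdeg F i) j (D i v) = D i (fpr R (bdeg F (Suc i)) j v)"
  using pr_homogeneous_map[OF FG.grading_axioms FG.grading_axioms, of "D i" "Suc i" i 0 j v]
    D_add D_homogeneous by simp

lemma fpr_in_Fj: "v \<in> FF i \<Longrightarrow> fpr R (bdeg F i) j v \<in> Fj i j"
  unfolding Fj_def using FG.pr_in fpr_free_mod by blast

lemma D_Fj: "v \<in> Fj (Suc i) j \<Longrightarrow> D i v \<in> Fj i j"
  unfolding Fj_def using D_homogeneous D_in_FF by blast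

lemma D0_surj: "D0 ` FF 0 = UNIV" using res_surj D0_eq by (metis (no_types, lifting) image_cong)

lemma D0_Fj: "D0 ` Fj 0 j = G j"
proof
  show "D0 ` Fj 0 j \<subseteq> G j" using D0_homogeneous unfolding Fj_def by blast
  show "G j \<subseteq> D0 ` Fj 0 j"
  proof
    fix m assume m: "m \<in> G j"
    obtain v where v: "v \<in> FF 0" "m = D0 v" using D0_surj by (metis UNIV_I imageE)
    then have "m = D0 (fpr R (bdeg F 0) j v)" using pr_D0[of j v] pr_same[OF m] by simp
    then show "m \<in> D0 ` Fj 0 j" using fpr_in_Fj[OF v(1)] by blast
  qed
qed

lemma exact_0: "v \<in> FF 0 \<Longrightarrow> D0 v = 0 \<Longrightarrow> \<exists>w\<in>FF 1. v = D 0 w"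
proof -
  assume v: "v \<in> FF 0" "D0 v = 0"
  have "v \<in> {v \<in> FF 0. lin_ext sc (aug F) v = 0}" using v D0_eq[OF v(1)] by simp
  then obtain w where w: "w \<in> FF 1" "v = lin_ext vscale (bdry F 0) w" unfolding res_exact_0 by blast
  show ?thesis by (rule bexI[OF _ w(1)]) (use w D_eq[of w 0] in simp)
qed

lemma exact: "v \<in> FF (Suc i) \<Longrightarrow> D i v = 0 \<Longrightarrow> \<exists>w\<in>FF (Suc (Suc i)). v = D (Suc i) w"
proof -
  assume v: "v \<in> FF (Suc i)" "D i v = 0"
  have "v \<in> {v \<in> FF (Suc i). lin_ext vscale (bdry F i) v = 0}" using v D_eq[OF v(1)] by simp
  then obtain w where w: "w \<in> FF (Suc (Suc i))" "v = lin_ext vscale (bdry F (Suc i)) w"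
    unfolding res_exact by blast
  show ?thesis by (rule bexI[OF _ w(1)]) (use w D_eq[of w "Suc i"] in simp)
qed

lemma D0_D: "w \<in> FF 1 \<Longrightarrow> D0 (D 0 w) = 0"
proof -
  assume w: "w \<in> FF 1"
  then have "D 0 w \<in> {v \<in> FF 0. lin_ext sc (aug F) v = 0}"
    unfolding res_exact_0 using w D_eq[of w 0] by simp
  then show ?thesis using D0_eq[of "D 0 w"] by simp
qed

lemma D_D: "w \<in> FF (Suc (Suc i)) \<Longrightarrow> D i (D (Suc i) w) = 0"
proof -
  assume w: "w \<in> FF (Suc (Suc i))"
  then have "D (Suc i) w \<in> {v \<in> FF (Suc i). lin_ext vscale (bdry F i) v = 0}"
    unfolding res_exact using w D_eq[of w "Suc i"] by simp
  then show ?thesis using D_eq[of "D (Suc i) w" i] by simp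
qed

lemma exact_0_Fj: "{v \<in> Fj 0 j. D0 v = 0} = D 0 ` Fj 1 j"
proof (intro set_eqI iffI)
  fix v assume v: "v \<in> {v \<in> Fj 0 j. D0 v = 0}"
  then obtain w where w: "w \<in> FF 1" "v = D 0 w" using exact_0 unfolding Fj_def by blast
  have "v = fpr R (bdeg F 0) j v" using v FG.pr_same unfolding Fj_def by simp
  then have "v = D 0 (fpr R (bdeg F 1) j w)" using fpr_D[of 0 j w] w(2) by simp
  then show "v \<in> D 0 ` Fj 1 j" using fpr_in_Fj[OF w(1)] by blast
next
  fix v assume "v \<in> D 0 ` Fj 1 j"
  then show "v \<in> {v \<in> Fj 0 j. D0 v = 0}" using D0_D D_Fj[of _ 0] unfolding Fj_def by auto
qed

lemma exact_Fj: "{v \<in> Fj (Suc i) j. D i v = 0} = D (Suc i) ` Fj (Suc (Suc i)) j"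
proof (intro set_eqI iffI)
  fix v assume v: "v \<in> {v \<in> Fj (Suc i) j. D i v = 0}"
  then obtain w where w: "w \<in> FF (Suc (Suc i))" "v = D (Suc i) w" using exact unfolding Fj_def by blast
  have "v = fpr R (bdeg F (Suc i)) j v" using v FG.pr_same unfolding Fj_def by simp
  then have "v = D (Suc i) (fpr R (bdeg F (Suc (Suc i))) j w)" using fpr_D[of "Suc i" j w] w(2) by simp
  then show "v \<in> D (Suc i) ` Fj (Suc (Suc i)) j" using fpr_in_Fj[OF w(1)] by blast
next
  fix v assume "v \<in> D (Suc i) ` Fj (Suc (Suc i)) j"
  then show "v \<in> {v \<in> Fj (Suc i) j. D i v = 0}" using D_D D_Fj unfolding Fj_def by auto
qed

definition "free_dim i j = FK.dim (Fj i j)"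
definition "image_dim i j = FK.dim (D i ` Fj (Suc i) j)"

lemma fin_dim_Fj: "fin_dim fksc (Fj i j)"
  unfolding Fj_def by (rule dim_fpart_free_mod(1)) (rule fin_le)

lemma fksc_eq: "fksc c v = vscale (smul R c 1) v" by (simp add: vscale_smul_1)

lemma subspace_Fj: "FK.subspace (Fj i j)"
  unfolding FK.subspace_def Fj_def fksc_eq
  using FG.G_0 FG.G_add FG.sc_in[OF smul_1_in, where j = j] free_mod_add free_mod_vscale by auto

lemma linear_D: "Vector_Spaces.linear fksc fksc (D i)"
proof (intro Vector_Spaces.linear.intro FK.vector_space_axioms module_hom.intro FK.module_axioms module_hom_axioms.intro)
  show "D i (x + y) = D i x + D i y" for x y by (rule D_add)
  show "D i (fksc c x) = fksc c (D i x)" for c x unfolding fksc_eq by (rule D_vscale)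
qed

lemma linear_D0: "Vector_Spaces.linear fksc ksc D0"
proof (intro Vector_Spaces.linear.intro FK.vector_space_axioms KM.vector_space_axioms module_hom.intro
    FK.module_axioms KM.module_axioms module_hom_axioms.intro)
  show "D0 (x + y) = D0 x + D0 y" for x y by (rule D0_add)
  show "D0 (fksc c x) = ksc c (D0 x)" for c x unfolding fksc_eq ksc_def by (rule D0_vscale)
qed

lemma free_dim_0: "free_dim 0 j = KM.dim (G j) + image_dim 0 j"
proof -
  interpret vector_space_pair fksc ksc by unfold_locales
  show ?thesis unfolding free_dim_def image_dim_def
    using rank_nullity[OF linear_D0 subspace_Fj fin_dim_Fj, of 0 j] D0_Fj exact_0_Fj by simp
qed

lemma free_dim_Suc: "free_dim (Suc i) j = image_dim i j + image_dim (Suc i) j"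
proof -
  interpret vector_space_pair fksc fksc by unfold_locales
  show ?thesis unfolding free_dim_def image_dim_def
    using rank_nullity[OF linear_D[of i] subspace_Fj[of "Suc i" j] fin_dim_Fj] exact_Fj by simp
qed

subsection \<open>Reduction modulo the irrelevant ideal\<close>

text \<open>
  \<open>\<epsilon>\<close> is the reduction \<open>F\<^sub>i \<rightarrow> k \<otimes> F\<^sub>i\<close>, and \<open>lift\<close> is its section with constant coefficients.
\<close>
definition \<epsilon> :: "(nat \<Rightarrow>\<^sub>0 'a) \<Rightarrow> (nat \<Rightarrow>\<^sub>0 'k)" where "\<epsilon> = Poly_Mapping.map (augmentation R)"
definition lift :: "(nat \<Rightarrow>\<^sub>0 'k) \<Rightarrow> (nat \<Rightarrow>\<^sub>0 'a)" where "lift = Poly_Mapping.map (\<lambda>c. smul R c 1)"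
abbreviation "tb \<equiv> tensor_bdry R F"

lemma lookup_\<epsilon> [simp]: "lookup (\<epsilon> v) p = augmentation R (lookup v p)"
  by (simp add: \<epsilon>_def lookup_map_0)

lemma lookup_lift [simp]: "lookup (lift v) p = smul R (lookup v p) 1"
  by (simp add: lift_def lookup_map_0)

lemma \<epsilon>_add: "\<epsilon> (v + w) = \<epsilon> v + \<epsilon> w"
  by (rule poly_mapping_eqI) (simp add: lookup_add aug_add)
lemma \<epsilon>_diff: "\<epsilon> (v - w) = \<epsilon> v - \<epsilon> w"
  by (rule poly_mapping_eqI) (simp add: lookup_minus aug_diff)
lemma \<epsilon>_vscale: "\<epsilon> (vscale r v) = vscale (augmentation R r) (\<epsilon> v)"
  by (rule poly_mapping_eqI) (simp add: aug_mult)
lemma \<epsilon>_lift [simp]: "\<epsilon> (lift v) = v"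
  by (rule poly_mapping_eqI) simp
lemma \<epsilon>_0 [simp]: "\<epsilon> 0 = 0"
  by (rule poly_mapping_eqI) simp

lemma \<epsilon>_D: "v \<in> FF (Suc i) \<Longrightarrow> \<epsilon> (D i v) = tb i (\<epsilon> v)"
proof -
  assume v: "v \<in> FF (Suc i)"
  have "\<epsilon> (D i v) = (\<Sum>b\<in>keys v. \<epsilon> (vscale (lookup v b) (bdry F i b)))"
    unfolding D_eq[OF v] lin_ext_def by (rule additive_sum) (rule \<epsilon>_add)
  also have "\<dots> = (\<Sum>b\<in>keys v. vscale (lookup (\<epsilon> v) b) (\<epsilon> (bdry F i b)))"
    by (simp add: \<epsilon>_vscale)
  also have "\<dots> = tb i (\<epsilon> v)"
    unfolding tensor_bdry_def \<epsilon>_def[symmetric]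
    by (rule T.lin_ext_superset[symmetric]) (auto simp: in_keys_iff)
  finally show ?thesis .
qed

lemma tensor_part_iff: "v \<in> tensor_part F i j \<longleftrightarrow>
    (\<forall>p. p \<notin> basis F i \<or> bdeg F i p \<noteq> j \<longrightarrow> lookup v p = 0)"
  unfolding tensor_part_def in_free_mod_iff by auto

lemma \<epsilon>_Fj: "v \<in> Fj i j \<Longrightarrow> \<epsilon> v \<in> tensor_part F i j"
proof (unfold tensor_part_iff, intro allI impI)
  fix p assume v: "v \<in> Fj i j" and p: "p \<notin> basis F i \<or> bdeg F i p \<noteq> j"
  have *: "if bdeg F i p \<le> j then lookup v p \<in> part R (j - bdeg F i p) else lookup v p = 0"
    using v unfolding Fj_def fpart_def by blast
  have "p \<notin> basis F i \<Longrightarrow> lookup v p = 0" using v unfolding Fj_def by (simp add: in_free_mod_iff)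
  then show "lookup (\<epsilon> v) p = 0"
    using p * aug_eq_0[of "lookup v p" "j - bdeg F i p"] by (auto split: if_splits)
qed

lemma lift_Fj: "v \<in> tensor_part F i j \<Longrightarrow> lift v \<in> Fj i j"
proof -
  assume v: "v \<in> tensor_part F i j"
  have "if bdeg F i p \<le> j then lookup (lift v) p \<in> part R (j - bdeg F i p)
       else lookup (lift v) p = 0" for p
    using v[unfolded tensor_part_iff, rule_format, of p] smul_1_in A.G_0 by (cases "bdeg F i p = j") auto
  moreover have "lift v \<in> FF i" using v unfolding tensor_part_iff by (simp add: in_free_mod_iff)
  ultimately show ?thesis unfolding Fj_def fpart_def by blast
qed

lemma tensor_part_FF: "v \<in> tensor_part F i j \<Longrightarrow> lift v \<in> FF i"
  using lift_Fj unfolding Fj_def by blast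

lemma tb_eq: "v \<in> tensor_part F (Suc i) j \<Longrightarrow> tb i v = \<epsilon> (D i (lift v))"
  using \<epsilon>_D[OF tensor_part_FF] by simp

lemma tb_in: "v \<in> tensor_part F (Suc i) j \<Longrightarrow> tb i v \<in> tensor_part F i j"
  using tb_eq \<epsilon>_Fj D_Fj lift_Fj by metis

lemma tb_tb: "v \<in> tensor_part F (Suc (Suc i)) j \<Longrightarrow> tb i (tb (Suc i) v) = 0"
  using tb_eq[of v "Suc i" j] \<epsilon>_D[OF D_in_FF] D_D[OF tensor_part_FF] by (metis \<epsilon>_0)

lemma boundaries_subset_cycles: "tensor_boundaries R F i j \<subseteq> tensor_cycles R F i j"
  unfolding tensor_boundaries_def tensor_cycles_def
  using tb_in tb_tb by (auto split: nat.splits)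

lemma subspace_tensor_part: "T.subspace (tensor_part F i j)"
  by (auto simp: T.subspace_def tensor_part_iff lookup_add)

definition "bcard i j = card {b \<in> basis F i. bdeg F i b = j}"

lemma tensor_part_dim: "fin_dim vscale (tensor_part F i j :: (nat \<Rightarrow>\<^sub>0 'k) set)"
    "T.dim (tensor_part F i j) = bcard i j"
proof -
  have *: "tensor_part F i j = {v :: nat \<Rightarrow>\<^sub>0 'k. \<forall>p. if p \<in> {b \<in> basis F i. bdeg F i b = j}
      then lookup v p \<in> UNIV else lookup v p = 0}"
    by (auto simp: tensor_part_iff)
  have eq: "(vscale :: 'k \<Rightarrow> (nat \<Rightarrow>\<^sub>0 'k) \<Rightarrow> _) = (\<lambda>c. Poly_Mapping.map ((*) c))"
    by (simp add: vscale_def fun_eq_iff)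
  have S: "module.subspace (*) (UNIV :: 'k set)" by (rule module.subspace_UNIV[OF module_mult])
  note A = dim_finsupp[where V = "\<lambda>_. UNIV", OF vector_space_mult res_fin[of i j] S dim_mult_UNIV(1)]
  show "fin_dim vscale (tensor_part F i j :: (nat \<Rightarrow>\<^sub>0 'k) set)"
    unfolding eq * using A by blast
  show "T.dim (tensor_part F i j) = bcard i j"
    unfolding eq * bcard_def using A by (simp only: dim_mult_UNIV sum_constant mult_1_right of_nat_id) 
qed

lemma lin_tb: "Vector_Spaces.linear vscale vscale (tb i)"
proof (intro Vector_Spaces.linear.intro T.vector_space_axioms module_hom.intro T.module_axioms module_hom_axioms.intro)
  show "tb i (x + y) = tb i x + tb i y" for x y unfolding tensor_bdry_def by (rule T.lin_ext_add)
  show "tb i (vscale c x) = vscale c (tb i x)" for c x unfolding tensor_bdry_def by (rule T.lin_ext_vscale)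
qed

sublocale TP: vector_space_pair "vscale :: 'k \<Rightarrow> (nat \<Rightarrow>\<^sub>0 'k) \<Rightarrow> _" "vscale :: 'k \<Rightarrow> (nat \<Rightarrow>\<^sub>0 'k) \<Rightarrow> _"
  by unfold_locales

definition "tor_rank i j = T.dim (tensor_boundaries R F i j)"

lemma subspace_boundaries: "T.subspace (tensor_boundaries R F i j)"
proof -
  interpret f: Vector_Spaces.linear vscale vscale "tb i" by (rule lin_tb)
  show ?thesis unfolding tensor_boundaries_def by (rule f.subspace_image) (rule subspace_tensor_part)
qed

lemma dim_cycles_0: "T.dim (tensor_cycles R F 0 j) = bcard 0 j"
  unfolding tensor_cycles_def by (simp add: tensor_part_dim)

lemma dim_cycles_Suc: "T.dim (tensor_cycles R F (Suc i) j) + tor_rank i j = bcard (Suc i) j"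
  unfolding tensor_cycles_def tor_rank_def tensor_boundaries_def
  using TP.rank_nullity[OF lin_tb[of i] subspace_tensor_part[of "Suc i" j] tensor_part_dim(1)]
  by (simp add: tensor_part_dim)

lemma cycles_subset: "tensor_cycles R F i j \<subseteq> tensor_part F i j"
  unfolding tensor_cycles_def by (auto split: nat.splits)

lemma subspace_cycles: "T.subspace (tensor_cycles R F i j)"
proof (cases i)
  case 0 then show ?thesis by (simp add: tensor_cycles_def subspace_tensor_part)
next
  case (Suc l)
  interpret f: Vector_Spaces.linear vscale vscale "tb l" by (rule lin_tb)
  show ?thesis using Suc subspace_tensor_part[of "Suc l" j]
    by (auto simp: tensor_cycles_def T.subspace_def f.zero f.add f.scale)
qed

lemma fin_dim_cycles: "fin_dim vscale (tensor_cycles R F i j :: (nat \<Rightarrow>\<^sub>0 'k) set)"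
  by (rule T.fin_dim_subset[OF tensor_part_dim(1) cycles_subset])

lemma tor_rank_le: "tor_rank i j \<le> T.dim (tensor_cycles R F i j)"
  unfolding tor_rank_def
  by (rule T.dim_mono_fin_dim[OF fin_dim_cycles subspace_cycles boundaries_subset_cycles])

definition "tor_dim i j = T.dim (tensor_cycles R F i j) - tor_rank i j"

lemma tor_dim_0: "int (tor_dim 0 j) = int (bcard 0 j) - int (tor_rank 0 j)"
  using tor_rank_le[of 0 j] dim_cycles_0[of j] by (simp add: tor_dim_def)

lemma tor_dim_Suc: "int (tor_dim (Suc i) j) = int (bcard (Suc i) j) - int (tor_rank i j) - int (tor_rank (Suc i) j)"
  using tor_rank_le[of "Suc i" j] dim_cycles_Suc[of i j] by (simp add: tor_dim_def)

lemma boundaries_eq_cycles: "tor_dim i j = 0 \<Longrightarrow> tensor_boundaries R F i j = tensor_cycles R F i j"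
  using T.subspace_eq_of_dim_ge[OF fin_dim_cycles subspace_cycles subspace_boundaries boundaries_subset_cycles, of i j]
  unfolding tor_dim_def tor_rank_def by simp

lemma sum_by_degree:
  fixes f :: "nat \<Rightarrow> nat"
  assumes "B \<subseteq> basis F i"
  shows "(\<Sum>p | p \<in> B \<and> bdeg F i p \<le> j. f (bdeg F i p)) =
    (\<Sum>l\<le>j. f l * card {p \<in> B. bdeg F i p = l})"
proof -
  have fin: "finite {p \<in> B. bdeg F i p \<le> j}"
    by (rule finite_subset[OF _ fin_le[of i j]]) (use assms in auto)
  have "(\<Sum>p | p \<in> B \<and> bdeg F i p \<le> j. f (bdeg F i p)) =
     (\<Sum>l\<le>j. \<Sum>p | p \<in> {p \<in> B. bdeg F i p \<le> j} \<and> bdeg F i p = l. f (bdeg F i p))"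
    by (rule sum.group[symmetric]) (use fin in auto)
  also have "\<dots> = (\<Sum>l\<le>j. \<Sum>p | p \<in> B \<and> bdeg F i p = l. f l)"
    by (intro sum.cong) auto
  finally show ?thesis by (simp add: mult.commute)
qed

lemma free_dim_eq: "free_dim i j = (\<Sum>l\<le>j. hdim R (j - l) * bcard i l)"
  unfolding free_dim_def Fj_def dim_fpart_free_mod(2)[OF fin_le] bcard_def
  by (rule sum_by_degree) simp

subsection \<open>Nakayama's lemma\<close>

lemma standard_vectors_span: "tensor_part F i l \<subseteq> T.span ((\<lambda>p. single p 1) ` {p \<in> basis F i. bdeg F i p = l})"
proof
  fix v :: "nat \<Rightarrow>\<^sub>0 'k" assume v: "v \<in> tensor_part F i l"
  have "v = (\<Sum>p\<in>keys v. vscale (lookup v p) (single p 1))"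
    by (rule sum_single_eq)
  also have "\<dots> \<in> T.span ((\<lambda>p. single p 1) ` {p \<in> basis F i. bdeg F i p = l})"
    by (intro T.span_sum T.span_scale T.span_base imageI)
       (use v in \<open>auto simp: tensor_part_iff in_keys_iff\<close>)
  finally show "v \<in> T.span ((\<lambda>p. single p 1) ` {p \<in> basis F i. bdeg F i p = l})" .
qed

lemma generators_complement:
  obtains C where "C \<subseteq> {p \<in> basis F i. bdeg F i p = l}" "card C + tor_rank i l = bcard i l"
    "\<forall>p\<in>basis F i. bdeg F i p = l \<longrightarrow>
       (\<exists>x\<in>free_mod C. \<exists>y\<in>tensor_part F (Suc i) l. single p (1::'k) = x + tb i y)"
proof -
  let ?e = "\<lambda>p. single p (1::'k)"
  have sub: "?e ` {p \<in> basis F i. bdeg F i p = l} \<subseteq> tensor_part F i l"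
    by (auto simp: tensor_part_iff lookup_single when_def)
  have bsub: "tensor_boundaries R F i l \<subseteq> tensor_part F i l"
    using boundaries_subset_cycles cycles_subset by blast
  obtain E where E: "E \<subseteq> ?e ` {p \<in> basis F i. bdeg F i p = l}" "finite E"
     "card E + T.dim (tensor_boundaries R F i l) = T.dim (tensor_part F i l)"
     "\<forall>v\<in>tensor_part F i l. \<exists>x\<in>T.span E. \<exists>u\<in>tensor_boundaries R F i l. v = x + u"
    by (rule T.complement_from_spanning_set[OF tensor_part_dim(1) subspace_tensor_part sub
        standard_vectors_span subspace_boundaries bsub])
  obtain C where C: "C \<subseteq> {p \<in> basis F i. bdeg F i p = l}" "E = ?e ` C"
    using E(1) by (meson subset_imageE)
  have inj: "inj_on ?e C"
  proof
    fix p q assume "?e p = ?e q"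
    then have "keys (?e p) = keys (?e q)" by simp
    then show "p = q" by simp
  qed
  have span: "T.span E \<subseteq> free_mod C"
  proof (rule T.span_minimal)
    show "E \<subseteq> free_mod C" unfolding C(2) by (auto intro: free_mod_single)
    show "T.subspace (free_mod C)"
      by (auto simp: T.subspace_def intro: free_mod_add free_mod_vscale)
  qed
  have "\<exists>x\<in>free_mod C. \<exists>y\<in>tensor_part F (Suc i) l. ?e p = x + tb i y"
    if p: "p \<in> basis F i" "bdeg F i p = l" for p
  proof -
    have "?e p \<in> tensor_part F i l" using sub p by blast
    then obtain x u where "x \<in> T.span E" "u \<in> tensor_boundaries R F i l" "?e p = x + u"
      using E(4) by blast
    then show ?thesis using span unfolding tensor_boundaries_def by blast
  qed
  moreover have "card C + tor_rank i l = bcard i l"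
    using E(3) card_image[OF inj] unfolding C(2) tor_rank_def tensor_part_dim by simp
  ultimately show ?thesis using that C(1) by blast
qed

text \<open>
  Nakayama's lemma for the cokernel of \<^term>\<open>D i\<close>: those basis elements whose reductions form a
  complement of the boundaries generate it, because modulo the image of \<^term>\<open>D i\<close> every
  other basis element is a combination of them and of basis elements of smaller degree.
\<close>
lemma Nakayama_generators:
  assumes C: "\<And>l. C l \<subseteq> {p \<in> basis F i. bdeg F i p = l}"
    and comp: "\<And>l. \<forall>p\<in>basis F i. bdeg F i p = l \<longrightarrow>
       (\<exists>x\<in>free_mod (C l). \<exists>y\<in>tensor_part F (Suc i) l. single p (1::'k) = x + tb i y)"
    and v: "v \<in> FF i"
  shows "\<exists>x\<in>free_mod (\<Union>l. C l). \<exists>w\<in>FF (Suc i). v = x + D i w"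
proof -
  define N where "N = {x + D i w | x w. x \<in> free_mod (\<Union>l. C l) \<and> w \<in> FF (Suc i)}"
  have N_add: "v + w \<in> N" if vw: "v \<in> N" "w \<in> N" for v w
  proof -
    obtain x y x' y' where "v = x + D i y" "w = x' + D i y'" "x \<in> free_mod (\<Union>l. C l)" "x' \<in> free_mod (\<Union>l. C l)"
       "y \<in> FF (Suc i)" "y' \<in> FF (Suc i)" using vw unfolding N_def by blast
    then show ?thesis unfolding N_def
      by (intro CollectI exI[of _ "x + x'"] exI[of _ "y + y'"]) (auto simp: D_add intro: free_mod_add)
  qed
  have N_scale: "vscale r v \<in> N" if v: "v \<in> N" for r v
  proof -
    obtain x y where "v = x + D i y" "x \<in> free_mod (\<Union>l. C l)" "y \<in> FF (Suc i)"
      using v unfolding N_def by blast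
    then show ?thesis unfolding N_def
      by (intro CollectI exI[of _ "vscale r x"] exI[of _ "vscale r y"])
         (auto simp: D_vscale V.scale_right_distrib intro: free_mod_vscale)
  qed
  have free_N: "x \<in> N" if "x \<in> free_mod (\<Union>l. C l)" for x unfolding N_def
    by (intro CollectI exI[of _ x] exI[of _ 0]) (use that D_def in auto)
  have D_N: "D i w \<in> N" if "w \<in> FF (Suc i)" for w unfolding N_def
    by (intro CollectI exI[of _ 0] exI[of _ w]) (use that in auto)
  have N_comb: "v \<in> N" if "\<And>p. p \<in> keys v \<Longrightarrow> single p 1 \<in> N" for v
  proof -
    have "v = (\<Sum>p\<in>keys v. vscale (lookup v p) (single p 1))"
      by (rule sum_single_eq)
    also have "\<dots> \<in> N"
    proof -
      have "(\<Sum>p\<in>S. vscale (lookup v p) (single p 1)) \<in> N"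
        if "finite S" "S \<subseteq> keys v" for S using that
        by (induction S rule: finite_induct) (auto intro: free_N N_add N_scale \<open>\<And>p. p \<in> keys v \<Longrightarrow> _\<close>)
      then show ?thesis by simp
    qed
    finally show ?thesis .
  qed
  have basis_N: "single p 1 \<in> N" if "p \<in> basis F i" for p using that
  proof (induction "bdeg F i p" arbitrary: p rule: less_induct)
    case less
    let ?l = "bdeg F i p"
    obtain x y where xy: "x \<in> free_mod (C ?l)" "y \<in> tensor_part F (Suc i) ?l"
       "single p (1::'k) = x + tb i y" using comp[of ?l] less.prems by blast
    have "x \<in> tensor_part F i ?l" using xy(1) C[of ?l] unfolding tensor_part_iff by (auto simp: in_free_mod_iff)
    then have lx: "lift x \<in> Fj i ?l" by (rule lift_Fj)
    have lxN: "lift x \<in> N" using xy(1) by (intro free_N) (auto simp: in_free_mod_iff)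
    have Dy: "D i (lift y) \<in> Fj i ?l" using D_Fj lift_Fj xy(2) by blast
    have DyN: "D i (lift y) \<in> N" using D_N tensor_part_FF xy(2) by blast
    have "lift (single p 1) = single p 1"
      by (rule poly_mapping_eqI) (simp add: lookup_single when_def)
    moreover have "single p 1 \<in> tensor_part F i ?l"
      using less.prems by (auto simp: tensor_part_iff lookup_single when_def)
    ultimately have e: "single p 1 \<in> Fj i ?l" "\<epsilon> (single p 1) = single p 1"
      using lift_Fj \<epsilon>_lift by metis+
    \<comment> \<open>The remainder vanishes modulo the irrelevant ideal, so only basis elements of smaller degree occur.\<close>
    define z where "z = single p 1 - (lift x + D i (lift y))"
    have z: "z \<in> Fj i ?l" unfolding z_def
      using FK.subspace_diff[OF subspace_Fj e(1) FK.subspace_add[OF subspace_Fj lx Dy]] .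
    have "\<epsilon> z = 0" unfolding z_def \<epsilon>_diff \<epsilon>_add e(2) xy(3) using tb_eq[OF xy(2)] by simp
    then have aug_z: "augmentation R (lookup z q) = 0" for q
      by (metis lookup_\<epsilon> lookup_zero)
    have "z \<in> N"
    proof (rule N_comb)
      fix q assume q: "q \<in> keys z"
      have q': "q \<in> basis F i" using z q unfolding Fj_def free_mod_def by blast
      have deg: "bdeg F i q \<le> ?l" "lookup z q \<in> part R (?l - bdeg F i q)"
        using z q unfolding Fj_def fpart_def by (auto simp: in_keys_iff split: if_splits)
      have "bdeg F i q \<noteq> ?l"
      proof
        assume "bdeg F i q = ?l"
        then have "lookup z q = 0" using aug_part_0[of "lookup z q"] deg(2) aug_z by simp
        then show False using q by (simp add: in_keys_iff)
      qed
      then show "single q 1 \<in> N" using less.hyps[of q] deg(1) q' by simp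
    qed
    moreover have "single p 1 = z + (lift x + D i (lift y))" by (simp add: z_def)
    ultimately show ?case using N_add lxN DyN by metis
  qed
  have "v \<in> N" by (rule N_comb) (use v basis_N in \<open>auto simp: free_mod_def\<close>)
  then show ?thesis unfolding N_def by blast
qed

text \<open>
  The module \<open>F\<^sub>i / im D\<^sub>i\<close> is generated by as many basis elements as remain after the rank of
  \<open>k \<otimes> D\<^sub>i\<close> is subtracted. This bounds its dimension from above and hence that of the image from below:
  the image is at least as large as a free module whose generators are counted by that rank.
\<close>
lemma free_summand_le_syzygies: "(\<Sum>l\<le>j. hdim R (j - l) * tor_rank i l) \<le> image_dim i j"
proof -
  have "\<forall>l. \<exists>C. C \<subseteq> {p \<in> basis F i. bdeg F i p = l} \<and> card C + tor_rank i l = bcard i l \<and>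
    (\<forall>p\<in>basis F i. bdeg F i p = l \<longrightarrow>
       (\<exists>x\<in>free_mod C. \<exists>y\<in>tensor_part F (Suc i) l. single p (1::'k) = x + tb i y))"
  proof
    fix l
    show "\<exists>C. C \<subseteq> {p \<in> basis F i. bdeg F i p = l} \<and> card C + tor_rank i l = bcard i l \<and>
      (\<forall>p\<in>basis F i. bdeg F i p = l \<longrightarrow>
       (\<exists>x\<in>free_mod C. \<exists>y\<in>tensor_part F (Suc i) l. single p (1::'k) = x + tb i y))"
      by (rule generators_complement[of i l]) (intro exI conjI)
  qed
  from choice[OF this] obtain C where CC: "\<forall>l. C l \<subseteq> {p \<in> basis F i. bdeg F i p = l} \<and> card (C l) + tor_rank i l = bcard i l \<and>
    (\<forall>p\<in>basis F i. bdeg F i p = l \<longrightarrow>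
       (\<exists>x\<in>free_mod (C l). \<exists>y\<in>tensor_part F (Suc i) l. single p (1::'k) = x + tb i y))"
    by (rule exE)
  note C = CC[THEN spec, THEN conjunct1] CC[THEN spec, THEN conjunct2, THEN conjunct1]
    CC[THEN spec, THEN conjunct2, THEN conjunct2]
  let ?C = "\<Union>l. C l"
  have CB: "?C \<subseteq> basis F i" using C(1) by blast
  have deg: "{p \<in> ?C. bdeg F i p = l} = C l" for l using C(1) by blast
  let ?W = "fpart R (bdeg F i) j \<inter> free_mod ?C"
  have fin: "finite {p \<in> ?C. bdeg F i p \<le> j}"
    by (rule finite_subset[OF _ fin_le[of i j]]) (use CB in auto)
  have fdW: "fin_dim fksc ?W" and dimW: "FK.dim ?W = (\<Sum>l\<le>j. hdim R (j - l) * card (C l))"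
    using dim_fpart_free_mod[OF fin] sum_by_degree[OF CB, where j = j and f = "\<lambda>l. hdim R (j - l)"] unfolding deg by auto
  have subW: "FK.subspace ?W"
    unfolding FK.subspace_def fksc_eq
    using FG.G_0 FG.G_add FG.sc_in[OF smul_1_in, where j = j] free_mod_add free_mod_vscale by auto
  interpret f: Vector_Spaces.linear fksc fksc "D i" by (rule linear_D)
  interpret vector_space_pair fksc fksc by unfold_locales
  have "free_dim i j \<le> FK.dim ?W + image_dim i j" unfolding free_dim_def image_dim_def
  proof (rule FK.dim_le_add[OF fdW subW])
    show "fin_dim fksc (D i ` Fj (Suc i) j)" by (rule fin_dim_image[OF linear_D fin_dim_Fj])
    show "FK.subspace (D i ` Fj (Suc i) j)" by (rule f.subspace_image[OF subspace_Fj])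
    fix v assume v: "v \<in> Fj i j"
    then obtain x w where xw: "x \<in> free_mod ?C" "w \<in> FF (Suc i)" "v = x + D i w"
      using Nakayama_generators[OF C(1,3), of v] unfolding Fj_def by blast
    have "v = fpr R (bdeg F i) j v" using v FG.pr_same unfolding Fj_def by simp
    also have "\<dots> = fpr R (bdeg F i) j x + D i (fpr R (bdeg F (Suc i)) j w)"
      using xw(3) FG.pr_add fpr_D by simp
    finally show "\<exists>u\<in>?W. \<exists>w\<in>D i ` Fj (Suc i) j. v = u + w"
      using FG.pr_in fpr_free_mod[OF xw(1)] fpr_in_Fj[OF xw(2)] by blast
  qed
  moreover have "free_dim i j = (\<Sum>l\<le>j. hdim R (j - l) * card (C l)) + (\<Sum>l\<le>j. hdim R (j - l) * tor_rank i l)"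
    unfolding free_dim_eq C(2)[symmetric] by (simp add: distrib_left sum.distrib)
  ultimately show ?thesis using dimW by simp
qed

end

subsection \<open>The Euler characteristic\<close>

text \<open>
  Here \<open>c (i + 1)\<close> is the Hilbert series of the image of \<^term>\<open>D i\<close> minus that of a free module whose generators
  are counted by the rank of \<open>k \<otimes> D\<^sub>i\<close>. The alternating sums of Betti numbers differ from \<open>H\<^sub>M / H\<^sub>R\<close> by \<open>\<plusminus> c n / H\<^sub>R\<close>.
  In a resolution that is not minimal the degrees of the bases need not grow with \<open>n\<close>; the bound
  \<open>0 \<le> c n \<le> H\<^sub>R \<beta>\<^sub>n\<close>, which follows from non-negativity and the recursion, is what controls the error term.
\<close>
lemma (in resolution) euler_characteristic:
  obtains c :: "nat \<Rightarrow> int fps" where "c 0 = Abs_fps (\<lambda>j. int (KM.dim (G j)))"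
    "\<And>i j. fps_nth (c i) j \<ge> 0"
    "\<And>i. c i + c (Suc i) = hilbert_series R * Abs_fps (\<lambda>j. int (tor_dim i j))"
proof -
  let ?H = "hilbert_series R"
  define c where "c i = (case i of 0 \<Rightarrow> Abs_fps (\<lambda>j. int (KM.dim (G j)))
     | Suc i \<Rightarrow> Abs_fps (\<lambda>j. int (image_dim i j)) - ?H * Abs_fps (\<lambda>j. int (tor_rank i j)))" for i
  have conv: "fps_nth (?H * Abs_fps (\<lambda>j. int (f j))) j = int (\<Sum>l\<le>j. hdim R (j - l) * f l)" for f j
    unfolding mult.commute[of ?H] fps_mult_nth
    by (simp add: hilbert_series_def atMost_atLeast0 mult.commute)
  have free_dim: "int (free_dim i j) = fps_nth (?H * Abs_fps (\<lambda>j. int (bcard i j))) j" for i j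
    unfolding conv free_dim_eq ..
  have "fps_nth (c i) j \<ge> 0" for i j
    using free_summand_le_syzygies conv[of "tor_rank (i - 1)" j]
    by (cases i) (simp_all add: c_def del: of_nat_sum)
  moreover have "c i + c (Suc i) = ?H * Abs_fps (\<lambda>j. int (tor_dim i j))" for i
  proof (cases i)
    case 0
    have b: "Abs_fps (\<lambda>j. int (tor_dim 0 j)) = Abs_fps (\<lambda>j. int (bcard 0 j)) - Abs_fps (\<lambda>j. int (tor_rank 0 j))"
      by (rule fps_ext) (simp add: tor_dim_0)
    have k: "Abs_fps (\<lambda>j. int (KM.dim (G j))) + Abs_fps (\<lambda>j. int (image_dim 0 j)) = ?H * Abs_fps (\<lambda>j. int (bcard 0 j))"
      by (rule fps_ext) (simp add: free_dim[symmetric] free_dim_0)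
    have "c i + c (Suc i) = (Abs_fps (\<lambda>j. int (KM.dim (G j))) + Abs_fps (\<lambda>j. int (image_dim 0 j)))
       - ?H * Abs_fps (\<lambda>j. int (tor_rank 0 j))" by (simp add: 0 c_def)
    then show ?thesis unfolding k 0 b by (simp only: right_diff_distrib)
  next
    case (Suc l)
    have b: "Abs_fps (\<lambda>j. int (tor_dim i j)) = Abs_fps (\<lambda>j. int (bcard i j)) - Abs_fps (\<lambda>j. int (tor_rank l j)) - Abs_fps (\<lambda>j. int (tor_rank i j))"
      by (rule fps_ext) (simp add: Suc tor_dim_Suc)
    have k: "Abs_fps (\<lambda>j. int (image_dim l j)) + Abs_fps (\<lambda>j. int (image_dim i j)) = ?H * Abs_fps (\<lambda>j. int (bcard i j))"
      by (rule fps_ext) (simp add: free_dim[symmetric] free_dim_Suc Suc)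
    have "c i + c (Suc i) = (Abs_fps (\<lambda>j. int (image_dim l j)) + Abs_fps (\<lambda>j. int (image_dim i j)))
       - ?H * Abs_fps (\<lambda>j. int (tor_rank l j)) - ?H * Abs_fps (\<lambda>j. int (tor_rank i j))" by (simp add: Suc c_def)
    then show ?thesis unfolding k b by (simp only: right_diff_distrib)
  qed
  moreover have "c 0 = Abs_fps (\<lambda>j. int (KM.dim (G j)))" by (simp add: c_def)
  ultimately show ?thesis using that by blast
qed

section \<open>Existence of graded free resolutions\<close>

definition graded_submodule :: "('a \<Rightarrow> 'm::ab_group_add \<Rightarrow> 'm) \<Rightarrow> (nat \<Rightarrow> 'm \<Rightarrow> 'm) \<Rightarrow> 'm set \<Rightarrow> bool" where
  "graded_submodule sc pr K \<longleftrightarrow> 0 \<in> K \<and> (\<forall>x\<in>K. \<forall>y\<in>K. x + y \<in> K) \<and> (\<forall>r. \<forall>x\<in>K. sc r x \<in> K) \<and>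
     (\<forall>j. \<forall>x\<in>K. pr j x \<in> K)"

context graded_module_over
begin

text \<open>
  A \<open>k\<close>-basis of each component serves as a set of generators, and \<open>prod_encode\<close> numbers the generators by
  degree and position. The images of indices outside \<open>B\<close> are controlled as well, so that the linear
  extension is homogeneous on the whole type.
\<close>
lemma graded_free_cover:
  assumes K: "graded_submodule sc pr K" and fd: "\<And>j. fin_dim ksc (K \<inter> G j)"
  obtains B deg f where "\<And>j. finite {b \<in> B. deg b = j}" "\<And>b. f b \<in> K \<inter> G (deg b)"
    "lin_ext sc f ` free_mod B = K"
proof -
  have K': "0 \<in> K" "\<And>x y. x \<in> K \<Longrightarrow> y \<in> K \<Longrightarrow> x + y \<in> K" "\<And>r x. x \<in> K \<Longrightarrow> sc r x \<in> K"
     "\<And>j x. x \<in> K \<Longrightarrow> pr j x \<in> K" using K unfolding graded_submodule_def by blast+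
  have Ksum: "sum f S \<in> K" if f: "\<And>x. x \<in> S \<Longrightarrow> f x \<in> K" for f :: "'z \<Rightarrow> 'm" and S
    using f by (induction S rule: infinite_finite_induct) (auto intro: K')
  have sub: "KM.subspace (K \<inter> G j)" for j
    by (auto simp: KM.subspace_def K' G_add ksc_in) (simp add: ksc_def K')
  have "\<forall>j. \<exists>p :: nat \<times> (nat \<Rightarrow> 'm). KM.span (snd p ` {..<fst p}) = K \<inter> G j"
  proof
    fix j
    obtain S where S: "finite S" "KM.span S = K \<inter> G j" by (rule KM.fin_dim_basis[OF fd sub])
    obtain n and e :: "nat \<Rightarrow> 'm" where "S = e ` {i. i < n}"
      using finite_imp_nat_seg_image_inj_on[OF S(1)] by blast
    then have "S = snd (n, e) ` {..<fst (n, e)}" by (simp add: lessThan_def)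
    then show "\<exists>p :: nat \<times> (nat \<Rightarrow> 'm). KM.span (snd p ` {..<fst p}) = K \<inter> G j"
      using S(2) by (intro exI[of _ "(n, e)"]) simp
  qed
  from choice[OF this] obtain p :: "nat \<Rightarrow> nat \<times> (nat \<Rightarrow> 'm)"
    where p: "\<forall>j. KM.span (snd (p j) ` {..<fst (p j)}) = K \<inter> G j" by (rule exE)
  define n where "n j = fst (p j)" for j
  define e where "e j = snd (p j)" for j
  have e: "KM.span (e j ` {..<n j}) = K \<inter> G j" for j
    using p[THEN spec, of j] by (simp only: n_def e_def)
  define B where "B = {prod_encode (j, i) | i j. i < n j}"
  define deg where "deg b = fst (prod_decode b)" for b
  define f where "f b = (if b \<in> B then e (deg b) (snd (prod_decode b)) else 0)" for b
  have "finite {b \<in> B. deg b = j}" for j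
  proof (rule finite_subset)
    show "{b \<in> B. deg b = j} \<subseteq> (\<lambda>i. prod_encode (j, i)) ` {..<n j}" unfolding B_def deg_def by auto
  qed simp
  moreover have fK: "f b \<in> K \<inter> G (deg b)" for b
  proof (cases "b \<in> B")
    case True
    then have "f b \<in> e (deg b) ` {..<n (deg b)}" unfolding f_def B_def deg_def by auto
    then have "f b \<in> KM.span (e (deg b) ` {..<n (deg b)})" by (rule KM.span_base)
    then show ?thesis unfolding e .
  qed (simp add: f_def K')
  moreover have "lin_ext sc f ` free_mod B = K"
  proof
    show "lin_ext sc f ` free_mod B \<subseteq> K"
      unfolding lin_ext_def using fK by (auto intro!: Ksum K'(3))
    let ?I = "lin_ext sc f ` free_mod B"
    have I_add: "x + y \<in> ?I" if xy: "x \<in> ?I" "y \<in> ?I" for x y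
    proof -
      obtain v w where "v \<in> free_mod B" "w \<in> free_mod B" "x = lin_ext sc f v" "y = lin_ext sc f w"
        using xy by blast
      then show ?thesis by (intro image_eqI[of _ _ "v + w"]) (auto simp: M.lin_ext_add intro: free_mod_add)
    qed
    have I_sc: "ksc c x \<in> ?I" if x: "x \<in> ?I" for c x
    proof -
      obtain v where "v \<in> free_mod B" "x = lin_ext sc f v" using x by blast
      then show ?thesis unfolding ksc_def
        by (intro image_eqI[of _ _ "vscale (smul R c 1) v"]) (auto simp: M.lin_ext_vscale intro: free_mod_vscale)
    qed
    have I_0: "0 \<in> ?I" by (intro image_eqI[of _ _ 0]) auto
    have I_sum: "sum g S \<in> ?I" if g: "\<And>x. x \<in> S \<Longrightarrow> g x \<in> ?I" for g :: "nat \<Rightarrow> 'm" and S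
      using g by (induction S rule: infinite_finite_induct) (auto intro: I_0 I_add)
    have homog: "K \<inter> G j \<subseteq> ?I" for j
      unfolding e[symmetric]
    proof (rule KM.span_minimal)
      show "KM.subspace ?I" unfolding KM.subspace_def using I_0 I_add I_sc by blast
      show "e j ` {..<n j} \<subseteq> ?I"
      proof
        fix x assume "x \<in> e j ` {..<n j}"
        then obtain i where i: "i < n j" "x = e j i" by blast
        let ?b = "prod_encode (j, i)"
        have b: "?b \<in> B" using i(1) unfolding B_def by blast
        then have "lin_ext sc f (single ?b 1) = x"
          using i(2) by (simp add: M.lin_ext_single f_def deg_def)
        then show "x \<in> ?I" using free_mod_single[OF b] by (metis imageI)
      qed
    qed
    show "K \<subseteq> ?I"
    proof
      fix x assume x: "x \<in> K"
      obtain n where n: "x = (\<Sum>i<n. pr i x)" using pr_fin by blast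
      have "pr i x \<in> ?I" for i using homog[of i] K'(4)[OF x, of i] pr_in[of i x] by blast
      then have "(\<Sum>i<n. pr i x) \<in> ?I" by (rule I_sum)
      then show "x \<in> ?I" using n by simp
    qed
  qed
  ultimately show ?thesis using that by blast
qed

lemma kernel_graded_submodule:
  assumes "\<And>b. f b \<in> G (deg b)"
  shows "graded_submodule vscale (fpr R deg) {v \<in> free_mod B. lin_ext sc f v = 0}"
proof -
  have "lin_ext sc f (fpr R deg j v) = pr j (lin_ext sc f v)" for j v
    using pr_homogeneous_map[OF grading_fpart grading_axioms, of "lin_ext sc f" deg 0 j v]
      M.lin_ext_add lin_ext_in[OF _ assms] by simp
  then show ?thesis unfolding graded_submodule_def
    by (auto simp: M.lin_ext_add M.lin_ext_vscale intro: free_mod_add free_mod_vscale fpr_free_mod)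
qed

text \<open>
  Dependent choice iterates the cover. A state consists of a basis, its degrees and the kernel of the
  map out of the free module on that basis, which the next step has to cover.
\<close>
theorem exists_graded_free_resolution:
  assumes fd: "\<And>j. fin_dim ksc (G j)"
  shows "\<exists>F. graded_free_resolution R \<lparr>mscale = sc, mpart = G\<rparr> F"
proof -
  have "graded_submodule sc pr UNIV" by (simp add: graded_submodule_def)
  moreover have "fin_dim ksc (UNIV \<inter> G j)" for j by (simp add: fd)
  ultimately obtain B0 deg0 f0 where 0: "\<And>j. finite {b \<in> B0. deg0 b = j}" "\<And>b. f0 b \<in> UNIV \<inter> G (deg0 b)"
    "lin_ext sc f0 ` free_mod B0 = UNIV"
    using graded_free_cover[of UNIV] by blast
  define good where "good = (\<lambda>(B, deg, K). (\<forall>j. finite {b \<in> B. deg b = j}) \<and> K \<subseteq> free_mod B \<and>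
      graded_submodule vscale (fpr R deg) K)"
  define S0 where "S0 = (B0, deg0, {v \<in> free_mod B0. lin_ext sc f0 v = 0})"
  define step where "step = (\<lambda>f :: nat \<Rightarrow> (nat \<Rightarrow>\<^sub>0 'a). \<lambda>(B :: nat set, deg, K). \<lambda>(B' :: nat set, deg', K').
     (\<forall>b. f b \<in> K \<inter> fpart R deg (deg' b)) \<and> lin_ext vscale f ` free_mod B' = K \<and>
     K' = {v \<in> free_mod B'. lin_ext vscale f v = 0})"
  have good_0: "good S0"
    using 0 kernel_graded_submodule[of f0 deg0 B0] unfolding good_def S0_def by auto
  have good_step: "\<exists>T. good T \<and> (\<exists>f. step f S T)" if S: "good S" for S
  proof -
    obtain B deg K where S_eq: "S = (B, deg, K)" by (cases S)
    have B: "\<And>j. finite {b \<in> B. deg b = j}" and KB: "K \<subseteq> free_mod B" and K: "graded_submodule vscale (fpr R deg) K"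
      using S unfolding S_eq good_def by auto
    interpret V: graded_module_over R vscale "fpart R deg" "fpr R deg" by (rule graded_module_fpart)
    have ksc: "V.ksc = fksc" by (intro ext) (simp add: V.ksc_def vscale_smul_1)
    have fin: "finite {b \<in> B. deg b \<le> j}" for j
    proof -
      have "{b \<in> B. deg b \<le> j} = (\<Union>l\<le>j. {b \<in> B. deg b = l})" by auto
      then show ?thesis using B by simp
    qed
    have fdK: "fin_dim V.ksc (K \<inter> fpart R deg j)" for j
      unfolding ksc
      by (rule vector_space.fin_dim_subset[OF vector_space_fksc dim_fpart_free_mod(1)[OF fin, of j]])
         (use KB in blast)
    obtain B' deg' f where f: "\<And>j. finite {b \<in> B'. deg' b = j}" "\<And>b. f b \<in> K \<inter> fpart R deg (deg' b)"
      "lin_ext vscale f ` free_mod B' = K"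
      using V.graded_free_cover[OF K fdK] by blast
    have "good (B', deg', {v \<in> free_mod B'. lin_ext vscale f v = 0})"
      using f(1) V.kernel_graded_submodule[of f deg' B'] f(2) unfolding good_def by auto
    moreover have "step f S (B', deg', {v \<in> free_mod B'. lin_ext vscale f v = 0})"
      using f unfolding step_def S_eq by auto
    ultimately show ?thesis by blast
  qed
  obtain s where s: "\<And>n. good (s n)" "s 0 = S0" "\<And>n. \<exists>f. step f (s n) (s (Suc n))"
  proof -
    have "\<exists>s. \<forall>n. (good (s n) \<and> (n = 0 \<longrightarrow> s n = S0)) \<and> (\<exists>f. step f (s n) (s (Suc n)))"
    proof (rule dependent_nat_choice)
      show "\<exists>x. good x \<and> ((0::nat) = 0 \<longrightarrow> x = S0)" using good_0 by (intro exI[of _ S0]) simp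
      show "\<exists>y. (good y \<and> (Suc n = 0 \<longrightarrow> y = S0)) \<and> (\<exists>f. step f x y)"
        if "good x \<and> (n = 0 \<longrightarrow> x = S0)" for x n
        using good_step[of x] that by simp
    qed
    then show ?thesis using that by blast
  qed
  then obtain f where f: "\<And>n. step (f n) (s n) (s (Suc n))" by metis
  define bs where "bs n = fst (s n)" for n
  define dg where "dg n = fst (snd (s n))" for n
  define K where "K n = snd (snd (s n))" for n
  have s_eq: "s n = (bs n, dg n, K n)" for n by (simp add: bs_def dg_def K_def)
  have g: "finite {b \<in> bs n. dg n b = j}" "K n \<subseteq> free_mod (bs n)" for n j
    using s(1)[of n] unfolding s_eq good_def by auto
  have st: "f n b \<in> K n" "f n b \<in> fpart R (dg n) (dg (Suc n) b)" "lin_ext vscale (f n) ` free_mod (bs (Suc n)) = K n"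
     "K (Suc n) = {v \<in> free_mod (bs (Suc n)). lin_ext vscale (f n) v = 0}" for n b
    using f[of n] unfolding s_eq step_def by auto
  have z: "bs 0 = B0" "dg 0 = deg0" "K 0 = {v \<in> free_mod B0. lin_ext sc f0 v = 0}"
    using s(2) unfolding s_eq S0_def by auto
  let ?F = "\<lparr>basis = bs, bdeg = dg, bdry = f, aug = f0\<rparr>"
  have "graded_free_resolution R \<lparr>mscale = sc, mpart = G\<rparr> ?F"
    unfolding graded_free_resolution_def graded_module.simps free_complex.simps
  proof (intro conjI allI ballI)
    show "finite {b \<in> bs i. dg i b = j}" for i j by (rule g)
    show "f0 b \<in> G (dg 0 b)" for b using 0(2) z by simp
    show "f i b \<in> free_mod (bs i)" for i b using st(1) g(2) by blast
    show "dg i p \<le> dg (Suc i) b" "lookup (f i b) p \<in> part R (dg (Suc i) b - dg i p)"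
      if p: "p \<in> keys (f i b)" for i b p
      using st(2)[of i b, unfolded fpart_def, THEN CollectD, rule_format, of p] p
      by (auto simp: in_keys_iff split: if_splits)
    show "lin_ext sc f0 ` free_mod (bs 0) = UNIV" using 0(3) z by simp
    show "{v \<in> free_mod (bs 0). lin_ext sc f0 v = 0} = lin_ext vscale (f 0) ` free_mod (bs 1)"
      using st(3)[of 0] z by simp
    show "{v \<in> free_mod (bs (Suc i)). lin_ext vscale (f i) v = 0}
      = lin_ext vscale (f (Suc i)) ` free_mod (bs (Suc (Suc i)))" for i
      using st(3)[of "Suc i"] st(4)[of i] by simp
  qed
  then show ?thesis by blast
qed

lemma betti_resolution:
  assumes fd: "\<And>j. fin_dim ksc (G j)"
  obtains F where "resolution R sc G pr F"
    "\<And>i j. betti R \<lparr>mscale = sc, mpart = G\<rparr> i j = resolution.tor_dim R F i j"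
proof -
  let ?F = "SOME F. graded_free_resolution R \<lparr>mscale = sc, mpart = G\<rparr> F"
  have "graded_free_resolution R \<lparr>mscale = sc, mpart = G\<rparr> ?F"
    using exists_graded_free_resolution[OF fd] by (rule someI_ex)
  then interpret r: resolution R sc G pr ?F
    by unfold_locales (simp_all add: fd)
  have "betti R \<lparr>mscale = sc, mpart = G\<rparr> i j = r.tor_dim i j" for i j
    unfolding betti_def Let_def r.tor_dim_def r.tor_rank_def ..
  then show ?thesis using that r.resolution_axioms by blast
qed

end

section \<open>Koszul algebras\<close>

context std_graded
begin

lemma residue_field_module:
  "graded_module_over R (\<lambda>x c. augmentation R x * c) (\<lambda>j. if j = 0 then UNIV else {0}) (\<lambda>j c. if j = 0 then c else 0)"
proof
  fix x :: 'a and i j :: nat and m :: 'k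
  assume "x \<in> part R i" "m \<in> (if j = 0 then UNIV else {0})"
  then show "augmentation R x * m \<in> (if i + j = 0 then UNIV else {0})"
    using aug_eq_0 by auto
next
  fix x :: 'k
  show "\<exists>n::nat. x = (\<Sum>i<n. if i = 0 then x else 0)" by (rule exI[of _ 1]) simp
qed (auto simp: algebra_simps aug_add aug_mult split: if_splits)

text \<open>
  The error term after \<open>n\<close> steps lies between \<open>0\<close> and \<open>H\<^sub>R \<beta>\<^sub>n\<close>, and \<open>\<beta>\<^sub>n\<close> is concentrated in degree \<open>n\<close>, so it does not
  affect coefficients below \<open>n\<close>.
\<close>
lemma koszul_hilbert_series:
  assumes "koszul R"
  shows "hilbert_series R * Abs_fps (\<lambda>i. (-1) ^ i * int (betti R (residue_field R) i i)) = 1"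
proof -
  let ?H = "hilbert_series R"
  let ?b = "betti R (residue_field R)"
  interpret M: graded_module_over R "\<lambda>x c. augmentation R x * c" "\<lambda>j. if j = 0 then UNIV else {0}" "\<lambda>j c. if j = 0 then c else 0"
    by (rule residue_field_module)
  have ksc: "M.ksc = (*)" by (intro ext) (simp add: M.ksc_def)
  have fd: "fin_dim M.ksc (if j = 0 then UNIV else {0})" for j :: nat
    using M.KM.fin_dim_subset[of UNIV "{0}"] dim_mult_UNIV(1) unfolding ksc by auto
  obtain F where F: "resolution R (\<lambda>x c. augmentation R x * c) (\<lambda>j. if j = 0 then UNIV else {0}) (\<lambda>j c. if j = 0 then c else 0) F"
    and b: "\<And>i j. ?b i j = resolution.tor_dim R F i j"
    using M.betti_resolution[OF fd] unfolding residue_field_def by blast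
  interpret r: resolution R "\<lambda>x c. augmentation R x * c" "\<lambda>j. if j = 0 then UNIV else {0}" "\<lambda>j c. if j = 0 then c else 0" F
    by (rule F)
  obtain c where c: "c 0 = Abs_fps (\<lambda>j. int (M.KM.dim (if j = 0 then UNIV else {0})))"
    "\<And>i j. fps_nth (c i) j \<ge> 0" "\<And>i. c i + c (Suc i) = ?H * Abs_fps (\<lambda>j. int (?b i j))"
    using r.euler_characteristic unfolding b by blast
  have c0: "c 0 = 1"
    unfolding c(1) ksc using dim_mult_UNIV(2)[where ?'k = 'k] M.KM.fin_dim_0_iff[of "{0}"] fd[of 1]
    by (intro fps_ext) (simp add: ksc M.KM.subspace_single_0)
  define A where "A n = (\<Sum>i<n. (-1) ^ i * Abs_fps (\<lambda>j. int (?b i j)))" for n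
  have part: "1 = ?H * A n + (-1) ^ n * c n" for n
  proof (induction n)
    case 0 then show ?case by (simp add: A_def c0)
  next
    case (Suc n)
    have "?H * A (Suc n) + (-1) ^ Suc n * c (Suc n) = ?H * A n + (-1) ^ n * (?H * Abs_fps (\<lambda>j. int (?b n j)) - c (Suc n))"
      by (simp add: A_def algebra_simps)
    also have "\<dots> = ?H * A n + (-1) ^ n * c n" by (simp flip: c(3))
    finally show ?case using Suc by simp
  qed
  have bz: "?b i j = 0" if "i \<noteq> j" for i j using assms that unfolding koszul_def by blast
  have small: "fps_nth (c n) j = 0" if "j < n" for n j
  proof -
    have "fps_nth (c n) j + fps_nth (c (Suc n)) j = fps_nth (?H * Abs_fps (\<lambda>j. int (?b n j))) j"
      using c(3)[of n] by (metis fps_add_nth)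
    also have "\<dots> = 0" unfolding fps_mult_nth using that bz by (intro sum.neutral) auto
    finally show ?thesis using c(2)[of n j] c(2)[of "Suc n" j] by linarith
  qed
  show ?thesis
  proof (rule fps_ext)
    fix j
    let ?n = "Suc j"
    have m1: "fps_nth ((-1) ^ i * f) l = (-1) ^ i * fps_nth f l" for i l and f :: "int fps"
      by (cases "even i") auto
    have An: "fps_nth (A ?n) l = (-1) ^ l * int (?b l l)" if "l \<le> j" for l
    proof -
      have "fps_nth (A ?n) l = (\<Sum>i<?n. if i = l then (-1) ^ l * int (?b l l) else 0)"
        unfolding A_def fps_sum_nth m1 by (intro sum.cong) (auto simp: bz)
      then show ?thesis using that by simp
    qed
    have "fps_nth (?H * Abs_fps (\<lambda>i. (-1) ^ i * int (?b i i))) j = fps_nth (?H * A ?n) j"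
      unfolding fps_mult_nth by (intro sum.cong refl) (simp add: An)
    also have "\<dots> = fps_nth (1 - (-1) ^ ?n * c ?n) j" using part[of ?n] by (simp add: algebra_simps)
    also have "\<dots> = fps_nth 1 j" unfolding fps_sub_nth m1 using small[of j ?n] by simp
    finally show "fps_nth (?H * Abs_fps (\<lambda>i. (-1) ^ i * int (?b i i))) j = fps_nth 1 j" .
  qed
qed

end

section \<open>Surjective morphisms of standard graded algebras\<close>

locale graded_surjection = Q: std_graded Q + R: std_graded R
  for Q :: "('k::field, 'q::comm_ring_1) graded_algebra" and R :: "('k, 'a::comm_ring_1) graded_algebra" +
  fixes \<phi> :: "'q \<Rightarrow> 'a"
  assumes morphism: "graded_morphism Q R \<phi>" and surj: "surj \<phi>"
begin

lemma \<phi>_add: "\<phi> (x + y) = \<phi> x + \<phi> y"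
  and \<phi>_mult: "\<phi> (x * y) = \<phi> x * \<phi> y"
  and \<phi>_1: "\<phi> 1 = 1"
  and \<phi>_smul: "\<phi> (smul Q c x) = smul R c (\<phi> x)"
  and \<phi>_part: "\<phi> ` part Q i \<subseteq> part R i"
  using morphism unfolding graded_morphism_def by blast+

lemma \<phi>_0 [simp]: "\<phi> 0 = 0" using \<phi>_add[of 0 0] by simp

lemma \<phi>_diff: "\<phi> (x - y) = \<phi> x - \<phi> y" using \<phi>_add[of "x - y" y] by (simp add: algebra_simps)

lemma \<phi>_sum: "\<phi> (sum f S) = (\<Sum>x\<in>S. \<phi> (f x))" by (rule additive_sum) (rule \<phi>_add)

lemma hpr_\<phi>: "hpr R j (\<phi> x) = \<phi> (hpr Q j x)"
proof -
  have "\<phi> y \<in> part R (i + 0)" if "y \<in> part Q i" for y i using \<phi>_part[of i] that by auto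
  from pr_homogeneous_map[OF Q.A.grading_axioms R.A.grading_axioms \<phi>_add this, of j x]
  show ?thesis by simp
qed

lemma \<phi>_part_eq: "\<phi> ` part Q j = part R j"
proof
  show "part R j \<subseteq> \<phi> ` part Q j"
  proof
    fix y assume y: "y \<in> part R j"
    obtain x where x: "y = \<phi> x" using surj by blast
    then have "y = \<phi> (hpr Q j x)" using R.A.pr_same[OF y] hpr_\<phi> by simp
    then show "y \<in> \<phi> ` part Q j" using Q.A.pr_in by blast
  qed
qed (rule \<phi>_part)

lemma aug_\<phi>: "augmentation R (\<phi> x) = augmentation Q x"
  by (rule R.aug_eqI) (simp add: hpr_\<phi> Q.hpr_0 \<phi>_smul \<phi>_1)

abbreviation "RQ \<equiv> \<lambda>x y. \<phi> x * y"

sublocale M: graded_module_over Q RQ "part R" "hpr R"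
proof
  fix x y i j assume *: "x \<in> part Q i" "y \<in> part R j"
  show "\<phi> x * y \<in> part R (i + j)" by (rule R.part_mult[OF _ *(2)]) (use * \<phi>_part in blast)
qed (auto simp: algebra_simps \<phi>_add \<phi>_mult \<phi>_1)

lemma ksc_eq: "M.ksc = smul R"
  by (intro ext) (simp add: M.ksc_def \<phi>_smul \<phi>_1 R.smul_1_mult)

lemma fin_dim_ksc: "fin_dim M.ksc (part R j)"
  unfolding ksc_eq by (rule R.fin_dim_part)

lemma ker_part_subspace: "Q.K.subspace {x \<in> part Q j. \<phi> x = 0}"
  using Q.part_subspace[of j] by (auto simp: Q.K.subspace_def \<phi>_add \<phi>_smul)

lemma ker_part_dim: "hdim Q j = hdim R j + Q.K.dim {x \<in> part Q j. \<phi> x = 0}"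
proof -
  interpret vector_space_pair "smul Q" "smul R" by unfold_locales
  have "Vector_Spaces.linear (smul Q) (smul R) \<phi>"
    by (intro Vector_Spaces.linear.intro Q.K.vector_space_axioms R.K.vector_space_axioms
      module_hom.intro Q.K.module_axioms R.K.module_axioms module_hom_axioms.intro \<phi>_add \<phi>_smul)
  from rank_nullity[OF this Q.part_subspace Q.fin_dim_part, of j] show ?thesis unfolding \<phi>_part_eq .
qed

lemma ker_part_fin_dim: "fin_dim (smul Q) {x \<in> part Q j. \<phi> x = 0}"
  by (rule Q.K.fin_dim_subset[OF Q.fin_dim_part]) auto

lemma inj_if_hilbert_series_eq:
  assumes "hilbert_series R = hilbert_series Q" "\<phi> u = 0"
  shows "u = 0"
proof (rule Q.A.eq_0_of_pr)
  fix j
  have "int (hdim R j) = int (hdim Q j)"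
    using arg_cong[OF assms(1), of "\<lambda>f. fps_nth f j"] by (simp add: hilbert_series_def)
  then have "{x \<in> part Q j. \<phi> x = 0} = {0}"
    using ker_part_dim[of j] Q.K.fin_dim_0_iff[OF ker_part_fin_dim ker_part_subspace, of j] by simp
  moreover have "\<phi> (hpr Q j u) = 0" using hpr_\<phi>[of j u] assms(2) by simp
  ultimately show "hpr Q j u = 0" using Q.A.pr_in[of j u] by blast
qed

subsection \<open>The first Betti number and the generators of the kernel\<close>

text \<open>
  With \<open>I\<close> the kernel and \<open>m\<close> the irrelevant ideal of \<open>Q\<close>, this is the inclusion of \<open>I / m I\<close> into \<open>Tor\<^sub>1(k, R)\<close>. For a resolution that
  need not begin with \<open>Q\<close> itself, one compares its first term with \<open>Q\<close> by means of a linear map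
  \<open>\<psi>\<close> lifting the augmentation through \<^term>\<open>\<phi>\<close>. The conclusion says that \<open>u\<close> is a sum of
  products of elements of \<open>m\<close> and of \<open>I\<close>.
\<close>
lemma ker_in_irrelevant_times_ker:
  assumes betti: "betti Q (restrict_scalars \<phi> R) 1 j = 0"
    and u: "u \<in> part Q j" "\<phi> u = 0"
    and W: "0 \<in> W" "\<And>x y. x \<in> W \<Longrightarrow> y \<in> W \<Longrightarrow> x + y \<in> W"
      "\<And>x y. augmentation Q x = 0 \<Longrightarrow> \<phi> y = 0 \<Longrightarrow> x * y \<in> W"
  shows "u \<in> W"
proof -
  obtain F where F: "resolution Q RQ (part R) (hpr R) F"
    and b: "\<And>i j. betti Q (restrict_scalars \<phi> R) i j = resolution.tor_dim Q F i j"
    using M.betti_resolution[OF fin_dim_ksc] unfolding restrict_scalars_def by blast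
  interpret r: resolution Q RQ "part R" "hpr R" F by (rule F)
  interpret m: module "(*) :: 'q \<Rightarrow> 'q \<Rightarrow> 'q" by (rule module_mult)
  have W_sum: "sum f S \<in> W" if f: "\<And>x. x \<in> S \<Longrightarrow> f x \<in> W" for f :: "nat \<Rightarrow> 'q" and S
    using f by (induction S rule: infinite_finite_induct) (auto intro: W)
  have aug_u: "augmentation Q u = 0" using aug_\<phi>[of u] u(2) by simp
  obtain e where e: "e \<in> r.Fj 0 0" "r.D0 e = 1" using r.D0_Fj[of 0] R.one_in by (metis imageE)
  have ue: "vscale u e \<in> r.Fj 0 j"
    using r.FG.sc_in[OF u(1), of e 0 0] e(1) free_mod_vscale[of e _ u] unfolding r.Fj_def by simp
  have "r.D0 (vscale u e) = 0" using e(2) u(2) by (simp add: r.D0_vscale)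
  then have "vscale u e \<in> {v \<in> r.Fj 0 j. r.D0 v = 0}" using ue by simp
  then obtain w where w: "w \<in> r.Fj 1 j" "vscale u e = r.D 0 w" unfolding r.exact_0_Fj by blast
  have wF: "w \<in> r.FF (Suc 0)" using w(1) unfolding r.Fj_def by simp
  have "r.\<epsilon> (vscale u e) = 0" unfolding r.\<epsilon>_vscale aug_u by (rule poly_mapping_eqI) simp
  then have "tensor_bdry Q F 0 (r.\<epsilon> w) = 0" using r.\<epsilon>_D[OF wF] w(2) by simp
  then have "r.\<epsilon> w \<in> tensor_cycles Q F 1 j"
    using r.\<epsilon>_Fj[OF w(1)] unfolding tensor_cycles_def by simp
  then have "r.\<epsilon> w \<in> tensor_boundaries Q F 1 j"
    using r.boundaries_eq_cycles[of 1 j] b betti by simp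
  then obtain v where v: "v \<in> tensor_part F (Suc 1) j" "r.\<epsilon> w = tensor_bdry Q F 1 v"
    unfolding tensor_boundaries_def by blast
  \<comment> \<open>Correcting \<open>w\<close> by a boundary moves all its coefficients into the irrelevant ideal.\<close>
  define w' where "w' = w - r.D 1 (r.lift v)"
  have "r.\<epsilon> w' = 0" unfolding w'_def r.\<epsilon>_diff v(2) r.tb_eq[OF v(1)] by simp
  then have w'_aug: "augmentation Q (lookup w' p) = 0" for p
    by (metis r.lookup_\<epsilon> lookup_zero)
  have "r.D 0 (r.D 1 (r.lift v)) = 0"
    using r.D_D[of "r.lift v" 0] r.tensor_part_FF[OF v(1)] by simp
  moreover have "w = w' + r.D 1 (r.lift v)" by (simp add: w'_def)
  ultimately have Dw': "vscale u e = r.D 0 w'" using w(2) r.D_add[of 0 w' "r.D 1 (r.lift v)"] by simp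
  define a0 where "a0 b = (if b \<in> basis F 0 then aug F b else 0)" for b
  have "\<exists>y. \<phi> y = a0 b" for b using surj by (metis surjD)
  then obtain s where s: "\<And>b. \<phi> (s b) = a0 b" by metis
  define \<psi> where "\<psi> = lin_ext (*) s"
  have \<phi>\<psi>: "\<phi> (\<psi> v) = r.D0 v" for v
    unfolding \<psi>_def r.D0_def lin_ext_def \<phi>_sum \<phi>_mult s a0_def ..
  have \<psi>_add: "\<psi> (v + w) = \<psi> v + \<psi> w" for v w unfolding \<psi>_def by (rule m.lin_ext_add)
  have \<psi>_vscale: "\<psi> (vscale x v) = x * \<psi> v" for x v unfolding \<psi>_def by (rule m.lin_ext_vscale)
  define g where "g b = (if b \<in> basis F (Suc 0) then bdry F 0 b else 0)" for b
  have "\<phi> (\<psi> (g b)) = 0" for b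
  proof (cases "b \<in> basis F (Suc 0)")
    case True
    have "r.D 0 (single b 1) = g b"
      unfolding r.D_def r.V.lin_ext_single g_def by simp
    then show ?thesis using r.D0_D[of "single b 1"] free_mod_single[OF True, of "1::'q"] by (simp add: \<phi>\<psi>)
  qed (simp add: g_def \<phi>\<psi> r.D0_def)
  moreover have "\<psi> (r.D 0 w') = (\<Sum>b\<in>keys w'. lookup w' b * \<psi> (g b))"
    unfolding r.D_def lin_ext_def[of vscale] g_def[symmetric]
    by (simp add: additive_sum[of \<psi>, OF \<psi>_add] \<psi>_vscale)
  moreover have "u * \<psi> e = \<psi> (r.D 0 w')" using \<psi>_vscale[of u e] Dw' by simp
  ultimately have 1: "u * \<psi> e \<in> W" using W_sum[of "keys w'"] W(3)[OF w'_aug] by simp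
  have "\<phi> (1 - \<psi> e) = 0" by (simp add: \<phi>_diff \<phi>_1 \<phi>\<psi> e(2))
  then have 2: "u * (1 - \<psi> e) \<in> W" using W(3) aug_u by blast
  have "u * \<psi> e + u * (1 - \<psi> e) = u" by (simp add: algebra_simps)
  then show ?thesis using W(2)[OF 1 2] by simp
qed

text \<open>
  Induction on the degree: where the first Betti number vanishes, elements of the kernel are combinations
  of kernel elements of smaller degree.
\<close>
lemma ker_subset_ideal:
  assumes J: "0 \<in> J" "\<And>x y. x \<in> J \<Longrightarrow> y \<in> J \<Longrightarrow> x + y \<in> J" "\<And>x y. y \<in> J \<Longrightarrow> x * y \<in> J"
    and gen: "\<And>j. betti Q (restrict_scalars \<phi> R) 1 j = 0 \<or> {x \<in> part Q j. \<phi> x = 0} \<subseteq> J"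
    and u: "\<phi> u = 0"
  shows "u \<in> J"
proof -
  have J_sum: "sum f S \<in> J" if f: "\<And>x. x \<in> S \<Longrightarrow> f x \<in> J" for f :: "nat \<Rightarrow> 'q" and S
    using f by (induction S rule: infinite_finite_induct) (auto intro: J)
  have homog: "x \<in> J" if "x \<in> part Q j" "\<phi> x = 0" for x j using that
  proof (induction j arbitrary: x rule: less_induct)
    case (less j)
    show ?case
    proof (cases "{x \<in> part Q j. \<phi> x = 0} \<subseteq> J")
      case False
      then have b: "betti Q (restrict_scalars \<phi> R) 1 j = 0" using gen by blast
      have "x \<in> {x. hpr Q j x \<in> J}"
      proof (rule ker_in_irrelevant_times_ker[OF b less.prems])
        fix a y assume a: "augmentation Q a = 0" and y: "\<phi> y = 0"
        have "hpr Q i a * hpr Q (j - i) y \<in> J" if "i \<le> j" for i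
        proof (cases "i = 0")
          case True then show ?thesis using a J(1) by (simp add: Q.aug_eq_0_iff)
        next
          case False
          then have "hpr Q (j - i) y \<in> J"
            using less.IH[of "j - i" "hpr Q (j - i) y"] that Q.A.pr_in hpr_\<phi>[of "j - i" y] y by simp
          then show ?thesis by (rule J(3))
        qed
        then have "(\<Sum>i\<le>j. hpr Q i a * hpr Q (j - i) y) \<in> J" by (auto intro: J_sum)
        then show "a * y \<in> {x. hpr Q j x \<in> J}" by (simp add: Q.hpr_mult)
      qed (auto simp: J Q.A.pr_add)
      then show ?thesis using Q.A.pr_same[OF less.prems(1)] by simp
    qed (use less.prems in blast)
  qed
  obtain n where n: "u = (\<Sum>i<n. hpr Q i u)" using Q.A.pr_fin by blast
  have "(\<Sum>i<n. hpr Q i u) \<in> J"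
    by (rule J_sum, rule homog[OF Q.A.pr_in]) (simp add: hpr_\<phi>[symmetric] u)
  then show ?thesis using n by simp
qed

text \<open>
  With the Hilbert series \<open>H\<^sub>Q(z)(1 - z\<^sup>2)\<close> the kernel has a single quadric, and the count of
  dimensions leaves no room for an element annihilated by that quadric.
\<close>
lemma ker_principal_regular:
  assumes H: "hilbert_series R = hilbert_series Q * (1 - fps_X ^ 2)"
    and b: "\<And>j. j \<noteq> 2 \<Longrightarrow> betti Q (restrict_scalars \<phi> R) 1 j = 0"
  obtains q where "q \<in> part Q 2" "{u. \<phi> u = 0} = range ((*) q)" "\<forall>y. q * y = 0 \<longrightarrow> y = 0"
proof -
  have dim_R: "int (hdim R (j + 2)) = int (hdim Q (j + 2)) - int (hdim Q j)" for j
  proof -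
    have "fps_nth (hilbert_series R) (j + 2) = fps_nth (hilbert_series Q - fps_X ^ 2 * hilbert_series Q) (j + 2)"
      unfolding H by (simp add: algebra_simps)
    then show ?thesis by (simp add: hilbert_series_def fps_X_power_mult_nth)
  qed
  have dim: "Q.K.dim {x \<in> part Q (j + 2). \<phi> x = 0} = hdim Q j" for j
    using ker_part_dim[of "j + 2"] dim_R[of j] by linarith
  obtain B where B: "Q.K.span B = {x \<in> part Q 2. \<phi> x = 0}" "card B = 1"
  proof (rule Q.K.fin_dim_basis[OF ker_part_fin_dim ker_part_subspace, of 2])
    fix B assume "Q.K.span B = {x \<in> part Q 2. \<phi> x = 0}" "card B = Q.K.dim {x \<in> part Q 2. \<phi> x = 0}"
    then show thesis using that dim[of 0] Q.hdim_0 by (simp only: add_0)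
  qed
  then obtain q where q: "B = {q}" using card_1_singletonE by blast
  have ker2: "{x \<in> part Q 2. \<phi> x = 0} = range (\<lambda>c. smul Q c q)"
    using B(1) unfolding q Q.K.span_singleton by blast
  have "q \<in> {x \<in> part Q 2. \<phi> x = 0}" using Q.K.span_base[of q B] B(1) q by blast
  then have q2: "q \<in> part Q 2" and \<phi>q: "\<phi> q = 0" by auto
  have ker: "{u. \<phi> u = 0} = range ((*) q)"
  proof
    show "range ((*) q) \<subseteq> {u. \<phi> u = 0}" by (auto simp: \<phi>_mult \<phi>q)
    show "{u. \<phi> u = 0} \<subseteq> range ((*) q)"
    proof
      fix u assume "u \<in> {u. \<phi> u = 0}"
      then have u: "\<phi> u = 0" by simp
      show "u \<in> range ((*) q)"
      proof (rule ker_subset_ideal[OF _ _ _ _ u])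
        show "0 \<in> range ((*) q)" by (rule image_eqI[of _ _ 0]) auto
        show "x + y \<in> range ((*) q)" if "x \<in> range ((*) q)" "y \<in> range ((*) q)" for x y
          using that by (auto simp: distrib_left[symmetric])
        show "x * y \<in> range ((*) q)" if "y \<in> range ((*) q)" for x y
          using that by (auto simp: mult.left_commute)
        have "smul Q c q \<in> range ((*) q)" for c
          using Q.smul_1_mult[of c q] by (metis mult.commute rangeI)
        then show "betti Q (restrict_scalars \<phi> R) 1 j = 0 \<or> {x \<in> part Q j. \<phi> x = 0} \<subseteq> range ((*) q)" for j
          using b[of j] ker2 by (cases "j = 2") auto
      qed
    qed
  qed
  have homog: "{y \<in> part Q l. q * y = 0} = {0}" for l
  proof -
    have im: "(*) q ` part Q l = {x \<in> part Q (l + 2). \<phi> x = 0}"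
    proof
      show "(*) q ` part Q l \<subseteq> {x \<in> part Q (l + 2). \<phi> x = 0}"
        using Q.part_mult[OF q2, of _ l] by (auto simp: \<phi>_mult \<phi>q add.commute)
      show "{x \<in> part Q (l + 2). \<phi> x = 0} \<subseteq> (*) q ` part Q l"
      proof
        fix x assume x: "x \<in> {x \<in> part Q (l + 2). \<phi> x = 0}"
        then obtain y where y: "x = q * y" using ker by blast
        have "x = hpr Q (l + 2) x" using Q.A.pr_same x by simp
        also have "\<dots> = q * hpr Q l y" unfolding y Q.hpr_mult_homogeneous[OF q2] by simp
        finally show "x \<in> (*) q ` part Q l" using Q.A.pr_in by blast
      qed
    qed
    interpret vector_space_pair "smul Q" "smul Q" by unfold_locales
    have lin: "Vector_Spaces.linear (smul Q) (smul Q) ((*) q)"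
      by (intro Vector_Spaces.linear.intro Q.K.vector_space_axioms
        module_hom.intro Q.K.module_axioms module_hom_axioms.intro) (auto simp: algebra_simps Q.mult_smul)
    interpret f: Vector_Spaces.linear "smul Q" "smul Q" "(*) q" by (rule lin)
    have "Q.K.dim {y \<in> part Q l. q * y = 0} = 0"
      using rank_nullity[OF lin Q.part_subspace Q.fin_dim_part, of l] unfolding im dim by simp
    moreover have "Q.K.subspace {y \<in> part Q l. q * y = 0}"
      using Q.part_subspace[of l] by (auto simp: Q.K.subspace_def f.add f.scale)
    moreover have "fin_dim (smul Q) {y \<in> part Q l. q * y = 0}"
      by (rule Q.K.fin_dim_subset[OF Q.fin_dim_part]) auto
    ultimately show ?thesis using Q.K.fin_dim_0_iff by blast
  qed
  have "y = 0" if y: "q * y = 0" for y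
  proof (rule Q.A.eq_0_of_pr)
    fix l
    have "q * hpr Q l y = hpr Q (l + 2) (q * y)" unfolding Q.hpr_mult_homogeneous[OF q2] by simp
    then have "hpr Q l y \<in> {y \<in> part Q l. q * y = 0}" using y Q.A.pr_in by simp
    then show "hpr Q l y = 0" using homog by blast
  qed
  then show ?thesis using that q2 ker by blast
qed

text \<open>
  The constant terms in the recursion \<open>c 0 + c 1 = H\<^sub>Q \<beta>\<^sub>0\<close> of \<open>euler_characteristic\<close>, where \<open>c 0 = H\<^sub>R\<close>, give the bound
  because \<open>c 1\<close> is non-negative.
\<close>
lemma betti_00_pos: "betti Q (restrict_scalars \<phi> R) 0 0 \<ge> 1"
proof -
  obtain F where F: "resolution Q RQ (part R) (hpr R) F"
    and b: "\<And>i j. betti Q (restrict_scalars \<phi> R) i j = resolution.tor_dim Q F i j"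
    using M.betti_resolution[OF fin_dim_ksc] unfolding restrict_scalars_def by blast
  interpret r: resolution Q RQ "part R" "hpr R" F by (rule F)
  obtain c where c: "c 0 = Abs_fps (\<lambda>j. int (M.KM.dim (part R j)))"
    "\<And>i j. fps_nth (c i) j \<ge> 0" "\<And>i. c i + c (Suc i) = hilbert_series Q * Abs_fps (\<lambda>j. int (r.tor_dim i j))"
    using r.euler_characteristic by blast
  have "fps_nth (c 0 + c 1) 0 = int (r.tor_dim 0 0)"
    using c(3)[of 0] by (simp add: hilbert_series_def Q.hdim_0)
  moreover have "fps_nth (c 0) 0 = 1" unfolding c(1) ksc_eq by (simp add: R.hdim_0)
  ultimately show ?thesis unfolding b using c(2)[of 1 0] by simp
qed

end

section \<open>Golod morphisms onto Koszul algebras\<close>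

text \<open>
  The substitution of \<open>-z\<close> for \<open>z\<close>.
\<close>
definition alternate :: "int fps \<Rightarrow> int fps" where
  "alternate f = Abs_fps (\<lambda>n. (-1) ^ n * fps_nth f n)"

lemma alternate_nth [simp]: "fps_nth (alternate f) n = (-1) ^ n * fps_nth f n"
  by (simp add: alternate_def)

lemma alternate_add: "alternate (f + g) = alternate f + alternate g"
  by (rule fps_ext) (simp add: distrib_left)

lemma alternate_mult: "alternate (f * g) = alternate f * alternate g"
proof (rule fps_ext)
  fix n
  have "(\<Sum>i=0..n. (-1) ^ n * (fps_nth f i * fps_nth g (n - i)))
    = (\<Sum>i=0..n. (-1) ^ i * fps_nth f i * ((-1) ^ (n - i) * fps_nth g (n - i)))"
  proof (rule sum.cong[OF refl])
    fix i assume "i \<in> {0..n}"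
    then have "(-1::int) ^ n = (-1) ^ i * (-1) ^ (n - i)" by (simp flip: power_add)
    then show "(-1) ^ n * (fps_nth f i * fps_nth g (n - i))
      = (-1) ^ i * fps_nth f i * ((-1) ^ (n - i) * fps_nth g (n - i))" by simp
  qed
  then show "fps_nth (alternate (f * g)) n = fps_nth (alternate f * alternate g) n"
    by (simp add: fps_mult_nth sum_distrib_left)
qed

text \<open>
  The numerical content of the Golod equality. All coefficients of
  \<open>P\<^sup>R = P\<^sup>Q + z P\<^sup>R (P\<^sup>Q\<^sub>R - 1)\<close> are non-negative and \<open>P\<^sup>R\<close> lives on the diagonal, hence so does
  \<open>P\<^sup>Q\<close>, and \<open>P\<^sup>Q\<^sub>R - 1\<close> lives on the line next to it.
\<close>
lemma golod_koszul:
  assumes "standard_graded Q" "standard_graded R" and golod: "golod Q R \<phi>" and koszul: "koszul R"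
  defines "T \<equiv> betti Q (restrict_scalars \<phi> R)"
  obtains N where "\<And>n. fps_nth N n \<ge> 0" "fps_nth N 2 = int (T 1 2)" "\<And>j. j \<noteq> 2 \<Longrightarrow> T 1 j = 0"
    "hilbert_series R = hilbert_series Q * (1 - alternate N)"
proof -
  interpret Q: std_graded Q by unfold_locales fact
  interpret R: std_graded R by unfold_locales fact
  interpret graded_surjection Q R \<phi>
    by unfold_locales (use golod in \<open>auto simp: golod_def\<close>)
  define p where "p i j = int (betti R (residue_field R) i j)" for i j
  define q where "q i j = int (betti Q (residue_field Q) i j)" for i j
  define t where "t i j = int (T i j) - (if i = 0 \<and> j = 0 then 1 else 0)" for i j
  have t_nonneg: "t i j \<ge> 0" for i j using betti_00_pos unfolding t_def T_def by auto
  have p_off: "p i j = 0" if "i \<noteq> j" for i j using koszul that unfolding koszul_def p_def by simp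
  have p_nonneg: "p i j \<ge> 0" and q_nonneg: "q i j \<ge> 0" for i j by (simp_all add: p_def q_def)
  have "fps_nth (hilbert_series R * Abs_fps (\<lambda>i. (-1) ^ i * p i i)) 0 = 1"
    using R.koszul_hilbert_series[OF koszul] unfolding p_def by simp
  then have p00: "p 0 0 = 1" by (simp add: hilbert_series_def R.hdim_0)
  let ?P = "poincare_series R (residue_field R)" and ?Q = "poincare_series Q (residue_field Q)"
    and ?T = "poincare_series Q (restrict_scalars \<phi> R) - 1"
  have "?P - fps_X * (?P * ?T) = ?Q"
    using golod unfolding golod_def by (simp add: algebra_simps)
  then have PQ: "?P = ?Q + fps_X * (?P * ?T)" by (simp add: algebra_simps)
  have T_nth: "fps_nth (fps_nth ?T i) j = t i j" for i j
    by (simp add: poincare_series_def t_def T_def)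
  have main: "p n j = q n j + (if n = 0 then 0 else \<Sum>i\<le>n - 1. \<Sum>l\<le>j. p i l * t (n - 1 - i) (j - l))" for n j
  proof -
    have "fps_nth (fps_nth ?P n) j = fps_nth (fps_nth ?Q n) j + fps_nth (fps_nth (fps_X * (?P * ?T)) n) j"
      by (subst PQ) simp
    then have "p n j = q n j + (if n = 0 then 0 else fps_nth (fps_nth (?P * ?T) (n - 1)) j)"
      by (auto simp: p_def q_def poincare_series_def)
    also have "fps_nth (fps_nth (?P * ?T) (n - 1)) j = (\<Sum>i\<le>n - 1. \<Sum>l\<le>j. p i l * t (n - 1 - i) (j - l))"
      unfolding fps_mult_nth fps_sum_nth T_nth by (simp add: poincare_series_def p_def atMost_atLeast0)
    finally show ?thesis .
  qed
  have terms: "p i l * t m l' \<ge> 0" for i l m l' using p_nonneg t_nonneg by simp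
  have q_off: "q n j = 0" if "n \<noteq> j" for n j
  proof -
    have "(if n = 0 then 0 else \<Sum>i\<le>n - 1. \<Sum>l\<le>j. p i l * t (n - 1 - i) (j - l)) \<ge> 0"
      by (auto intro!: sum_nonneg terms)
    then show ?thesis using main[of n j] p_off[OF that] q_nonneg[of n j] by linarith
  qed
  then have koszul_Q: "koszul Q" unfolding koszul_def q_def by simp
  have t_off: "t m j = 0" if "j \<noteq> Suc m" for m j
  proof -
    have "(\<Sum>i\<le>m. \<Sum>l\<le>j. p i l * t (m - i) (j - l)) = 0"
      using main[of "Suc m" j] p_off[of "Suc m" j] q_off[of "Suc m" j] that by simp
    then have "\<forall>i\<in>{..m}. (\<Sum>l\<le>j. p i l * t (m - i) (j - l)) = 0"
      using sum_nonneg_eq_0_iff[of "{..m}" "\<lambda>i. \<Sum>l\<le>j. p i l * t (m - i) (j - l)"] terms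
      by (simp add: sum_nonneg)
    then have "(\<Sum>l\<le>j. p 0 l * t m (j - l)) = 0" by force
    then have "\<forall>l\<in>{..j}. p 0 l * t m (j - l) = 0"
      using sum_nonneg_eq_0_iff[of "{..j}" "\<lambda>l. p 0 l * t m (j - l)"] terms by simp
    then have "p 0 0 * t m (j - 0) = 0" by blast
    then show ?thesis using p00 by simp
  qed
  define N where "N = Abs_fps (\<lambda>n. if n = 0 then 0 else t (n - 1) n)"
  define pR where "pR = Abs_fps (\<lambda>n. p n n)"
  define pQ where "pQ = Abs_fps (\<lambda>n. q n n)"
  have "pR = pQ + pR * N"
  proof (rule fps_ext)
    fix n
    have "(if n = 0 then 0 else \<Sum>i\<le>n - 1. \<Sum>l\<le>n. p i l * t (n - 1 - i) (n - l))
       = (\<Sum>i=0..n. p i i * fps_nth N (n - i))"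
    proof (cases n)
      case 0 then show ?thesis by (simp add: N_def)
    next
      case (Suc m)
      have "(\<Sum>l\<le>n. p i l * t (n - 1 - i) (n - l)) = p i i * fps_nth N (n - i)" if "i \<le> m" for i
      proof -
        have "(\<Sum>l\<le>n. p i l * t (n - 1 - i) (n - l)) = (\<Sum>l\<le>n. if l = i then p i i * t (n - 1 - i) (n - i) else 0)"
          by (intro sum.cong) (auto simp: p_off)
        also have "\<dots> = p i i * t (n - 1 - i) (n - i)" using that Suc by simp
        also have "n - 1 - i = n - i - 1" by simp
        finally show ?thesis using that Suc by (simp add: N_def)
      qed
      then have "(\<Sum>i\<le>n - 1. \<Sum>l\<le>n. p i l * t (n - 1 - i) (n - l)) = (\<Sum>i\<le>m. p i i * fps_nth N (n - i))"
        using Suc by simp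
      also have "\<dots> = (\<Sum>i\<le>n. p i i * fps_nth N (n - i))"
        using Suc by (simp add: N_def)
      finally show ?thesis using Suc by (simp add: atMost_atLeast0)
    qed
    then show "fps_nth pR n = fps_nth (pQ + pR * N) n"
      using main[of n n] by (simp add: pR_def pQ_def fps_mult_nth)
  qed
  then have aR: "alternate pR = alternate pQ + alternate pR * alternate N"
    by (metis alternate_add alternate_mult)
  have R1: "hilbert_series R * alternate pR = 1" and Q1: "hilbert_series Q * alternate pQ = 1"
    using R.koszul_hilbert_series[OF koszul] Q.koszul_hilbert_series[OF koszul_Q]
    by (simp_all add: alternate_def pR_def pQ_def p_def q_def)
  have "alternate pQ = alternate pR * (1 - alternate N)" using aR by (simp add: algebra_simps)
  then have "hilbert_series R = hilbert_series R * (hilbert_series Q * (alternate pR * (1 - alternate N)))"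
    using Q1 by simp
  also have "\<dots> = (hilbert_series R * alternate pR) * (hilbert_series Q * (1 - alternate N))"
    by (simp only: ac_simps)
  finally have "hilbert_series R = hilbert_series Q * (1 - alternate N)" using R1 by simp
  moreover have "fps_nth N n \<ge> 0" for n by (simp add: N_def t_nonneg)
  moreover have "fps_nth N 2 = int (T 1 2)" by (simp add: N_def t_def)
  moreover have "T 1 j = 0" if "j \<noteq> 2" for j using t_off[of j 1] that by (simp add: t_def)
  ultimately show ?thesis using that by blast
qed

section \<open>Complete intersections\<close>

subsection \<open>The grading of the polynomial ring\<close>

type_synonym 'k mv_poly = "(nat \<Rightarrow>\<^sub>0 nat) \<Rightarrow>\<^sub>0 'k"

definition mdeg :: "(nat \<Rightarrow>\<^sub>0 nat) \<Rightarrow> nat" where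
  "mdeg m = (\<Sum>i\<in>keys m. lookup m i)"

lemma mdeg_add: "mdeg (m + m') = mdeg m + mdeg m'"
  unfolding mdeg_def by (rule setsum_keys_plus_distrib) auto

lemma mdeg_0 [simp]: "mdeg 0 = 0" by (simp add: mdeg_def)

lemma mdeg_single [simp]: "mdeg (single i d) = d"
  by (cases "d = 0") (simp_all add: mdeg_def)

lemma mdeg_eq_0_iff: "mdeg m = 0 \<longleftrightarrow> m = 0"
proof
  assume "mdeg m = 0"
  then have "lookup m i = 0" for i unfolding mdeg_def by (auto simp: in_keys_iff)
  then show "m = 0" by (intro poly_mapping_eqI) simp
qed simp

definition monomials :: "nat \<Rightarrow> nat \<Rightarrow> (nat \<Rightarrow>\<^sub>0 nat) set" where
  "monomials n d = {m. keys m \<subseteq> {..<n} \<and> mdeg m = d}"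

lemma monomials_0: "monomials n 0 = {0}"
  by (auto simp: monomials_def mdeg_eq_0_iff)

lemma monomials_no_variables: "monomials 0 (Suc d) = {}"
  by (auto simp: monomials_def mdeg_def)

text \<open>
  A monomial is either free of the last variable or divisible by it.
\<close>
lemma monomials_Suc: "monomials (Suc n) (Suc d)
    = monomials n (Suc d) \<union> (\<lambda>m. m + single n 1) ` monomials (Suc n) d"
proof (intro set_eqI iffI)
  fix m assume m: "m \<in> monomials (Suc n) (Suc d)"
  show "m \<in> monomials n (Suc d) \<union> (\<lambda>m. m + single n 1) ` monomials (Suc n) d"
  proof (cases "n \<in> keys m")
    case False
    have "keys m \<subseteq> {..<n}"
    proof
      fix i assume i: "i \<in> keys m"
      then have "i < Suc n" using m unfolding monomials_def by blast
      moreover have "i \<noteq> n" using i False by blast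
      ultimately show "i \<in> {..<n}" by simp
    qed
    then show ?thesis using m by (simp add: monomials_def)
  next
    case True
    define m' where "m' = m - single n 1"
    have eq: "m = m' + single n 1"
      using True by (intro poly_mapping_eqI)
        (auto simp: m'_def lookup_add lookup_minus lookup_single when_def in_keys_iff)
    have "keys m' \<subseteq> keys m"
      by (auto simp: m'_def lookup_minus in_keys_iff)
    moreover have "mdeg m = Suc (mdeg m')" by (subst eq) (simp add: mdeg_add)
    ultimately have "m' \<in> monomials (Suc n) d" using m unfolding monomials_def by auto
    then show ?thesis using eq by blast
  qed
next
  fix m assume "m \<in> monomials n (Suc d) \<union> (\<lambda>m. m + single n 1) ` monomials (Suc n) d"
  then show "m \<in> monomials (Suc n) (Suc d)"
  proof
    assume "m \<in> (\<lambda>m. m + single n 1) ` monomials (Suc n) d"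
    then obtain m' where m': "m' \<in> monomials (Suc n) d" "m = m' + single n 1" by blast
    have "keys m \<subseteq> keys m' \<union> {n}"
      unfolding m'(2) using Poly_Mapping.keys_add[of m' "single n 1"] by auto
    then show ?thesis using m'(1) unfolding monomials_def m'(2) by (auto simp: mdeg_add)
  qed (auto simp: monomials_def)
qed

lemma finite_monomials: "finite (monomials n d)"
proof (induction n arbitrary: d)
  case 0 then show ?case by (cases d) (simp_all add: monomials_0 monomials_no_variables)
next
  case (Suc n)
  show ?case by (induction d) (simp_all add: monomials_0 monomials_Suc Suc)
qed

lemma card_monomials_Suc: "card (monomials (Suc n) (Suc d)) = card (monomials n (Suc d)) + card (monomials (Suc n) d)"
proof -
  have "card (monomials n (Suc d) \<union> (\<lambda>m. m + single n 1) ` monomials (Suc n) d)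
    = card (monomials n (Suc d)) + card ((\<lambda>m. m + single n 1) ` monomials (Suc n) d)"
  proof (rule card_Un_disjoint)
    have "n \<in> keys (m + single n 1)" for m :: "nat \<Rightarrow>\<^sub>0 nat"
      by (simp add: in_keys_iff lookup_add)
    then show "monomials n (Suc d) \<inter> (\<lambda>m. m + single n 1) ` monomials (Suc n) d = {}"
      unfolding monomials_def by auto
  qed (simp_all add: finite_monomials)
  also have "card ((\<lambda>m. m + single n 1) ` monomials (Suc n) d) = card (monomials (Suc n) d)"
    by (rule card_image) (simp add: inj_on_def)
  finally show ?thesis unfolding monomials_Suc .
qed

lemma monomials_series: "Abs_fps (\<lambda>d. int (card (monomials n d))) * (1 - fps_X) ^ n = 1"
proof (induction n)
  case 0
  show ?case
  proof (rule fps_ext)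
    fix d show "fps_nth (Abs_fps (\<lambda>d. int (card (monomials 0 d))) * (1 - fps_X) ^ 0) d = fps_nth 1 d"
      by (cases d) (simp_all add: monomials_0 monomials_no_variables)
  qed
next
  case (Suc n)
  have "Abs_fps (\<lambda>d. int (card (monomials (Suc n) d))) * (1 - fps_X) = Abs_fps (\<lambda>d. int (card (monomials n d)))"
  proof (rule fps_ext)
    fix d
    show "fps_nth (Abs_fps (\<lambda>d. int (card (monomials (Suc n) d))) * (1 - fps_X)) d
      = fps_nth (Abs_fps (\<lambda>d. int (card (monomials n d)))) d"
      by (cases d) (simp_all add: right_diff_distrib card_monomials_Suc monomials_0)
  qed
  then show ?case using Suc by (simp add: mult.assoc[symmetric])
qed

definition gpart :: "nat \<Rightarrow> 'k::field mv_poly set" where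
  "gpart d = {p. \<forall>m\<in>keys p. mdeg m = d}"

definition gpr :: "nat \<Rightarrow> 'k::field mv_poly \<Rightarrow> 'k mv_poly" where
  "gpr d p = Poly_Mapping.mapp (\<lambda>m c. if mdeg m = d then c else 0) p"

lemma lookup_gpr: "lookup (gpr d p) m = (if mdeg m = d then lookup p m else 0)"
  unfolding gpr_def Poly_Mapping.lookup_mapp by (auto simp: in_keys_iff when_def)

interpretation G: grading gpart gpr
proof
  fix p :: "'k::field mv_poly"
  obtain N where N: "\<And>m. m \<in> keys p \<Longrightarrow> mdeg m < N"
    using finite_nat_set_iff_bounded[of "mdeg ` keys p"] by auto
  have "p = (\<Sum>i<N. gpr i p)"
  proof (rule poly_mapping_eqI)
    fix m
    have "(\<Sum>i<N. if mdeg m = i then lookup p m else 0) = lookup p m"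
      using N[of m] by (auto simp: in_keys_iff)
    then show "lookup p m = lookup (\<Sum>i<N. gpr i p) m"
      by (simp add: lookup_sum lookup_gpr)
  qed
  then show "\<exists>n. p = (\<Sum>i<n. gpr i p)" by blast
next
  fix i j and p :: "'k::field mv_poly" assume p: "p \<in> gpart i" "j \<noteq> i"
  show "gpr j p = 0"
    by (rule poly_mapping_eqI) (use p in \<open>auto simp: lookup_gpr gpart_def in_keys_iff\<close>)
next
  fix i and p :: "'k::field mv_poly" assume p: "p \<in> gpart i"
  show "gpr i p = p"
    by (rule poly_mapping_eqI) (use p in \<open>auto simp: lookup_gpr gpart_def in_keys_iff\<close>)
qed (auto simp: gpart_def lookup_gpr in_keys_iff lookup_add split: if_splits intro!: poly_mapping_eqI)

lemma gpart_mult: "p \<in> gpart d \<Longrightarrow> q \<in> gpart e \<Longrightarrow> p * q \<in> gpart (d + e)"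
  unfolding gpart_def using keys_mult[of p q] by (fastforce simp: mdeg_add)

lemma gpr_mult: "p \<in> gpart e \<Longrightarrow> gpr d (p * q) = (if e \<le> d then p * gpr (d - e) q else 0)"
  by (rule pr_homogeneous_map[OF G.grading_axioms G.grading_axioms])
     (simp add: distrib_left, metis add.commute gpart_mult)

lemma poly_ring_iff: "p \<in> poly_ring n \<longleftrightarrow> (\<forall>m. \<not> keys m \<subseteq> {..<n} \<longrightarrow> lookup p m = 0)"
  by (auto simp: poly_ring_def in_keys_iff)

lemma poly_part_eq: "poly_part n d = poly_ring n \<inter> gpart d"
  by (auto simp: poly_part_def gpart_def mdeg_def)

lemma poly_ring_closed:
  shows poly_ring_0 [simp]: "0 \<in> poly_ring n"
    and poly_ring_single [simp]: "single 0 c \<in> poly_ring n"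
    and poly_ring_add: "p \<in> poly_ring n \<Longrightarrow> q \<in> poly_ring n \<Longrightarrow> p + q \<in> poly_ring n"
    and poly_ring_diff: "p \<in> poly_ring n \<Longrightarrow> q \<in> poly_ring n \<Longrightarrow> p - q \<in> poly_ring n"
    and poly_ring_gpr: "p \<in> poly_ring n \<Longrightarrow> gpr d p \<in> poly_ring n"
  by (auto simp: poly_ring_iff lookup_add lookup_minus lookup_gpr lookup_single when_def)

lemma poly_ring_mult: "p \<in> poly_ring n \<Longrightarrow> q \<in> poly_ring n \<Longrightarrow> p * q \<in> poly_ring n"
proof -
  assume pq: "p \<in> poly_ring n" "q \<in> poly_ring n"
  have "keys m \<subseteq> {..<n}" if m: "m \<in> keys (p * q)" for m
  proof -
    obtain a b where "m = a + b" "a \<in> keys p" "b \<in> keys q"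
      using m keys_mult[of p q] by blast
    then show ?thesis using Poly_Mapping.keys_add[of a b] pq unfolding poly_ring_def by blast
  qed
  then show ?thesis unfolding poly_ring_def by blast
qed

lemma poly_ring_1 [simp]: "1 \<in> poly_ring n"
  using poly_ring_single[of 1] by simp

abbreviation psc :: "'k::field \<Rightarrow> 'k mv_poly \<Rightarrow> 'k mv_poly" where
  "psc \<equiv> \<lambda>c. Poly_Mapping.map ((*) c)"

lemma psc_eq: "psc c p = single 0 c * p" by (rule mult_map_scale_conv_mult)

lemma vector_space_psc: "vector_space (psc :: 'k::field \<Rightarrow> _)"
  by (rule vector_space_map_scale) (rule vector_space_mult)

lemma poly_part_dim:
  shows poly_part_fin_dim: "fin_dim psc (poly_part n d :: 'k::field mv_poly set)"
    and poly_part_subspace: "module.subspace psc (poly_part n d :: 'k mv_poly set)"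
    and dim_poly_part: "vector_space.dim psc (poly_part n d :: 'k mv_poly set) = card (monomials n d)"
proof -
  have *: "poly_part n d = {p :: 'k mv_poly. \<forall>m. if m \<in> monomials n d
      then lookup p m \<in> UNIV else lookup p m = 0}"
    by (auto simp: poly_part_eq poly_ring_def gpart_def monomials_def in_keys_iff)
  have S: "module.subspace (*) (UNIV :: 'k set)" by (rule module.subspace_UNIV[OF module_mult])
  note A = dim_finsupp[where V = "\<lambda>_. UNIV", OF vector_space_mult finite_monomials[of n d] S dim_mult_UNIV(1)]
  show "fin_dim psc (poly_part n d :: 'k mv_poly set)" unfolding * using A by blast
  show "module.subspace psc (poly_part n d :: 'k mv_poly set)" unfolding * using A by blast
  show "vector_space.dim psc (poly_part n d :: 'k mv_poly set) = card (monomials n d)"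
    unfolding * using A by (simp only: dim_mult_UNIV sum_constant mult_1_right of_nat_id)
qed

subsection \<open>Regular sequences\<close>

lemma poly_ideal_snoc:
  "poly_ideal n (fs @ [f]) = {x + c * f | x c. x \<in> poly_ideal n fs \<and> c \<in> poly_ring n}"
proof (intro set_eqI iffI)
  fix p assume "p \<in> poly_ideal n (fs @ [f])"
  then obtain c where c: "p = (\<Sum>i<length (fs @ [f]). c i * (fs @ [f]) ! i)" "\<And>i. c i \<in> poly_ring n"
    unfolding poly_ideal_def by blast
  have "p = (\<Sum>i<length fs. c i * fs ! i) + c (length fs) * f"
    unfolding c(1) by (simp add: nth_append)
  moreover have "(\<Sum>i<length fs. c i * fs ! i) \<in> poly_ideal n fs" unfolding poly_ideal_def using c(2) by blast
  ultimately show "p \<in> {x + c * f | x c. x \<in> poly_ideal n fs \<and> c \<in> poly_ring n}" using c(2) by blast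
next
  fix p assume "p \<in> {x + c * f | x c. x \<in> poly_ideal n fs \<and> c \<in> poly_ring n}"
  then obtain x a where p: "p = x + a * f" "x \<in> poly_ideal n fs" "a \<in> poly_ring n" by blast
  then obtain c where c: "x = (\<Sum>i<length fs. c i * fs ! i)" "\<And>i. c i \<in> poly_ring n"
    unfolding poly_ideal_def by blast
  let ?c = "\<lambda>i. if i < length fs then c i else a"
  have "p = (\<Sum>i<length (fs @ [f]). ?c i * (fs @ [f]) ! i)"
    unfolding p(1) c(1) by (simp add: nth_append)
  moreover have "\<forall>i. ?c i \<in> poly_ring n" using c(2) p(3) by simp
  ultimately show "p \<in> poly_ideal n (fs @ [f])" unfolding poly_ideal_def
    by (intro CollectI exI[of _ ?c] conjI)
qed

lemma poly_ideal_subset_snoc: "poly_ideal n fs \<subseteq> poly_ideal n (fs @ [f])"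
proof
  fix x assume "x \<in> poly_ideal n fs"
  moreover have "0 \<in> poly_ring n" by simp
  moreover have "x = x + 0 * f" by simp
  ultimately show "x \<in> poly_ideal n (fs @ [f])" unfolding poly_ideal_snoc by blast
qed

lemma poly_ideal_Nil: "poly_ideal n [] = {0}"
  unfolding poly_ideal_def by (auto intro: exI[of _ "\<lambda>_. 0"])

lemma poly_ideal_props:
  assumes "\<forall>f\<in>set fs. \<exists>d. f \<in> poly_part n d"
  shows poly_ideal_0: "0 \<in> poly_ideal n fs"
    and poly_ideal_add: "x \<in> poly_ideal n fs \<Longrightarrow> y \<in> poly_ideal n fs \<Longrightarrow> x + y \<in> poly_ideal n fs"
    and poly_ideal_mult: "x \<in> poly_ideal n fs \<Longrightarrow> r \<in> poly_ring n \<Longrightarrow> r * x \<in> poly_ideal n fs"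
    and poly_ideal_gpr: "x \<in> poly_ideal n fs \<Longrightarrow> gpr d x \<in> poly_ideal n fs"
    and poly_ideal_subset: "poly_ideal n fs \<subseteq> poly_ring n"
proof -
  have "0 \<in> poly_ideal n fs \<and> (\<forall>x\<in>poly_ideal n fs. \<forall>y\<in>poly_ideal n fs. x + y \<in> poly_ideal n fs) \<and>
    (\<forall>r\<in>poly_ring n. \<forall>x\<in>poly_ideal n fs. r * x \<in> poly_ideal n fs) \<and>
    (\<forall>d. \<forall>x\<in>poly_ideal n fs. gpr d x \<in> poly_ideal n fs) \<and> poly_ideal n fs \<subseteq> poly_ring n"
    using assms
  proof (induction fs rule: rev_induct)
    case Nil
    then show ?case by (simp add: poly_ideal_Nil)
  next
    case (snoc f fs)
    then have I: "0 \<in> poly_ideal n fs" "\<And>x y. x \<in> poly_ideal n fs \<Longrightarrow> y \<in> poly_ideal n fs \<Longrightarrow> x + y \<in> poly_ideal n fs"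
      "\<And>r x. r \<in> poly_ring n \<Longrightarrow> x \<in> poly_ideal n fs \<Longrightarrow> r * x \<in> poly_ideal n fs"
      "\<And>d x. x \<in> poly_ideal n fs \<Longrightarrow> gpr d x \<in> poly_ideal n fs" "poly_ideal n fs \<subseteq> poly_ring n"
      by auto
    obtain e where f: "f \<in> poly_part n e" using snoc.prems by auto
    let ?J = "{x + c * f | x c. x \<in> poly_ideal n fs \<and> c \<in> poly_ring n}"
    have J: "x + c * f \<in> ?J" if "x \<in> poly_ideal n fs" "c \<in> poly_ring n" for x c using that by blast
    show ?case unfolding poly_ideal_snoc
    proof (intro conjI ballI allI)
      show "0 \<in> ?J" using J[of 0 0] I(1) by simp
      show "x + y \<in> ?J" if xy: "x \<in> ?J" "y \<in> ?J" for x y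
      proof -
        obtain a b c d where ab: "x = a + c * f" "y = b + d * f" "a \<in> poly_ideal n fs" "b \<in> poly_ideal n fs"
           "c \<in> poly_ring n" "d \<in> poly_ring n" using xy by blast
        have "x + y = (a + b) + (c + d) * f" unfolding ab by (simp add: algebra_simps)
        then show ?thesis using J[OF I(2)[OF ab(3,4)] poly_ring_add[OF ab(5,6)]] by simp
      qed
      show "r * x \<in> ?J" if r: "r \<in> poly_ring n" and x: "x \<in> ?J" for r x
      proof -
        obtain a c where ac: "x = a + c * f" "a \<in> poly_ideal n fs" "c \<in> poly_ring n" using x by blast
        have "r * x = r * a + (r * c) * f" unfolding ac by (simp add: algebra_simps)
        then show ?thesis using J[OF I(3)[OF r ac(2)] poly_ring_mult[OF r ac(3)]] by simp
      qed
      show "gpr d x \<in> ?J" if x: "x \<in> ?J" for d x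
      proof -
        obtain a c where ac: "x = a + c * f" "a \<in> poly_ideal n fs" "c \<in> poly_ring n" using x by blast
        have "f \<in> gpart e" using f poly_part_eq by blast
        from gpr_mult[OF this, of d c]
        have "gpr d (c * f) = (if e \<le> d then gpr (d - e) c else 0) * f"
          by (simp add: mult.commute)
        then have "gpr d x = gpr d a + (if e \<le> d then gpr (d - e) c else 0) * f"
          unfolding ac by (simp add: G.pr_add)
        then show ?thesis using J[OF I(4)[OF ac(2)], of "if e \<le> d then gpr (d - e) c else 0"] ac(3)
          by (simp add: poly_ring_gpr)
      qed
      show "?J \<subseteq> poly_ring n" using I(5) f unfolding poly_part_eq by (auto intro!: poly_ring_add poly_ring_mult)
    qed
  qed
  then show "0 \<in> poly_ideal n fs"
    "x \<in> poly_ideal n fs \<Longrightarrow> y \<in> poly_ideal n fs \<Longrightarrow> x + y \<in> poly_ideal n fs"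
    "x \<in> poly_ideal n fs \<Longrightarrow> r \<in> poly_ring n \<Longrightarrow> r * x \<in> poly_ideal n fs"
    "x \<in> poly_ideal n fs \<Longrightarrow> gpr d x \<in> poly_ideal n fs"
    "poly_ideal n fs \<subseteq> poly_ring n" by blast+
qed

definition ideal_dim :: "nat \<Rightarrow> 'k::field mv_poly list \<Rightarrow> nat \<Rightarrow> nat" where
  "ideal_dim n fs d = vector_space.dim psc (poly_ideal n fs \<inter> gpart d)"

text \<open>
  The Hilbert series of the quotient by the ideal, counted inside the polynomial ring.
\<close>
definition quotient_series :: "nat \<Rightarrow> 'k::field mv_poly list \<Rightarrow> int fps" where
  "quotient_series n fs = Abs_fps (\<lambda>d. int (card (monomials n d)) - int (ideal_dim n fs d))"

text \<open>
  With \<open>S\<close> the polynomial ring and \<open>I\<close> the ideal of \<open>fs\<close>, one has \<open>(I + f S)\<^sub>d\<^sub>+\<^sub>e = I\<^sub>d\<^sub>+\<^sub>e + f S\<^sub>d\<close> and, by regularity,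
  \<open>I\<^sub>d\<^sub>+\<^sub>e \<inter> f S\<^sub>d = f I\<^sub>d\<close>. Regularity also gives \<open>f\<close> the same annihilator in \<open>S\<^sub>d\<close> and in \<open>I\<^sub>d\<close>, so the two images
  under multiplication by \<open>f\<close> differ in dimension by \<open>dim S\<^sub>d - dim I\<^sub>d\<close>.
\<close>
lemma quotient_series_snoc:
  fixes f :: "'k::field mv_poly"
  assumes fs: "\<forall>f\<in>set fs. \<exists>d. f \<in> poly_part n d" and f: "f \<in> poly_part n e"
    and reg: "\<And>p. p \<in> poly_ring n \<Longrightarrow> f * p \<in> poly_ideal n fs \<Longrightarrow> p \<in> poly_ideal n fs"
  shows "quotient_series n (fs @ [f]) = quotient_series n fs * (1 - fps_X ^ e)"
proof -
  interpret P: vector_space "psc :: 'k \<Rightarrow> _" by (rule vector_space_psc)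
  interpret vector_space_pair "psc :: 'k \<Rightarrow> _" "psc :: 'k \<Rightarrow> _" by unfold_locales
  let ?I = "\<lambda>d. poly_ideal n fs \<inter> gpart d"
  note I = poly_ideal_props[OF fs]
  have fR: "f \<in> poly_ring n" and fe: "f \<in> gpart e" using f poly_part_eq by blast+
  have psc_gpart: "psc c p \<in> gpart d" if "p \<in> gpart d" for c p d
    using that by (auto simp: gpart_def in_keys_iff lookup_map_0)
  have I_sub: "P.subspace (?I d)" for d
  proof -
    have "psc c x \<in> poly_ideal n fs" if "x \<in> poly_ideal n fs" for c x
      unfolding psc_eq by (rule I(3)[OF that poly_ring_single])
    then show ?thesis unfolding P.subspace_def using I(1,2) G.G_0 G.G_add psc_gpart by auto
  qed
  have I_part: "?I d \<subseteq> poly_part n d" for d using I(5) unfolding poly_part_eq by blast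
  have I_fd: "fin_dim psc (?I d)" for d by (rule P.fin_dim_subset[OF poly_part_fin_dim I_part])
  have lin: "Vector_Spaces.linear psc psc ((*) f)"
    by (intro Vector_Spaces.linear.intro P.vector_space_axioms module_hom.intro P.module_axioms module_hom_axioms.intro)
       (simp_all add: psc_eq algebra_simps)
  interpret l: Vector_Spaces.linear psc psc "(*) f" by (rule lin)
  have small: "poly_ideal n (fs @ [f]) \<inter> gpart d = ?I d" if "d < e" for d
  proof
    show "poly_ideal n (fs @ [f]) \<inter> gpart d \<subseteq> ?I d"
    proof
      fix x assume x: "x \<in> poly_ideal n (fs @ [f]) \<inter> gpart d"
      then obtain a c where ac: "x = a + c * f" "a \<in> poly_ideal n fs" unfolding poly_ideal_snoc by blast
      have "x = gpr d x" using x G.pr_same[symmetric] by blast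
      also have "\<dots> = gpr d a" using that unfolding ac by (simp add: G.pr_add mult.commute[of c] gpr_mult[OF fe])
      finally show "x \<in> ?I d" using I(4)[OF ac(2)] x by auto
    qed
    show "?I d \<subseteq> poly_ideal n (fs @ [f]) \<inter> gpart d"
      using poly_ideal_subset_snoc by blast
  qed
  have big: "poly_ideal n (fs @ [f]) \<inter> gpart (d + e) = {x + y | x y. x \<in> ?I (d + e) \<and> y \<in> (*) f ` poly_part n d}" (is "?L = ?R") for d
  proof
    show "?L \<subseteq> ?R"
    proof
      fix x assume x: "x \<in> ?L"
      then obtain a c where ac: "x = a + c * f" "a \<in> poly_ideal n fs" "c \<in> poly_ring n"
        unfolding poly_ideal_snoc by blast
      have "x = gpr (d + e) x" using x G.pr_same[symmetric] by blast
      also have "\<dots> = gpr (d + e) a + f * gpr d c"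
        unfolding ac by (simp add: G.pr_add mult.commute[of c] gpr_mult[OF fe])
      finally show "x \<in> ?R" using I(4)[OF ac(2)] G.pr_in poly_ring_gpr[OF ac(3)] unfolding poly_part_eq by blast
    qed
    show "?R \<subseteq> ?L"
    proof
      fix z assume "z \<in> ?R"
      then obtain x p where z: "z = x + f * p" "x \<in> ?I (d + e)" "p \<in> poly_part n d" by blast
      have "z = x + p * f" using z(1) by (simp add: mult.commute)
      then have "z \<in> poly_ideal n (fs @ [f])" unfolding poly_ideal_snoc using z(2,3) poly_part_eq by blast
      moreover have "f * p \<in> gpart (d + e)" using gpart_mult[OF fe, of p d] z(3) poly_part_eq by (auto simp: add.commute)
      ultimately show "z \<in> ?L" using z(1,2) G.G_add by blast
    qed
  qed
  have int: "?I (d + e) \<inter> (*) f ` poly_part n d = (*) f ` ?I d" for d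
  proof
    show "?I (d + e) \<inter> (*) f ` poly_part n d \<subseteq> (*) f ` ?I d"
    proof
      fix z assume z: "z \<in> ?I (d + e) \<inter> (*) f ` poly_part n d"
      then obtain p where p: "z = f * p" "p \<in> poly_part n d" by blast
      then have "p \<in> ?I d" using reg[of p] z unfolding poly_part_eq by blast
      then show "z \<in> (*) f ` ?I d" using p(1) by blast
    qed
    show "(*) f ` ?I d \<subseteq> ?I (d + e) \<inter> (*) f ` poly_part n d"
    proof
      fix z assume "z \<in> (*) f ` ?I d"
      then obtain p where p: "z = f * p" "p \<in> ?I d" by blast
      then have "p \<in> poly_part n d" using I_part by blast
      moreover have "f * p \<in> gpart (d + e)" using gpart_mult[OF fe, of p d] p(2) by (auto simp: add.commute)
      ultimately show "z \<in> ?I (d + e) \<inter> (*) f ` poly_part n d" using p I(3)[OF _ fR] by blast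
    qed
  qed
  have ann: "{p \<in> poly_part n d. f * p = 0} = {p \<in> ?I d. f * p = 0}" for d
    using reg I(1) I_part unfolding poly_part_eq by auto
  have rec: "int (ideal_dim n (fs @ [f]) (d + e)) = int (ideal_dim n fs (d + e)) + int (card (monomials n d)) - int (ideal_dim n fs d)" for d
  proof -
    have 1: "P.dim (poly_ideal n (fs @ [f]) \<inter> gpart (d + e)) + P.dim ((*) f ` ?I d) = P.dim (?I (d + e)) + P.dim ((*) f ` poly_part n d)"
      unfolding big int[symmetric]
      by (rule P.dim_sum_Int[OF I_sub I_fd l.subspace_image[OF poly_part_subspace] fin_dim_image[OF lin poly_part_fin_dim]])
    have 2: "P.dim (?I d) = P.dim ((*) f ` ?I d) + P.dim {p \<in> ?I d. f * p = 0}"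
      by (rule rank_nullity[OF lin I_sub I_fd])
    have 3: "card (monomials n d) = P.dim ((*) f ` poly_part n d) + P.dim {p \<in> ?I d. f * p = 0}"
      using rank_nullity[OF lin poly_part_subspace poly_part_fin_dim, of n d] unfolding dim_poly_part ann .
    show ?thesis unfolding ideal_dim_def using 1 2 3 by linarith
  qed
  show ?thesis
  proof (rule fps_ext)
    fix d
    let ?q = "quotient_series n fs"
    have nth: "fps_nth (?q * (1 - fps_X ^ e)) d = fps_nth ?q d - (if d < e then 0 else fps_nth ?q (d - e))"
      by (simp add: right_diff_distrib fps_X_power_mult_right_nth)
    show "fps_nth (quotient_series n (fs @ [f])) d = fps_nth (?q * (1 - fps_X ^ e)) d"
    proof (cases "d < e")
      case True
      then show ?thesis unfolding nth using small by (simp add: quotient_series_def ideal_dim_def)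
    next
      case False
      then obtain c where d: "d = c + e" by (metis add.commute le_add_diff_inverse not_less)
      show ?thesis unfolding nth unfolding d using rec[of c]
        by (simp add: quotient_series_def)
    qed
  qed
qed


lemma regular_sequence_snoc:
  assumes "homogeneous_regular_sequence n (fs @ [f])"
  shows "homogeneous_regular_sequence n fs" "\<exists>e. f \<in> poly_part n e"
    "\<And>p. p \<in> poly_ring n \<Longrightarrow> f * p \<in> poly_ideal n fs \<Longrightarrow> p \<in> poly_ideal n fs"
    "poly_ideal n (fs @ [f]) \<noteq> poly_ring n" "\<forall>f\<in>set fs. \<exists>d. f \<in> poly_part n d"
proof -
  have hom: "\<forall>f\<in>set (fs @ [f]). \<exists>d. f \<in> poly_part n d"
    and reg: "\<forall>i<length (fs @ [f]). \<forall>p\<in>poly_ring n.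
        (fs @ [f]) ! i * p \<in> poly_ideal n (take i (fs @ [f])) \<longrightarrow> p \<in> poly_ideal n (take i (fs @ [f]))"
    and proper: "poly_ideal n (fs @ [f]) \<noteq> poly_ring n"
    using assms unfolding homogeneous_regular_sequence_def by blast+
  show hom': "\<forall>f\<in>set fs. \<exists>d. f \<in> poly_part n d" and "\<exists>e. f \<in> poly_part n e" using hom by auto
  show "p \<in> poly_ideal n fs" if "p \<in> poly_ring n" "f * p \<in> poly_ideal n fs" for p
    using reg[rule_format, of "length fs" p] that by simp
  show "poly_ideal n (fs @ [f]) \<noteq> poly_ring n" by (rule proper)
  have "poly_ideal n fs \<subseteq> poly_ideal n (fs @ [f])"
    by (rule poly_ideal_subset_snoc)
  then have "poly_ideal n fs \<noteq> poly_ring n"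
    using proper poly_ideal_subset[OF hom] by blast
  moreover have "fs ! i * p \<in> poly_ideal n (take i fs) \<longrightarrow> p \<in> poly_ideal n (take i fs)"
    if "i < length fs" "p \<in> poly_ring n" for i p
    using reg[rule_format, of i p] that by (simp add: nth_append)
  ultimately show "homogeneous_regular_sequence n fs"
    unfolding homogeneous_regular_sequence_def using hom' by blast
qed

text \<open>
  Degree zero is impossible because the ideal is proper: a nonzero constant would generate
  everything, and zero is regular only modulo the unit ideal.
\<close>
lemma regular_sequence_degree_pos:
  fixes f :: "'k::field mv_poly"
  assumes "homogeneous_regular_sequence n (fs @ [f])" "f \<in> poly_part n e"
  shows "e > 0"
proof (rule ccontr)
  assume "\<not> e > 0"
  note r = regular_sequence_snoc[OF assms(1)]
  note I = poly_ideal_props[OF r(5)]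
  have "f = single 0 (lookup f 0)"
  proof (rule poly_mapping_eqI)
    fix m
    show "lookup f m = lookup (single 0 (lookup f 0)) m"
      using assms(2) \<open>\<not> e > 0\<close> unfolding poly_part_eq gpart_def
      by (cases "m = 0") (auto simp: lookup_single when_def mdeg_eq_0_iff in_keys_iff)
  qed
  then obtain c where c: "f = single 0 c" by blast
  have J: "poly_ideal n (fs @ [f]) \<subseteq> poly_ring n"
    by (rule poly_ideal_subset) (use r(2,5) in auto)
  have J_mult: "x \<in> poly_ideal n (fs @ [f]) \<Longrightarrow> y \<in> poly_ring n \<Longrightarrow> y * x \<in> poly_ideal n (fs @ [f])" for x y
    by (rule poly_ideal_mult) (use r(2,5) in auto)
  have "1 \<in> poly_ideal n (fs @ [f])"
  proof (cases "c = 0")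
    case True
    then have "1 \<in> poly_ideal n fs" using r(3)[of 1] I(1) c by simp
    then have "1 + 0 * f \<in> poly_ideal n (fs @ [f])" unfolding poly_ideal_snoc using poly_ring_0 by blast
    then show ?thesis by simp
  next
    case False
    then have "0 + single 0 (1 / c) * f = 1" unfolding c by (simp add: mult_single)
    moreover have "0 + single 0 (1 / c) * f \<in> poly_ideal n (fs @ [f])"
      unfolding poly_ideal_snoc using I(1) poly_ring_single by blast
    ultimately show ?thesis by simp
  qed
  then have "poly_ring n \<subseteq> poly_ideal n (fs @ [f])" using J_mult[of 1] by auto
  then show False using J r(4) by blast
qed

lemma quotient_series_regular_sequence:
  fixes fs :: "'k::field mv_poly list"
  assumes "homogeneous_regular_sequence n fs"
  obtains ds where "\<forall>d\<in>set ds. d > 0"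
    "quotient_series n fs * (1 - fps_X) ^ n = (\<Prod>d\<leftarrow>ds. 1 - fps_X ^ d)"
proof -
  have "\<exists>ds. (\<forall>d\<in>set ds. d > 0) \<and> quotient_series n fs * (1 - fps_X) ^ n = (\<Prod>d\<leftarrow>ds. 1 - fps_X ^ d)"
    using assms
  proof (induction fs rule: rev_induct)
    case Nil
    have "ideal_dim n ([] :: 'k mv_poly list) d = 0" for d
    proof -
      have "poly_ideal n [] \<inter> gpart d = ({0} :: 'k mv_poly set)" by (auto simp: poly_ideal_Nil)
      moreover interpret P: vector_space "psc :: 'k \<Rightarrow> _" by (rule vector_space_psc)
      have "P.dim {0} = 0" using P.dim_le_card[of "{0}" "{}"] by simp
      ultimately show ?thesis unfolding ideal_dim_def by simp
    qed
    then have "quotient_series n ([] :: 'k mv_poly list) * (1 - fps_X) ^ n = 1"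
      using monomials_series[of n] by (simp add: quotient_series_def)
    then show ?case by (intro exI[of _ "[]"]) simp
  next
    case (snoc f fs)
    note r = regular_sequence_snoc[OF snoc.prems]
    obtain ds where ds: "\<forall>d\<in>set ds. d > 0" "quotient_series n fs * (1 - fps_X) ^ n = (\<Prod>d\<leftarrow>ds. 1 - fps_X ^ d)"
      using snoc.IH[OF r(1)] by blast
    obtain e where e: "f \<in> poly_part n e" using r(2) by blast
    have "quotient_series n (fs @ [f]) = quotient_series n fs * (1 - fps_X ^ e)"
      by (rule quotient_series_snoc[OF r(5) e]) (rule r(3))
    then have "quotient_series n (fs @ [f]) * (1 - fps_X) ^ n
        = (quotient_series n fs * (1 - fps_X) ^ n) * (1 - fps_X ^ e)"
      by (simp only: ac_simps)
    also have "\<dots> = (\<Prod>d\<leftarrow>ds @ [e]. 1 - fps_X ^ d)" unfolding ds(2) by simp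
    finally show ?case using ds(1) regular_sequence_degree_pos[OF snoc.prems e]
      by (intro exI[of _ "ds @ [e]"]) auto
  qed
  then show ?thesis using that by blast
qed

subsection \<open>Presentations\<close>

text \<open>
  A presentation is additive only on the polynomials in the first \<open>n\<close> variables. Precomposing it with
  the truncation to those variables makes it linear on the whole type.
\<close>
definition trunc :: "nat \<Rightarrow> 'k::field mv_poly \<Rightarrow> 'k mv_poly" where
  "trunc n p = Poly_Mapping.mapp (\<lambda>m c. if keys m \<subseteq> {..<n} then c else 0) p"

lemma lookup_trunc: "lookup (trunc n p) m = (if keys m \<subseteq> {..<n} then lookup p m else 0)"
  unfolding trunc_def Poly_Mapping.lookup_mapp by (auto simp: in_keys_iff when_def)

lemma trunc_in: "trunc n p \<in> poly_ring n"
  by (auto simp: poly_ring_iff lookup_trunc)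

lemma trunc_same: "p \<in> poly_ring n \<Longrightarrow> trunc n p = p"
  by (rule poly_mapping_eqI) (auto simp: poly_ring_iff lookup_trunc)

lemma trunc_add: "trunc n (p + q) = trunc n p + trunc n q"
  by (rule poly_mapping_eqI) (simp add: lookup_trunc lookup_add)

lemma trunc_psc: "trunc n (psc c p) = psc c (trunc n p)"
  by (rule poly_mapping_eqI) (simp add: lookup_trunc lookup_map_0)

lemma trunc_gpart: "p \<in> gpart d \<Longrightarrow> trunc n p \<in> poly_part n d"
  unfolding poly_part_eq using trunc_in by (auto simp: gpart_def in_keys_iff lookup_trunc split: if_splits)

locale presentation = std_graded Q for Q :: "('k::field, 'q::comm_ring_1) graded_algebra" +
  fixes n :: nat and \<pi> :: "'k mv_poly \<Rightarrow> 'q"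
  assumes pres: "poly_presentation n Q \<pi>"
begin

lemma \<pi>_add: "p \<in> poly_ring n \<Longrightarrow> q \<in> poly_ring n \<Longrightarrow> \<pi> (p + q) = \<pi> p + \<pi> q"
  and \<pi>_mult: "p \<in> poly_ring n \<Longrightarrow> q \<in> poly_ring n \<Longrightarrow> \<pi> (p * q) = \<pi> p * \<pi> q"
  and \<pi>_single: "\<pi> (single 0 c) = smul Q c 1"
  and \<pi>_part: "\<pi> ` poly_part n d \<subseteq> part Q d"
  and \<pi>_surj: "\<pi> ` poly_ring n = UNIV"
  using pres unfolding poly_presentation_def by (simp_all only: Ball_def)

lemma \<pi>_1: "\<pi> 1 = 1" using \<pi>_single[of 1] by simp

lemma \<pi>_diff: "p \<in> poly_ring n \<Longrightarrow> q \<in> poly_ring n \<Longrightarrow> \<pi> (p - q) = \<pi> p - \<pi> q"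
  using \<pi>_add[of "p - q" q] by (simp add: poly_ring_diff algebra_simps)

definition \<pi>t where "\<pi>t p = \<pi> (trunc n p)"

lemma \<pi>t_eq: "p \<in> poly_ring n \<Longrightarrow> \<pi>t p = \<pi> p"
  by (simp add: \<pi>t_def trunc_same)

lemma \<pi>t_add: "\<pi>t (p + q) = \<pi>t p + \<pi>t q"
  unfolding \<pi>t_def trunc_add by (rule \<pi>_add[OF trunc_in trunc_in])

lemma \<pi>t_psc: "\<pi>t (psc c p) = smul Q c (\<pi>t p)"
  unfolding \<pi>t_def trunc_psc
  by (simp add: psc_eq \<pi>_mult[OF poly_ring_single trunc_in] \<pi>_single smul_1_mult)

lemma linear_\<pi>t: "Vector_Spaces.linear psc (smul Q) \<pi>t"
  by (intro Vector_Spaces.linear.intro vector_space_psc K.vector_space_axioms module_hom.intro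
      vector_space_psc[folded module_iff_vector_space] K.module_axioms module_hom_axioms.intro \<pi>t_add \<pi>t_psc)

lemma \<pi>_part_eq: "\<pi> ` poly_part n d = part Q d"
proof
  show "part Q d \<subseteq> \<pi> ` poly_part n d"
  proof
    fix y assume y: "y \<in> part Q d"
    obtain p where p: "p \<in> poly_ring n" "y = \<pi> p" using \<pi>_surj by (metis UNIV_I imageE)
    have hom: "\<pi>t q \<in> part Q (j + 0)" if "q \<in> gpart j" for q j
      unfolding \<pi>t_def using \<pi>_part[of j] trunc_gpart[OF that, of n] by auto
    have "y = hpr Q d (\<pi>t p)" using A.pr_same[OF y] p \<pi>t_eq by simp
    also have "\<dots> = \<pi>t (gpr d p)"
      using pr_homogeneous_map[OF G.grading_axioms A.grading_axioms \<pi>t_add hom, of d p] by simp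
    finally show "y \<in> \<pi> ` poly_part n d"
      unfolding \<pi>t_def using trunc_gpart[OF G.pr_in] by blast
  qed
qed (rule \<pi>_part)

lemma hilbert_series_quotient:
  assumes ker: "{p \<in> poly_ring n. \<pi> p = 0} = poly_ideal n fs"
  shows "hilbert_series Q = quotient_series n fs"
proof (rule fps_ext)
  fix d
  interpret P: vector_space "psc :: 'k \<Rightarrow> _" by (rule vector_space_psc)
  interpret vector_space_pair "psc :: 'k \<Rightarrow> _" "smul Q" by unfold_locales
  have sub: "poly_part n d \<subseteq> poly_ring n" unfolding poly_part_eq by blast
  have "\<pi>t ` poly_part n d = part Q d"
    unfolding \<pi>_part_eq[symmetric] by (rule image_cong) (use sub \<pi>t_eq in auto)
  moreover have "{p \<in> poly_part n d. \<pi>t p = 0} = poly_ideal n fs \<inter> gpart d"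
    unfolding ker[symmetric] poly_part_eq using \<pi>t_eq by auto
  ultimately have "card (monomials n d) = hdim Q d + ideal_dim n fs d"
    unfolding ideal_dim_def using rank_nullity[OF linear_\<pi>t poly_part_subspace poly_part_fin_dim, of n d]
    by (simp add: dim_poly_part)
  then show "fps_nth (hilbert_series Q) d = fps_nth (quotient_series n fs) d"
    by (simp add: hilbert_series_def quotient_series_def)
qed

end

lemma complete_intersection_hilbert_series:
  assumes "standard_graded Q" "complete_intersection Q"
  obtains n ds where "\<forall>d\<in>set ds. d > 0"
    "hilbert_series Q * (1 - fps_X) ^ n = (\<Prod>d\<leftarrow>ds. 1 - fps_X ^ d)"
proof -
  obtain n fs \<pi> where *: "homogeneous_regular_sequence n fs" "poly_presentation n Q \<pi>"
    "{p \<in> poly_ring n. \<pi> p = 0} = poly_ideal n fs"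
    using assms(2) unfolding complete_intersection_def by blast
  interpret presentation Q n \<pi> by unfold_locales fact+
  show ?thesis
    using quotient_series_regular_sequence[OF *(1)] that
    unfolding hilbert_series_quotient[OF *(3), symmetric] by blast
qed

context graded_surjection
begin

lemma presentation_comp:
  assumes "poly_presentation n Q \<pi>"
  shows "poly_presentation n R (\<phi> \<circ> \<pi>)"
proof -
  interpret presentation Q n \<pi> by unfold_locales fact
  have "range \<phi> = UNIV" by (rule surj)
  then have "(\<phi> \<circ> \<pi>) ` poly_ring n = UNIV" unfolding image_comp[symmetric] \<pi>_surj .
  moreover have "(\<phi> \<circ> \<pi>) ` poly_part n d \<subseteq> part R d" for d
    unfolding image_comp[symmetric] \<pi>_part_eq \<phi>_part_eq by simp
  ultimately show ?thesis
    unfolding poly_presentation_def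
    by (auto simp: \<pi>_add \<pi>_mult \<pi>_single \<phi>_add \<phi>_mult \<phi>_smul \<phi>_1)
qed

lemma complete_intersection_if_injective:
  assumes "complete_intersection Q" "\<And>u. \<phi> u = 0 \<Longrightarrow> u = 0"
  shows "complete_intersection R"
proof -
  obtain n fs \<pi> where *: "homogeneous_regular_sequence n fs" "poly_presentation n Q \<pi>"
    "{p \<in> poly_ring n. \<pi> p = 0} = poly_ideal n fs"
    using assms(1) unfolding complete_intersection_def by blast
  have "{p \<in> poly_ring n. (\<phi> \<circ> \<pi>) p = 0} = poly_ideal n fs"
    unfolding *(3)[symmetric] using assms(2) by auto
  then show ?thesis unfolding complete_intersection_def using *(1) presentation_comp[OF *(2)] by blast
qed

text \<open>
  A lift of \<open>q\<close> to the polynomial ring extends the regular sequence that presents \<open>Q\<close>.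
\<close>
lemma complete_intersection_if_regular_quotient:
  assumes "complete_intersection Q" and q: "q \<in> part Q d" "{u. \<phi> u = 0} = range ((*) q)"
    "\<forall>y. q * y = 0 \<longrightarrow> y = 0"
  shows "complete_intersection R"
proof -
  obtain n fs \<pi> where *: "homogeneous_regular_sequence n fs" "poly_presentation n Q \<pi>"
    "{p \<in> poly_ring n. \<pi> p = 0} = poly_ideal n fs"
    using assms(1) unfolding complete_intersection_def by blast
  interpret presentation Q n \<pi> by unfold_locales fact
  have hom: "\<forall>f\<in>set fs. \<exists>d. f \<in> poly_part n d"
    and reg: "\<forall>i<length fs. \<forall>p\<in>poly_ring n.
        fs ! i * p \<in> poly_ideal n (take i fs) \<longrightarrow> p \<in> poly_ideal n (take i fs)"
    using *(1) unfolding homogeneous_regular_sequence_def by blast+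
  have I: "p \<in> poly_ideal n fs \<longleftrightarrow> p \<in> poly_ring n \<and> \<pi> p = 0" for p using *(3) by blast
  obtain f where f: "f \<in> poly_part n d" "\<pi> f = q" using q(1) unfolding \<pi>_part_eq[symmetric] by blast
  have fR: "f \<in> poly_ring n" using f(1) poly_part_eq by blast
  have ker: "{p \<in> poly_ring n. (\<phi> \<circ> \<pi>) p = 0} = poly_ideal n (fs @ [f])"
  proof (intro set_eqI iffI)
    fix p assume p: "p \<in> {p \<in> poly_ring n. (\<phi> \<circ> \<pi>) p = 0}"
    then obtain y where y: "\<pi> p = q * y" using q(2) by (metis (mono_tags, lifting) comp_apply imageE mem_Collect_eq)
    obtain c where c: "c \<in> poly_ring n" "y = \<pi> c" using \<pi>_surj by (metis UNIV_I imageE)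
    have "\<pi> (p - c * f) = 0"
      using p c f(2) fR y by (simp add: \<pi>_diff \<pi>_mult poly_ring_mult mult.commute)
    then have "p - c * f \<in> poly_ideal n fs" using I p c(1) fR poly_ring_diff poly_ring_mult by blast
    moreover have "p = (p - c * f) + c * f" by simp
    ultimately show "p \<in> poly_ideal n (fs @ [f])" unfolding poly_ideal_snoc using c(1) by blast
  next
    fix p assume "p \<in> poly_ideal n (fs @ [f])"
    then obtain x c where xc: "p = x + c * f" "x \<in> poly_ideal n fs" "c \<in> poly_ring n"
      unfolding poly_ideal_snoc by blast
    have x: "x \<in> poly_ring n" "\<pi> x = 0" using xc(2) I by auto
    have "\<phi> q = 0" using q(2) by (metis (mono_tags) mem_Collect_eq mult_1_right rangeI)
    then have "(\<phi> \<circ> \<pi>) p = 0" unfolding xc(1) using x xc(3) fR f(2)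
      by (simp add: \<pi>_add \<pi>_mult poly_ring_mult \<phi>_mult)
    moreover have "p \<in> poly_ring n" unfolding xc(1) using x xc(3) fR by (intro poly_ring_add poly_ring_mult)
    ultimately show "p \<in> {p \<in> poly_ring n. (\<phi> \<circ> \<pi>) p = 0}" by blast
  qed
  have "homogeneous_regular_sequence n (fs @ [f])"
    unfolding homogeneous_regular_sequence_def
  proof (intro conjI ballI allI impI)
    show "\<exists>d. g \<in> poly_part n d" if "g \<in> set (fs @ [f])" for g using that hom f(1) by auto
    have "(\<phi> \<circ> \<pi>) 1 = 1" by (simp add: \<pi>_1 \<phi>_1)
    then have "1 \<notin> poly_ideal n (fs @ [f])" unfolding ker[symmetric] by simp
    then show "poly_ideal n (fs @ [f]) \<noteq> poly_ring n" using poly_ring_1[of n] by blast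
    fix i p assume i: "i < length (fs @ [f])" and p: "p \<in> poly_ring n"
      and ip: "(fs @ [f]) ! i * p \<in> poly_ideal n (take i (fs @ [f]))"
    show "p \<in> poly_ideal n (take i (fs @ [f]))"
    proof (cases "i < length fs")
      case True
      then show ?thesis using reg p ip by (simp add: nth_append)
    next
      case False
      then have "i = length fs" using i by simp
      then have "f * p \<in> poly_ideal n fs" using ip by simp
      then have "q * \<pi> p = 0" using I \<pi>_mult[OF fR p] f(2) by simp
      then have "p \<in> poly_ideal n fs" using q(3) I p by blast
      then show ?thesis using \<open>i = length fs\<close> by simp
    qed
  qed
  then show ?thesis unfolding complete_intersection_def using ker presentation_comp[OF *(2)] by blast
qed

end

section \<open>Behaviour of the quotient of Hilbert series at 1\<close>

lemma conv_radius_ge_1_if_bounded: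
  fixes v :: "real fps"
  assumes "\<And>n. \<bar>fps_nth v n\<bar> \<le> 1"
  shows "fps_conv_radius v \<ge> 1"
  unfolding fps_conv_radius_def
proof (rule conv_radius_geI_ex')
  fix r :: real assume r: "0 < r" "ereal r < 1"
  show "summable (\<lambda>n. fps_nth v n * of_real r ^ n)"
  proof (rule summable_comparison_test')
    show "summable (\<lambda>n. r ^ n)" using r by (intro summable_geometric) auto
    show "norm (fps_nth v n * of_real r ^ n) \<le> r ^ n" for n
      using mult_right_mono[OF assms[of n], of "r ^ n"] r by (simp add: abs_mult)
  qed
qed

text \<open>
  This class is closed under products, which gives convergence of a quotient on the open unit disc
  without any discussion of the zeros of its denominator.
\<close>
definition unit_on_disc :: "real fps \<Rightarrow> bool" where
  "unit_on_disc f \<longleftrightarrow> (\<exists>v. f * v = 1 \<and> fps_conv_radius v \<ge> 1)"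

lemma unit_on_disc_mult:
  assumes "unit_on_disc f" "unit_on_disc g"
  shows "unit_on_disc (f * g)"
proof -
  obtain v w where vw: "f * v = 1" "fps_conv_radius v \<ge> 1" "g * w = 1" "fps_conv_radius w \<ge> 1"
    using assms unfolding unit_on_disc_def by blast
  have "(f * g) * (v * w) = (f * v) * (g * w)" by (simp only: ac_simps)
  moreover have "fps_conv_radius (v * w) \<ge> 1"
    using fps_conv_radius_mult[of v w] vw(2,4) by (meson min.boundedI order_trans)
  ultimately show ?thesis unfolding unit_on_disc_def using vw(1,3) by auto
qed

lemma unit_on_disc_1: "unit_on_disc 1"
  unfolding unit_on_disc_def by (intro exI[of _ 1]) simp

lemma unit_on_disc_power: "unit_on_disc f \<Longrightarrow> unit_on_disc (f ^ n)"
  by (induction n) (auto intro: unit_on_disc_1 unit_on_disc_mult)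

lemma unit_on_disc_geometric:
  assumes "d > 0" "\<bar>c\<bar> = 1"
  shows "unit_on_disc (1 - fps_const c * fps_X ^ d)"
proof -
  define v where "v = Abs_fps (\<lambda>n. if d dvd n then c ^ (n div d) else 0)"
  have "v - fps_X ^ d * (fps_const c * v) = 1"
  proof (rule fps_ext)
    fix n
    show "fps_nth (v - fps_X ^ d * (fps_const c * v)) n = fps_nth 1 n"
    proof (cases "n < d")
      case True
      then show ?thesis using assms(1) by (auto simp: v_def fps_X_power_mult_nth dest: dvd_imp_le)
    next
      case False
      then obtain m where n: "n = m + d" by (metis add.commute le_add_diff_inverse not_less)
      then show ?thesis using assms(1) by (auto simp: v_def fps_X_power_mult_nth)
    qed
  qed
  then have "(1 - fps_const c * fps_X ^ d) * v = 1" by (simp add: algebra_simps)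
  moreover have "fps_conv_radius v \<ge> 1"
    by (rule conv_radius_ge_1_if_bounded) (simp add: v_def power_abs assms(2))
  ultimately show ?thesis unfolding unit_on_disc_def by blast
qed

text \<open>
  The power series \<open>f(-z)\<close> with real coefficients.
\<close>
definition at_minus :: "int fps \<Rightarrow> real fps" where
  "at_minus f = Abs_fps (\<lambda>n. (-1) ^ n * real_of_int (fps_nth f n))"

lemma at_minus_nth [simp]: "fps_nth (at_minus f) n = (-1) ^ n * real_of_int (fps_nth f n)"
  by (simp add: at_minus_def)

lemma at_minus_mult: "at_minus (f * g) = at_minus f * at_minus g"
proof (rule fps_ext)
  fix n
  have "(\<Sum>i=0..n. (-1) ^ n * real_of_int (fps_nth f i * fps_nth g (n - i)))
    = (\<Sum>i=0..n. (-1) ^ i * real_of_int (fps_nth f i) * ((-1) ^ (n - i) * real_of_int (fps_nth g (n - i))))"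
  proof (rule sum.cong[OF refl])
    fix i assume "i \<in> {0..n}"
    then have "(-1::real) ^ n = (-1) ^ i * (-1) ^ (n - i)" by (simp flip: power_add)
    then show "(-1) ^ n * real_of_int (fps_nth f i * fps_nth g (n - i))
      = (-1) ^ i * real_of_int (fps_nth f i) * ((-1) ^ (n - i) * real_of_int (fps_nth g (n - i)))" by simp
  qed
  then show "fps_nth (at_minus (f * g)) n = fps_nth (at_minus f * at_minus g) n"
    by (simp add: fps_mult_nth sum_distrib_left)
qed

lemma at_minus_1: "at_minus 1 = 1" by (rule fps_ext) simp

lemma at_minus_power: "at_minus (f ^ n) = at_minus f ^ n"
  by (induction n) (simp_all add: at_minus_1 at_minus_mult)

lemma at_minus_1_minus_X: "at_minus (1 - fps_X) = 1 + fps_X"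
  by (rule fps_ext) (simp add: fps_X_def)

lemma at_minus_factor: "at_minus (1 - fps_X ^ d) = 1 - fps_const ((-1) ^ d) * fps_X ^ d"
  by (rule fps_ext) (auto simp: fps_X_power_iff)

abbreviation real_poly :: "int poly \<Rightarrow> real poly" where "real_poly \<equiv> map_poly real_of_int"

lemma real_poly_mult: "real_poly (p * q) = real_poly p * real_poly q"
  by (rule poly_eqI) (simp add: coeff_map_poly coeff_mult)

lemma real_poly_power: "real_poly (p ^ n) = real_poly p ^ n"
  by (induction n) (simp_all add: real_poly_mult)

lemma poly_real_poly: "poly (real_poly p) (real_of_int x) = real_of_int (poly p x)"
  by (induction p) (simp_all add: map_poly_pCons)

lemma at_minus_poly: "at_minus (fps_of_poly p) = fps_of_poly (pcompose (real_poly p) [:0, -1:])"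
  by (rule fps_ext) (simp add: coeff_pcompose_linear coeff_map_poly)

text \<open>
  In \<open>1 - N(x) = h\<^sub>R(-x) (1 + x)\<^sup>n / ((1 + x)\<^sup>e \<Prod>\<^sub>i (1 - (-x)\<^bsup>d\<^sub>i\<^esup>))\<close> all factors other than \<open>h\<^sub>R(-x)\<close> are
  positive on \<open>(0, 1)\<close>, and \<open>h\<^sub>R(-x) = g(-x) (1 - x)\<^sup>a\<close> has the sign of \<open>g(-1)\<close> near 1. If that sign
  is positive, then \<open>N(x) < 1\<close> for all \<open>x < 1\<close> close to 1, and the sum of the coefficients of \<open>N\<close> is at most 1.
\<close>
lemma positive_value_imp_monomial:
  fixes N HR HQ :: "int fps"
  assumes N: "\<And>n. fps_nth N n \<ge> 0"
    and HRQ: "HR = HQ * (1 - alternate N)"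
    and HR: "HR * (1 - fps_X) ^ e = fps_of_poly h"
    and h: "h = g * [:1, 1:] ^ a"
    and ds: "\<forall>d\<in>set ds. d > 0"
    and HQ: "HQ * (1 - fps_X) ^ n = (\<Prod>d\<leftarrow>ds. 1 - fps_X ^ d)"
    and g: "poly g (-1) > 0"
  shows "N = 0 \<or> (\<exists>m. N = fps_X ^ m)"
proof (rule ccontr)
  assume contra: "\<not> (N = 0 \<or> (\<exists>m. N = fps_X ^ m))"
  then obtain p where "fps_nth N p \<noteq> 0" by (metis fps_ext fps_zero_nth)
  then have p: "fps_nth N p \<ge> 1" using N[of p] by linarith
  have "N \<noteq> fps_X ^ p" using contra by blast
  then obtain q where q: "fps_nth N q \<noteq> fps_nth (fps_X ^ p) q" by (metis fps_ext)
  \<comment> \<open>Finitely many coefficients suffice to push the sum to 2.\<close>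
  obtain S where S: "finite S" "(\<Sum>i\<in>S. fps_nth N i) \<ge> 2"
  proof (cases "q = p")
    case True
    then show ?thesis using that[of "{p}"] p q by (simp add: fps_X_power_iff)
  next
    case False
    then have "fps_nth N q \<ge> 1" using q N[of q] by (simp add: fps_X_power_iff)
    then show ?thesis using that[of "{p, q}"] p False by simp
  qed
  define Nr :: "real fps" where "Nr = Abs_fps (\<lambda>n. real_of_int (fps_nth N n))"
  have Nr: "at_minus (1 - alternate N) = 1 - Nr"
    by (rule fps_ext) (simp add: Nr_def distrib_left[symmetric] power_mult_distrib[symmetric] right_diff_distrib mult.assoc[symmetric])
  define Dp :: "real poly" where "Dp = (\<Prod>d\<leftarrow>ds. 1 - monom ((-1) ^ d) d) * [:1, 1:] ^ e"
  define Hp where "Hp = pcompose (real_poly h) [:0, -1:]"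
  have X1: "fps_of_poly [:1, 1:] = 1 + (fps_X :: real fps)"
    by (simp add: fps_of_poly_pCons)
  have prod: "at_minus (\<Prod>d\<leftarrow>ds. 1 - fps_X ^ d) = fps_of_poly (\<Prod>d\<leftarrow>ds. 1 - monom ((-1) ^ d) d)"
    by (induction ds) (simp_all add: at_minus_1 at_minus_mult at_minus_factor fps_of_poly_mult fps_of_poly_diff fps_of_poly_monom)
  have "HR * (1 - fps_X) ^ e * (1 - fps_X) ^ n = (HQ * (1 - fps_X) ^ n) * (1 - fps_X) ^ e * (1 - alternate N)"
    unfolding HRQ by (simp only: ac_simps)
  then have "at_minus (fps_of_poly h * (1 - fps_X) ^ n) = at_minus ((\<Prod>d\<leftarrow>ds. 1 - fps_X ^ d) * (1 - fps_X) ^ e * (1 - alternate N))"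
    unfolding HR HQ by simp
  then have main: "fps_of_poly (Hp * [:1, 1:] ^ n) = fps_of_poly Dp * (1 - Nr)"
    unfolding at_minus_mult at_minus_power at_minus_1_minus_X Nr prod at_minus_poly Dp_def Hp_def
    by (simp add: fps_of_poly_mult fps_of_poly_power X1)
  \<comment> \<open>A priori \<open>N\<close> is only a formal series; it converges on \<open>(0, 1)\<close> as a polynomial divided by a unit.\<close>
  have "unit_on_disc (fps_of_poly (\<Prod>d\<leftarrow>ds. 1 - monom ((-1) ^ d) d))" using ds
    by (induction ds)
       (auto simp: fps_of_poly_mult fps_of_poly_diff fps_of_poly_monom intro!: unit_on_disc_1 unit_on_disc_mult unit_on_disc_geometric)
  moreover have "unit_on_disc (1 + fps_X)" using unit_on_disc_geometric[of 1 "-1"] by (simp flip: fps_const_neg)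
  ultimately have "unit_on_disc (fps_of_poly Dp)"
    unfolding Dp_def fps_of_poly_mult fps_of_poly_power X1 by (intro unit_on_disc_mult unit_on_disc_power)
  then obtain v where v: "fps_of_poly Dp * v = 1" "fps_conv_radius v \<ge> 1" unfolding unit_on_disc_def by blast
  have "1 - Nr = (fps_of_poly Dp * v) * (1 - Nr)" using v(1) by simp
  also have "\<dots> = v * (fps_of_poly Dp * (1 - Nr))" by (simp only: ac_simps)
  finally have "Nr = 1 - v * fps_of_poly (Hp * [:1, 1:] ^ n)" unfolding main by (simp add: algebra_simps)
  then have rad: "fps_conv_radius Nr \<ge> 1"
    using fps_conv_radius_diff[of 1 "v * fps_of_poly (Hp * [:1, 1:] ^ n)"]
      fps_conv_radius_mult[of v "fps_of_poly (Hp * [:1, 1:] ^ n)"] v(2)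
    by (simp add: min_def split: if_splits)
  have less_1: "eval_fps Nr x < 1" if x: "0 < x" "x < 1" and gx: "poly (real_poly g) (- x) > 0" for x
  proof -
    have xr: "ereal (norm x) < fps_conv_radius Nr" using rad x less_le_trans[of "ereal x" 1] by simp
    have "eval_fps (fps_of_poly Dp * (1 - Nr)) x = poly Dp x * (1 - eval_fps Nr x)"
    proof -
      have r: "ereal (norm x) < fps_conv_radius (1 - Nr)"
        using fps_conv_radius_diff[of 1 Nr] xr by (simp add: min_def split: if_splits)
      show ?thesis using r xr by (simp add: eval_fps_mult eval_fps_diff)
    qed
    then have "poly Hp x * (1 + x) ^ n = poly Dp x * (1 - eval_fps Nr x)"
      unfolding main[symmetric] by simp
    moreover have "poly Hp x > 0"
      unfolding Hp_def h real_poly_mult real_poly_power using gx x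
      by (simp add: poly_pcompose map_poly_pCons)
    moreover have "poly Dp x > 0"
    proof -
      have "poly (\<Prod>d\<leftarrow>ds. 1 - monom ((-1) ^ d) d) x > 0" using ds
      proof (induction ds)
        case (Cons d ds)
        have "(-1) ^ d * x ^ d = (- x) ^ d" by (simp add: power_mult_distrib[symmetric])
        moreover have "(- x) ^ d < 1"
        proof -
          have "(- x) ^ d \<le> \<bar>(- x) ^ d\<bar>" by (rule abs_ge_self)
          also have "\<dots> = x ^ d" using x by (simp add: power_abs)
          also have "\<dots> < 1" using x Cons.prems by (simp add: power_less_one_iff)
          finally show ?thesis .
        qed
        ultimately show ?case using Cons by (simp add: poly_monom)
      qed simp
      then show ?thesis unfolding Dp_def using x by simp
    qed
    ultimately have "poly Dp x * (1 - eval_fps Nr x) > 0" using x by (metis add_pos_pos mult_pos_pos zero_less_one zero_less_power)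
    then show ?thesis using \<open>poly Dp x > 0\<close> by (simp add: zero_less_mult_iff)
  qed
  have ge: "(\<Sum>i\<in>S. real_of_int (fps_nth N i) * x ^ i) \<le> eval_fps Nr x" if x: "0 < x" "x < 1" for x
  proof -
    have xr: "ereal (norm x) < fps_conv_radius Nr" using rad x less_le_trans[of "ereal x" 1] by simp
    have "(\<Sum>i\<in>S. fps_nth Nr i * x ^ i) \<le> suminf (\<lambda>i. fps_nth Nr i * x ^ i)"
      using summable_fps[OF xr] N x by (intro sum_le_suminf[OF _ S(1)]) (auto simp: Nr_def)
    then show ?thesis by (simp add: eval_fps_def Nr_def)
  qed
  have "((\<lambda>x. \<Sum>i\<in>S. real_of_int (fps_nth N i) * x ^ i) \<longlongrightarrow> (\<Sum>i\<in>S. real_of_int (fps_nth N i) * 1 ^ i)) (at_left 1)"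
    by (intro tendsto_intros)
  moreover have "(\<Sum>i\<in>S. real_of_int (fps_nth N i) * 1 ^ i) > 1"
    using S(2) by (simp flip: of_int_sum)
  ultimately have "eventually (\<lambda>x. (\<Sum>i\<in>S. real_of_int (fps_nth N i) * x ^ i) > 1) (at_left 1)"
    by (rule order_tendstoD(1))
  moreover have "((\<lambda>x. poly (real_poly g) (- x)) \<longlongrightarrow> poly (real_poly g) (- 1)) (at_left 1)"
    by (intro tendsto_intros)
  then have "eventually (\<lambda>x. poly (real_poly g) (- x) > 0) (at_left 1)"
    by (rule order_tendstoD(1)) (use g poly_real_poly[of g "-1"] in simp)
  moreover have "eventually (\<lambda>x. 0 < x \<and> x < 1) (at_left (1::real))"
    using eventually_at_left_real[of 0 "1::real"] by simp
  ultimately have "eventually (\<lambda>x::real. False) (at_left 1)"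
  proof eventually_elim
    case (elim x)
    then show ?case using less_1[of x] ge[of x] by linarith
  qed
  then show False by simp
qed

section \<open>The sign of the h-polynomial near -1\<close>

theorem corollary3p13:
  fixes R :: "('k::field, 'a::comm_ring_1) graded_algebra"
    and h g :: "int poly" and a :: nat
  assumes "standard_graded R"
    and "is_h_polynomial R h"
    and "a = order (-1) h"
    and "h = g * [:1, 1:] ^ a"
    and "poly g (-1) \<noteq> 0"
    and "koszul R"
    and "backelin_roos TYPE('q::comm_ring_1) R"
    and "\<not> complete_intersection R"
  shows "poly g (-1) < 0"
proof (rule ccontr)
  assume "\<not> poly g (-1) < 0"
  then have g: "poly g (-1) > 0" using assms(5) by linarith
  obtain Q :: "('k, 'q) graded_algebra" and \<phi> where
    Q: "standard_graded Q" "complete_intersection Q" "golod Q R \<phi>"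
    using assms(7) unfolding backelin_roos_def by blast
  interpret Q: std_graded Q by unfold_locales fact
  interpret R: std_graded R by unfold_locales fact
  interpret graded_surjection Q R \<phi>
    by unfold_locales (use Q(3) in \<open>auto simp: golod_def\<close>)
  let ?T = "betti Q (restrict_scalars \<phi> R)"
  obtain N where N: "\<And>n. fps_nth N n \<ge> 0" "fps_nth N 2 = int (?T 1 2)" "\<And>j. j \<noteq> 2 \<Longrightarrow> ?T 1 j = 0"
    "hilbert_series R = hilbert_series Q * (1 - alternate N)"
    using golod_koszul[OF Q(1) assms(1) Q(3) assms(6)] by blast
  obtain n ds where ds: "\<forall>d\<in>set ds. d > 0"
    "hilbert_series Q * (1 - fps_X) ^ n = (\<Prod>d\<leftarrow>ds. 1 - fps_X ^ d)"
    by (rule complete_intersection_hilbert_series[OF Q(1,2)])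
  obtain e where e: "hilbert_series R * (1 - fps_X) ^ e = fps_of_poly h"
    using assms(2) unfolding is_h_polynomial_def by blast
  have "N = 0 \<or> (\<exists>m. N = fps_X ^ m)"
    by (rule positive_value_imp_monomial[OF N(1,4) e assms(4) ds g])
  moreover have "complete_intersection R" if "N = 0"
  proof (rule complete_intersection_if_injective[OF Q(2)])
    have "alternate N = 0" using that by (intro fps_ext) simp
    then have "hilbert_series R = hilbert_series Q" using N(4) by simp
    then show "u = 0" if "\<phi> u = 0" for u using inj_if_hilbert_series_eq that by blast
  qed
  moreover have "complete_intersection R" if m: "N = fps_X ^ m" "m \<noteq> 2" for m
  proof (rule complete_intersection_if_injective[OF Q(2)])
    have "?T 1 j = 0" for j using N(2) N(3)[of j] m by (cases "j = 2") (simp_all add: fps_X_power_iff)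
    then show "u = 0" if "\<phi> u = 0" for u using ker_subset_ideal[of "{0}" u] that by auto
  qed
  moreover have "complete_intersection R" if m: "N = fps_X ^ 2"
  proof -
    have "alternate N = fps_X ^ 2" unfolding m by (rule fps_ext) (simp add: fps_X_power_iff)
    then have "hilbert_series R = hilbert_series Q * (1 - fps_X ^ 2)" using N(4) by simp
    then obtain q where "q \<in> part Q 2" "{u. \<phi> u = 0} = range ((*) q)" "\<forall>y. q * y = 0 \<longrightarrow> y = 0"
      by (rule ker_principal_regular[OF _ N(3)])
    then show ?thesis by (rule complete_intersection_if_regular_quotient[OF Q(2)])
  qed
  ultimately show False using assms(8) by blast
qed

end
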